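(* Let $X$ be an infinite dimensional complex Banach space which has cotype $p$ for some $2\le p<\infty$. Then $G_a(X)=1-\dfrac{1}{\operatorname{Cot}(X)}$.
   Context: Cotype: for $2\le p<\infty$ a Banach space $Y$ has cotype $p$ if there is a constant $C>0$ such that for each choice of finitely many $x_1,\dots,x_N\in Y$ one has $\big(\sum_{n=1}^N\|x_n\|^p\big)^{1/p}\le C\big(\int_0^1\big\|\sum_{n=1}^N r_n(t)x_n\big\|^2dt\big)^{1/2}$, where $r_n$ is the $n$-th Rademacher function on $[0,1]$. Every Banach space has cotype $\infty$ (with $\max_n\|x_n\|$ on the left-hand side). Put $\operatorname{Cot}(Y):=\inf\{2\le p\le\infty : Y\text{ has cotype }p\}$. $X'$ denotes the topological dual of $X$. For a Dirichlet series $D=\sum_n a_n\frac1{n^s}$ with coefficients in a complex Banach space $X$ (variable $s\in\mathbb{C}$), set $\sigma_c(D):=\inf\{r\in\mathbb{R}:\sum_n a_n\frac1{n^s}\text{ converges in }X\text{ for all } s \text{ with }\operatorname{Re}s>r\}$ and $\sigma_a(D):=\inf\{r\in\mathbb{R}:\sum_n \|a_n\|\,|n^{-s}|<+\infty\text{ for all } s \text{ with }\operatorname{Re}s>r\}$, infima being taken in the extended real line. For $x'\in X'$, $x'(D):=\sum_n x'(a_n)\frac1{n^s}$ is a scalar Dirichlet series, and $\sigma_a^w(D):=\sup_{x'\in X'}\sigma_a(x'(D))$. The gap for absolute convergence of Dirichlet series in $X$ is $G_a(X):=\sup_D(\sigma_a(D)-\sigma_a^w(D))$, the supremum being over all Dirichlet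 series $D$ with coefficients in $X$ such that $\sigma_c(D)<+\infty$ (convention: the difference is taken to be $0$ when both abscissas are $-\infty$). *)

theory Defs
  imports "HOL-Analysis.Analysis"
begin

section \<open>Complex Banach spaces\<close>

class complex_normed_vector = real_normed_vector +
  fixes scaleC :: "complex \<Rightarrow> 'a \<Rightarrow> 'a"  (infixr \<open>*\<^sub>C\<close> 75)
  assumes scaleC_add_right: "c *\<^sub>C (x + y) = c *\<^sub>C x + c *\<^sub>C y"
    and scaleC_add_left: "(c + d) *\<^sub>C x = c *\<^sub>C x + d *\<^sub>C x"
    and scaleC_scaleC: "c *\<^sub>C d *\<^sub>C x = (c * d) *\<^sub>C x"
    and scaleC_of_real: "complex_of_real r *\<^sub>C x = r *\<^sub>R x"
    and norm_scaleC: "norm (c *\<^sub>C x) = cmod c * norm x"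

class complex_banach = complex_normed_vector + banach

global_interpretation complex_vector:
  vector_space "scaleC :: complex \<Rightarrow> 'a::complex_normed_vector \<Rightarrow> 'a"
proof
  fix c d :: complex and x y :: 'a
  show "c *\<^sub>C (x + y) = c *\<^sub>C x + c *\<^sub>C y" by (rule scaleC_add_right)
  show "(c + d) *\<^sub>C x = c *\<^sub>C x + d *\<^sub>C x" by (rule scaleC_add_left)
  show "c *\<^sub>C d *\<^sub>C x = (c * d) *\<^sub>C x" by (rule scaleC_scaleC)
  show "1 *\<^sub>C x = x" using scaleC_of_real[of 1 x] by simp
qed

definition infinite_dimensional :: "'a::complex_normed_vector itself \<Rightarrow> bool" where
  "infinite_dimensional _ \<longleftrightarrow>
     \<not> (\<exists>B::'a set. finite B \<and> complex_vector.span B = UNIV)"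

definition dual_space :: "('a::complex_normed_vector \<Rightarrow> complex) set" where
  "dual_space = {f. bounded_linear f \<and> (\<forall>c x. f (c *\<^sub>C x) = c * f x)}"


section \<open>Cotype\<close>

definition rademacher :: "nat \<Rightarrow> real \<Rightarrow> real" where
  "rademacher n t = sgn (sin (2 ^ n * pi * t))"

text \<open>The left-hand side of the cotype inequality, for \<open>p\<close> in \<open>[2, \<infinity>]\<close>; the extra \<open>0\<close>
  only matters for the empty family.\<close>

definition cotype_lhs :: "ereal \<Rightarrow> nat \<Rightarrow> (nat \<Rightarrow> 'a::real_normed_vector) \<Rightarrow> real" where
  "cotype_lhs p N x =
     (if p = \<infinity> then Max (insert 0 ((\<lambda>n. norm (x n)) ` {1..N}))
      else (\<Sum>n=1..N. norm (x n) powr real_of_ereal p) powr (1 / real_of_ereal p))"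

definition has_cotype :: "'a::real_normed_vector itself \<Rightarrow> ereal \<Rightarrow> bool" where
  "has_cotype _ p \<longleftrightarrow>
     (\<exists>C>0. \<forall>N. \<forall>x :: nat \<Rightarrow> 'a.
        cotype_lhs p N x
          \<le> C * sqrt (LINT t:{0..1}|lborel. (norm (\<Sum>n=1..N. rademacher n t *\<^sub>R x n))\<^sup>2))"

definition Cot :: "'a::real_normed_vector itself \<Rightarrow> ereal" where
  "Cot T = Inf {p. 2 \<le> p \<and> has_cotype T p}"


section \<open>Dirichlet series and their abscissas\<close>

text \<open>A Dirichlet series is given by its coefficient sequence \<open>a\<close>. It starts at index \<open>1\<close>, so
  the value \<open>a 0\<close> is never used.\<close>

definition abscissa_conv :: "(nat \<Rightarrow> 'a::complex_normed_vector) \<Rightarrow> ereal" where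
  "abscissa_conv a =
     Inf {ereal r | r. \<forall>s. Re s > r \<longrightarrow>
            summable (\<lambda>n. (of_nat (Suc n) powr (- s)) *\<^sub>C a (Suc n))}"

definition abscissa_abs_conv :: "(nat \<Rightarrow> 'a::real_normed_vector) \<Rightarrow> ereal" where
  "abscissa_abs_conv a =
     Inf {ereal r | r. \<forall>s. Re s > r \<longrightarrow>
            summable (\<lambda>n. norm (a (Suc n)) * cmod (of_nat (Suc n) powr (- s)))}"

definition abscissa_weak_abs_conv :: "(nat \<Rightarrow> 'a::complex_normed_vector) \<Rightarrow> ereal" where
  "abscissa_weak_abs_conv a = (SUP f\<in>dual_space. abscissa_abs_conv (\<lambda>n. f (a n)))"

text \<open>The difference of two \<open>-\<infinity>\<close> has to be set to \<open>0\<close> explicitly, since \<open>ereal\<close> subtraction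
  gives \<open>- \<infinity> - (- \<infinity>) = \<infinity>\<close>.\<close>

definition abs_conv_gap :: "(nat \<Rightarrow> 'a::complex_normed_vector) \<Rightarrow> ereal" where
  "abs_conv_gap a =
     (if abscissa_abs_conv a = - \<infinity> \<and> abscissa_weak_abs_conv a = - \<infinity> then 0
      else abscissa_abs_conv a - abscissa_weak_abs_conv a)"

definition G_a :: "'a::complex_normed_vector itself \<Rightarrow> ereal" where
  "G_a _ = (SUP a\<in>{a :: nat \<Rightarrow> 'a. abscissa_conv a < \<infinity>}. abs_conv_gap a)"

end

theory Submission
  imports Defs "HOL-Library.Ramsey"
begin

text \<open>Everything reduces to the (q,1)-summing property of the identity: the q-th power sum of the
  norms of finitely many vectors is controlled by the largest norm of their signed sums.

  Weak absolute convergence makes the normalised coefficients weakly summable, so by uniform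
  boundedness all their signed sums are bounded. Cotype q then gives q-summable norms, and Young's
  inequality bounds the gap by 1 - 1/q. Conversely, if the identity is not (q,1)-summing, there are
  arbitrarily long families of N vectors of norm at least N^(-1/s), s < q, all of whose signed sums
  are at most 1; placing them on dyadically separated blocks of coefficients gives a Dirichlet
  series with gap at least 1 - 1/s.

  It remains to see that the (q,1)-summing property can only hold for q at least 2 and implies
  cotype t for all t > max q 2. If it held for some q < 2, every operator from a Euclidean space
  would have norms on the orthogonal complements of a greedy orthonormal system that decrease
  faster than any power, which fails for the operator defined by a basic sequence. For the second
  claim, assume that cotype t fails. A family that almost attains the cotype constant for its
  number of vectors satisfies, up to a constant, an upper t-estimate for the sign averages over
  disjoint groups of indices. Hence, off a small set of indices, the average over any group is at
  most a constant times the t-norm of the group. Among many vectors of about equal norm, Ramsey's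
  theorem provides a homogeneous set on which one pattern of signs is good for all subsets of a
  fixed size. Differences of neighbouring vectors of this set have small signed sums for every
  choice of signs, since each such sum is the difference of two sums with the fixed pattern. The
  differences can be chosen large because t > 2: on a cluster of vectors the average grows like the
  square root of its size. This contradicts the (q,1)-summing property.\<close>

section \<open>Norming functionals and uniform boundedness\<close>

definition sublinear :: "('a::real_vector \<Rightarrow> real) \<Rightarrow> bool" where
  "sublinear q \<longleftrightarrow> (\<forall>x y. q (x + y) \<le> q x + q y) \<and> (\<forall>c x. c \<ge> 0 \<longrightarrow> q (c *\<^sub>R x) = c * q x)"

lemma sublinear_add: "sublinear q \<Longrightarrow> q (x + y) \<le> q x + q y"
  and sublinear_scale: "sublinear q \<Longrightarrow> c \<ge> 0 \<Longrightarrow> q (c *\<^sub>R x) = c * q x"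
  unfolding sublinear_def by auto

lemma sublinear_0: "sublinear q \<Longrightarrow> q 0 = 0"
  using sublinear_scale[of q 0 0] by simp

lemma sublinear_minus_ge: "sublinear q \<Longrightarrow> - q (- x) \<le> q x"
  using sublinear_add[of q x "- x"] sublinear_0[of q] by simp

text \<open>One inequality for positive scalars suffices: applied to \<open>1 / c\<close> and
  \<open>c *\<^sub>R x\<close> it gives the reverse one.\<close>

lemma sublinearI:
  assumes add: "\<And>x y. q (x + y) \<le> q x + q y"
    and zero: "q 0 = 0" and scale: "\<And>c x. c > 0 \<Longrightarrow> q (c *\<^sub>R x) \<le> c * q x"
  shows "sublinear q"
  unfolding sublinear_def
proof (intro conjI allI impI add)
  fix c :: real and x
  assume "c \<ge> 0"
  show "q (c *\<^sub>R x) = c * q x"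
  proof (cases "c = 0")
    case True
    then show ?thesis by (simp add: zero)
  next
    case False
    then have c: "c > 0" using \<open>c \<ge> 0\<close> by simp
    have "q x \<le> (1 / c) * q (c *\<^sub>R x)"
      using scale[of "1 / c" "c *\<^sub>R x"] c by simp
    then have "c * q x \<le> q (c *\<^sub>R x)"
      using c by (simp add: field_simps)
    then show ?thesis using scale[OF c, of x] by simp
  qed
qed

text \<open>Lowering a sublinear functional in the direction z; a minimal one is not lowered, which
  forces additivity.\<close>

lemma sublinear_shift:
  fixes z :: "'a::real_vector"
  assumes q: "sublinear q"
  obtains q' where "sublinear q'" "\<And>x t. t \<ge> 0 \<Longrightarrow> q' x \<le> q (x + t *\<^sub>R z) - t * q z"
proof -
  define F where "F x t = q (x + t *\<^sub>R z) - t * q z" for x t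
  define q' where "q' x = (INF t\<in>{0..}. F x t)" for x
  \<comment> \<open>This bound does not depend on \<open>t\<close>, so the infimum defining
    \<open>q'\<close> is a genuine one.\<close>
  have lower: "- q (- x) \<le> F x t" if "t \<ge> 0" for x t
    using sublinear_add[OF q, of "x + t *\<^sub>R z" "- x"] sublinear_scale[OF q that, of z]
    by (simp add: F_def)
  have bdd: "bdd_below (F x ` {0..})" for x
    by (rule bdd_belowI2[of _ "- q (- x)"]) (simp add: lower)
  have le: "q' x \<le> F x t" if "t \<ge> 0" for x t
    unfolding q'_def using that bdd by (intro cINF_lower) auto
  have ge: "c \<le> q' x" if "\<And>t. t \<ge> 0 \<Longrightarrow> c \<le> F x t" for c x
    unfolding q'_def using that by (intro cINF_greatest) auto
  have "sublinear q'"
  proof (rule sublinearI)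
    fix x y
    have "q' (x + y) \<le> F x s + F y t" if "s \<ge> 0" "t \<ge> 0" for s t
    proof -
      have "q' (x + y) \<le> F (x + y) (s + t)" using that by (intro le) simp
      also have "\<dots> \<le> F x s + F y t"
        using sublinear_add[OF q, of "x + s *\<^sub>R z" "y + t *\<^sub>R z"]
        by (simp add: F_def algebra_simps)
      finally show ?thesis .
    qed
    then have "q' (x + y) - F y t \<le> q' x" if "t \<ge> 0" for t
      using that by (intro ge) (simp add: algebra_simps)
    then have "q' (x + y) - q' x \<le> q' y"
      by (intro ge) (simp add: algebra_simps)
    then show "q' (x + y) \<le> q' x + q' y" by simp
  next
    have "F 0 t = 0" if "t \<ge> 0" for t
      using sublinear_scale[OF q that, of z] by (simp add: F_def)
    then show "q' 0 = 0" using le[of 0 0] ge[of 0 0] by fastforce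
  next
    fix c :: real and x assume c: "c > 0"
    have "q' (c *\<^sub>R x) / c \<le> F x t" if "t \<ge> 0" for t
    proof -
      have "q' (c *\<^sub>R x) \<le> F (c *\<^sub>R x) (c * t)" using that c by (intro le) simp
      also have "\<dots> = c * F x t"
        using sublinear_scale[OF q, of c "x + t *\<^sub>R z"] c by (simp add: F_def algebra_simps)
      finally show ?thesis using c by (simp add: field_simps)
    qed
    then have "q' (c *\<^sub>R x) / c \<le> q' x" by (rule ge)
    then show "q' (c *\<^sub>R x) \<le> c * q' x" using c by (simp add: field_simps)
  qed
  then show ?thesis using that le F_def by metis
qed

lemma minimal_sublinear_linear:
  fixes q :: "'a::real_vector \<Rightarrow> real"
  assumes q: "sublinear q" and minimal: "\<And>q'. sublinear q' \<Longrightarrow> (\<forall>x. q' x \<le> q x) \<Longrightarrow> q' = q"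
  shows "linear q"
proof -
  have add: "q (x + z) = q x + q z" for x z
  proof (rule antisym)
    show "q (x + z) \<le> q x + q z" by (rule sublinear_add[OF q])
    obtain q' where q': "sublinear q'" "\<And>x t. t \<ge> 0 \<Longrightarrow> q' x \<le> q (x + t *\<^sub>R z) - t * q z"
      using sublinear_shift[OF q] by blast
    \<comment> \<open>The case \<open>t = 0\<close> puts \<open>q'\<close> below \<open>q\<close>,
      so minimality applies; the case \<open>t = 1\<close> is then superadditivity.\<close>
    have "q' = q" using q'(2)[of 0] by (intro minimal q'(1)) simp
    then show "q x + q z \<le> q (x + z)" using q'(2)[of 1 x] by simp
  qed
  have minus: "q (- x) = - q x" for x
    using add[of x "- x"] sublinear_0[OF q] by simp
  show ?thesis
  proof (rule linearI[OF add])
    fix c x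
    show "q (c *\<^sub>R x) = c *\<^sub>R q x"
      using sublinear_scale[OF q, of c x] sublinear_scale[OF q, of "- c" x] minus[of "c *\<^sub>R x"]
      by (cases "c \<ge> 0") auto
  qed
qed

text \<open>Zorn's lemma for the reversed pointwise order: the pointwise infimum of a chain is again
  sublinear, and a minimal functional below \<open>p\<close> is linear by
  \<open>minimal_sublinear_linear\<close>.\<close>

lemma sublinear_dominates_linear:
  fixes p :: "'a::real_vector \<Rightarrow> real"
  assumes p: "sublinear p"
  obtains q where "linear q" "\<And>x. q x \<le> p x"
proof -
  define A where "A = {q. sublinear q \<and> (\<forall>x. q x \<le> p x)}"
  define P where "P q q' \<longleftrightarrow> (\<forall>x. q' x \<le> q x)" for q q' :: "'a \<Rightarrow> real"
  have "\<exists>m\<in>A. \<forall>a\<in>A. P m a \<longrightarrow> a = m"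
  proof (rule predicate_Zorn)
    show "partial_order_on A (relation_of P A)"
      by (rule partial_order_on_relation_ofI) (auto simp: P_def fun_eq_iff intro: order_trans antisym)
    fix C assume C: "C \<in> Chains (relation_of P A)"
    show "\<exists>u\<in>A. \<forall>a\<in>C. P a u"
    proof (cases "C = {}")
      case True
      then show ?thesis using p by (auto simp: A_def)
    next
      case False
      have CA: "C \<subseteq> A" and tot: "\<And>q r. q \<in> C \<Longrightarrow> r \<in> C \<Longrightarrow> P q r \<or> P r q"
        using C by (auto simp: Chains_def relation_of_def)
      have sub: "sublinear q" "q x \<le> p x" if "q \<in> C" for q x
        using CA that by (auto simp: A_def)
      define u where "u x = (INF q\<in>C. q x)" for x
      have "- p (- x) \<le> q x" if "q \<in> C" for q x
        using sublinear_minus_ge[OF sub(1)[OF that], of x] sub(2)[OF that, of "- x"] by simp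
      then have bdd: "bdd_below ((\<lambda>q. q x) ` C)" for x
        by (intro bdd_belowI2[of _ "- p (- x)"])
      have le: "u x \<le> q x" if "q \<in> C" for q x
        unfolding u_def using that bdd by (intro cINF_lower)
      have ge: "c \<le> u x" if "\<And>q. q \<in> C \<Longrightarrow> c \<le> q x" for c x
        unfolding u_def using that False by (intro cINF_greatest)
      have "sublinear u"
      proof (rule sublinearI)
        fix x y
        have "u (x + y) \<le> q x + r y" if qr: "q \<in> C" "r \<in> C" for q r
        proof -
          \<comment> \<open>Of \<open>q\<close> and \<open>r\<close> the chain contains a smaller
            one, which is below both; this makes the infimum subadditive.\<close>
          obtain s where s: "s \<in> C" "s x \<le> q x" "s y \<le> r y"
            using tot[OF qr] qr unfolding P_def by fastforce
          then show ?thesis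
            using le[OF s(1), of "x + y"] sublinear_add[OF sub(1)[OF s(1)], of x y] by linarith
        qed
        then have "u (x + y) - r y \<le> u x" if "r \<in> C" for r
          using that by (intro ge) (simp add: algebra_simps)
        then have "u (x + y) - u x \<le> u y"
          by (intro ge) (simp add: algebra_simps)
        then show "u (x + y) \<le> u x + u y" by simp
      next
        obtain q where "q \<in> C" using False by blast
        then have "u 0 \<le> 0" using le[of q 0] sublinear_0[OF sub(1)[of q]] by simp
        moreover have "0 \<le> u 0" using sublinear_0[OF sub(1)] by (intro ge) (metis order_refl)
        ultimately show "u 0 = 0" by simp
      next
        fix c :: real and x assume c: "c > 0"
        have "u (c *\<^sub>R x) / c \<le> q x" if "q \<in> C" for q
          using le[OF that, of "c *\<^sub>R x"] sublinear_scale[OF sub(1)[OF that], of c x] c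
          by (simp add: field_simps)
        then have "u (c *\<^sub>R x) / c \<le> u x" by (rule ge)
        then show "u (c *\<^sub>R x) \<le> c * u x" using c by (simp add: field_simps)
      qed
      moreover have "u x \<le> p x" for x
        using False le sub(2) order_trans by blast
      ultimately show ?thesis using le by (auto simp: A_def P_def)
    qed
  qed
  then obtain m where m: "m \<in> A" and min: "\<And>a. a \<in> A \<Longrightarrow> P m a \<Longrightarrow> a = m" by blast
  have "linear m"
  proof (rule minimal_sublinear_linear)
    show "sublinear m" using m by (simp add: A_def)
    fix q' assume "sublinear q'" "\<forall>x. q' x \<le> m x"
    then show "q' = m"
      using m order_trans by (intro min) (auto simp: A_def P_def intro: order_trans)
  qed
  then show ?thesis using that m by (auto simp: A_def)
qed

text \<open>The norm is first lowered in the direction \<open>z\<close>. Every linear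
  \<open>q\<close> below the lowered functional satisfies \<open>q (- z) \<le> - norm z\<close> and
  stays below the norm, so it attains the norm at \<open>z\<close>; no extension from a subspace is
  involved.\<close>

theorem norming_functional:
  fixes z :: "'a::real_normed_vector"
  obtains g :: "'a \<Rightarrow>\<^sub>L real" where "norm g \<le> 1" "blinfun_apply g z = norm z"
proof -
  have "sublinear (norm :: 'a \<Rightarrow> real)"
    by (simp add: sublinear_def norm_triangle_ineq)
  then obtain p :: "'a \<Rightarrow> real" where p: "sublinear p"
    "\<And>x t. t \<ge> 0 \<Longrightarrow> p x \<le> norm (x + t *\<^sub>R z) - t * norm z"
    using sublinear_shift[of norm z] by blast
  obtain q where q: "linear q" "\<And>x. q x \<le> p x"
    using sublinear_dominates_linear[OF p(1)] by blast
  have le: "q x \<le> norm x" for x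
    using p(2)[of 0 x] q(2)[of x] by simp
  have abs: "\<bar>q x\<bar> \<le> norm x" for x
    using le[of x] le[of "- x"] linear_neg[OF q(1), of x] by simp
  have "bounded_linear q"
    using abs by (intro bounded_linear_intro[where K=1] linear_add[OF q(1)] linear_cmul[OF q(1)]) auto
  then have ap: "blinfun_apply (Blinfun q) = q" by (rule bounded_linear_Blinfun_apply)
  have "q (- z) \<le> - norm z" using p(2)[of 1 "- z"] q(2)[of "- z"] by simp
  then have "q z = norm z" using le[of z] linear_neg[OF q(1), of z] by simp
  moreover have "norm (Blinfun q) \<le> 1"
    using abs by (intro norm_blinfun_bound) (auto simp: ap)
  ultimately show ?thesis using that[of "Blinfun q"] ap by simp
qed

text \<open>Baire's theorem applied to the closed sets of functionals for which the sum is at most k.\<close>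

lemma weakly_summable_bound:
  fixes y :: "nat \<Rightarrow> 'a::real_normed_vector"
  assumes "\<And>g :: 'a \<Rightarrow>\<^sub>L real. summable (\<lambda>n. \<bar>blinfun_apply g (y n)\<bar>)"
  shows "\<exists>K\<ge>0. \<forall>(g :: 'a \<Rightarrow>\<^sub>L real) N. (\<Sum>n<N. \<bar>blinfun_apply g (y n)\<bar>) \<le> K * norm g"
proof -
  define U where "U k = {g :: 'a \<Rightarrow>\<^sub>L real. \<forall>N. (\<Sum>n<N. \<bar>blinfun_apply g (y n)\<bar>) \<le> real k}" for k
  have closed: "closed (U k)" for k
    unfolding U_def
    by (intro closed_Collect_all closed_Collect_le continuous_intros)
  have cover: "(\<Union>k. U k) = UNIV"
  proof -
    have "g \<in> (\<Union>k. U k)" for g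
    proof -
      obtain k where "(\<Sum>n. \<bar>blinfun_apply g (y n)\<bar>) \<le> real k" using real_arch_simple by blast
      then show ?thesis
        using order_trans[OF sum_le_suminf[OF assms[of g], of "{..<_}"]] by (auto simp: U_def)
    qed
    then show ?thesis by auto
  qed
  have "\<exists>k. interior (U k) \<noteq> {}"
  proof (rule ccontr)
    assume "\<not> ?thesis"
    then have empty: "euclidean interior_of U k = {}" for k
      by simp
    have "euclidean interior_of \<Union> (range U) = {}"
      unfolding mtopology_is_euclidean[symmetric]
    proof (rule Met_TC.metric_Baire_category_alt)
      show "Met_TC.mcomplete TYPE('a \<Rightarrow>\<^sub>L real)" by (simp add: mcomplete_iff_complete complete_UNIV)
    qed (use closed empty in auto)
    then show False using cover by simp
  qed
  then obtain k g0 where "g0 \<in> interior (U k)" by blast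
  then obtain e where e: "e > 0" "ball g0 e \<subseteq> U k"
    unfolding mem_interior by blast
  have "(\<Sum>n<N. \<bar>blinfun_apply g (y n)\<bar>) \<le> (4 * real k / e) * norm g" for g N
  proof (cases "g = 0")
    case False
    \<comment> \<open>With this factor \<open>c *\<^sub>R g\<close> is the difference of two
      functionals in the ball around \<open>g0\<close>, and both of them obey the bound
      \<open>k\<close>.\<close>
    define c where "c = e / (2 * norm g)"
    have c: "c > 0" using False e by (simp add: c_def)
    have "norm (c *\<^sub>R g) < e" using False e(1) by (simp add: c_def)
    then have "g0 + c *\<^sub>R g \<in> U k" "g0 \<in> U k" using e by (auto simp: dist_norm)
    then have 1: "(\<Sum>n<N. \<bar>blinfun_apply (g0 + c *\<^sub>R g) (y n)\<bar>) \<le> k"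
      and 2: "(\<Sum>n<N. \<bar>blinfun_apply g0 (y n)\<bar>) \<le> k" by (auto simp: U_def)
    have "c * (\<Sum>n<N. \<bar>blinfun_apply g (y n)\<bar>)
        = (\<Sum>n<N. \<bar>blinfun_apply (g0 + c *\<^sub>R g) (y n) - blinfun_apply g0 (y n)\<bar>)"
      using c by (simp add: sum_distrib_left blinfun.add_left blinfun.scaleR_left abs_mult)
    also have "\<dots> \<le> (\<Sum>n<N. \<bar>blinfun_apply (g0 + c *\<^sub>R g) (y n)\<bar> + \<bar>blinfun_apply g0 (y n)\<bar>)"
      by (intro sum_mono abs_triangle_ineq4)
    also have "\<dots> \<le> 2 * real k" using 1 2 by (simp add: sum.distrib)
    finally show ?thesis using c False e(1) by (simp add: c_def field_simps)
  qed simp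
  moreover have "4 * real k / e \<ge> 0" using e by simp
  ultimately show ?thesis by blast
qed

section \<open>Basic sequences\<close>

text \<open>Induction on the equations. Two independent solutions of the old equations exist, the
  second found by forcing to zero an unknown on which the first does not vanish; either the second
  or a combination of both solves the new equation.\<close>

lemma homogeneous_system_nontrivial:
  fixes M :: "'j \<Rightarrow> 'i \<Rightarrow> real"
  assumes "finite J" "finite I" "card J < card I"
  shows "\<exists>a. (\<exists>i\<in>I. a i \<noteq> 0) \<and> (\<forall>j\<in>J. (\<Sum>i\<in>I. a i * M j i) = 0) \<and> (\<forall>i. i \<notin> I \<longrightarrow> a i = 0)"
  using assms
proof (induction J arbitrary: I rule: finite_induct)
  case empty
  then obtain i where "i \<in> I" by fastforce
  then show ?case by (intro exI[of _ "\<lambda>k. if k = i then 1 else 0"]) auto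
next
  case (insert k J)
  have ext: "(\<Sum>i\<in>I. a i * M j i) = (\<Sum>i\<in>I - {i0}. a i * M j i)" if "a i0 = 0" for a i0 j
    using that insert.prems(1) by (intro sum.mono_neutral_right) auto
  have step: "\<exists>a. (\<exists>i\<in>I. a i \<noteq> 0) \<and> (\<forall>j\<in>J. (\<Sum>i\<in>I. a i * M j i) = 0) \<and>
      (\<forall>i. i \<notin> I \<longrightarrow> a i = 0) \<and> a i0 = 0" if i0: "i0 \<in> I" for i0
  proof -
    have "card J < card (I - {i0})" using insert i0 by simp
    then obtain a where "\<exists>i\<in>I - {i0}. a i \<noteq> 0"
      "\<forall>j\<in>J. (\<Sum>i\<in>I - {i0}. a i * M j i) = 0" "\<forall>i. i \<notin> I - {i0} \<longrightarrow> a i = 0"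
      using insert.IH[of "I - {i0}"] insert.prems by blast
    then show ?thesis using ext[of a i0] by (intro exI[of _ a]) auto
  qed
  obtain i1 where "i1 \<in> I" using insert.prems by fastforce
  then obtain a where a: "\<exists>i\<in>I. a i \<noteq> 0" "\<forall>j\<in>J. (\<Sum>i\<in>I. a i * M j i) = 0"
    "\<forall>i. i \<notin> I \<longrightarrow> a i = 0" using step by blast
  then obtain i0 where i0: "i0 \<in> I" "a i0 \<noteq> 0" by blast
  obtain b where b: "\<exists>i\<in>I. b i \<noteq> 0" "\<forall>j\<in>J. (\<Sum>i\<in>I. b i * M j i) = 0"
    "\<forall>i. i \<notin> I \<longrightarrow> b i = 0" "b i0 = 0" using step[OF i0(1)] by blast
  define r where "r c = (\<Sum>i\<in>I. c i * M k i)" for c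
  show ?case
  proof (cases "r b = 0")
    case True
    then show ?thesis using b by (intro exI[of _ b]) (auto simp: r_def)
  next
    case False
    \<comment> \<open>This combination cancels the new equation, and it is nonzero at
      \<open>i0\<close> because \<open>b i0 = 0\<close>.\<close>
    define c where "c i = r b * a i - r a * b i" for i
    have lin: "(\<Sum>i\<in>I. c i * M j i) = r b * (\<Sum>i\<in>I. a i * M j i) - r a * (\<Sum>i\<in>I. b i * M j i)" for j
      by (simp add: c_def sum_distrib_left sum_subtractf algebra_simps)
    have "c i0 \<noteq> 0" using False i0 b by (simp add: c_def)
    moreover have "(\<Sum>i\<in>I. c i * M j i) = 0" if "j \<in> insert k J" for j
      using that lin[of j] a(2) b(2) by (auto simp: r_def)
    moreover have "c i = 0" if "i \<notin> I" for i
      using that a(3) b(3) by (simp add: c_def)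
    ultimately show ?thesis using i0(1) by (intro exI[of _ c]) blast
  qed
qed

text \<open>The real span of a set lies in its complex span, so a real Hamel basis cannot be finite.
  All later constructions work with real scalars.\<close>

lemma infinite_dimensional_independent:
  assumes "infinite_dimensional TYPE('a::complex_normed_vector)"
  obtains B :: "'a::complex_normed_vector set" where "independent B" "infinite B"
proof -
  obtain B :: "'a set" where "B \<subseteq> UNIV" and B: "independent B" "UNIV \<subseteq> span B"
    and "card B = dim (UNIV :: 'a set)" by (rule basis_exists)
  have "span B \<subseteq> complex_vector.span B"
  proof
    fix x assume "x \<in> span B"
    then show "x \<in> complex_vector.span B"
    proof (induction rule: span_induct_alt)
      case base
      show ?case by (rule complex_vector.span_zero)
    next
      case (step c x y)
      then have "complex_of_real c *\<^sub>C x + y \<in> complex_vector.span B"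
        by (simp add: complex_vector.span_add complex_vector.span_scale complex_vector.span_base)
      then show ?case by (simp add: scaleC_of_real)
    qed
  qed
  then have "infinite B"
    using assms B(2) unfolding infinite_dimensional_def by auto
  then show ?thesis using that B by blast
qed

text \<open>One more independent vector than there are functionals leaves a nontrivial combination
  in all kernels.\<close>

lemma common_kernel_unit_vector:
  fixes B :: "'a::real_normed_vector set" and \<Phi> :: "('a \<Rightarrow>\<^sub>L real) set"
  assumes B: "independent B" "infinite B" and \<Phi>: "finite \<Phi>"
  obtains x where "norm x = 1" "\<And>g. g \<in> \<Phi> \<Longrightarrow> blinfun_apply g x = 0"
proof -
  obtain I where I: "I \<subseteq> B" "finite I" "card I = Suc (card \<Phi>)"
    using infinite_arbitrarily_large[OF B(2)] by blast
  obtain a where a: "\<exists>i\<in>I. a i \<noteq> 0" "\<And>g. g \<in> \<Phi> \<Longrightarrow> (\<Sum>i\<in>I. a i * blinfun_apply g i) = 0"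
    using homogeneous_system_nontrivial[of \<Phi> I blinfun_apply] \<Phi> I by auto
  define z where "z = (\<Sum>i\<in>I. a i *\<^sub>R i)"
  have "z \<noteq> 0"
    using independentD[OF B(1) I(2,1), of a] a(1) by (auto simp: z_def)
  moreover have "blinfun_apply g z = 0" if "g \<in> \<Phi>" for g
    using a(2)[OF that] by (simp add: z_def blinfun.sum_right blinfun.scaleR_right)
  ultimately show ?thesis
    by (intro that[of "z /\<^sub>R norm z"]) (auto simp: blinfun.scaleR_right)
qed

text \<open>Mazur's construction of a basic sequence: the new vector is annihilated by the norming
  functionals of a finite net of the unit sphere of the span of the previous vectors.\<close>

lemma basic_sequence_step:
  fixes B :: "'a::real_normed_vector set" and v :: "nat \<Rightarrow> 'a"
  assumes B: "independent B" "infinite B" and v: "\<And>i. i < n \<Longrightarrow> norm (v i) = 1"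
    and coord: "\<And>a i. i < n \<Longrightarrow> \<bar>a i\<bar> \<le> A * norm (\<Sum>j<n. a j *\<^sub>R v j)"
    and \<rho>: "\<rho> < 1"
  obtains x where "norm x = 1"
    "\<And>a t. \<rho> * norm (\<Sum>j<n. a j *\<^sub>R v j) \<le> norm ((\<Sum>j<n. a j *\<^sub>R v j) + t *\<^sub>R x)"
proof -
  \<comment> \<open>The net has mesh \<open>1 / M\<close>: rounding \<open>n\<close> coordinates
    moves a vector by at most \<open>n / M\<close>, and the estimate below pays this twice.\<close>
  obtain M :: nat where M: "2 * real n / (1 - \<rho>) < real M"
    using reals_Archimedean2 by blast
  have "0 \<le> 2 * real n / (1 - \<rho>)" using \<rho> by simp
  then have M0: "M > 0" using M by (intro gr0I) simp
  have M2: "2 * real n / M \<le> 1 - \<rho>"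
    using M M0 \<rho> by (simp add: field_simps)
  \<comment> \<open>Coordinates of unit vectors are bounded by \<open>A\<close>, so the rounded
    numerators stay in this range and the net \<open>G\<close> is finite.\<close>
  define K where "K = \<lceil>\<bar>A\<bar> * M\<rceil> + 1"
  define G where "G = (\<lambda>k. \<Sum>i<n. (of_int (k i) / M) *\<^sub>R v i) ` PiE {..<n} (\<lambda>_. {-K..K})"
  have "finite G" unfolding G_def by (intro finite_imageI finite_PiE) auto
  obtain \<phi> :: "'a \<Rightarrow> 'a \<Rightarrow>\<^sub>L real" where \<phi>: "\<And>z. norm (\<phi> z) \<le> 1" "\<And>z. blinfun_apply (\<phi> z) z = norm z"
    using norming_functional by metis
  obtain x where x: "norm x = 1" "\<And>g. g \<in> \<phi> ` G \<Longrightarrow> blinfun_apply g x = 0"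
    using common_kernel_unit_vector[OF B, of "\<phi> ` G"] \<open>finite G\<close> by blast
  have \<phi>_le: "blinfun_apply (\<phi> g) z \<le> norm z" for g z
  proof -
    have "blinfun_apply (\<phi> g) z \<le> norm (\<phi> g) * norm z"
      using norm_blinfun[of "\<phi> g" z] by simp
    also have "\<dots> \<le> 1 * norm z" by (intro mult_right_mono \<phi>) auto
    finally show ?thesis by simp
  qed
  have unit: "\<rho> \<le> norm (y + t *\<^sub>R x)" if y: "y = (\<Sum>j<n. a j *\<^sub>R v j)" "norm y = 1" for a t y
  proof -
    define k where "k = restrict (\<lambda>i. \<lfloor>a i * M\<rfloor>) {..<n}"
    define g where "g = (\<Sum>i<n. (of_int (k i) / M) *\<^sub>R v i)"
    have "\<bar>\<lfloor>a i * M\<rfloor>\<bar> \<le> K" if "i < n" for i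
    proof -
      have "\<bar>a i\<bar> \<le> A" using coord[OF that, of a] y by simp
      then have "\<bar>a i * M\<bar> \<le> \<bar>A\<bar> * M" by (simp add: abs_mult mult_right_mono)
      then show ?thesis unfolding K_def by linarith
    qed
    then have "k i \<in> {-K..K}" if "i < n" for i
      using that by (simp add: k_def abs_le_iff minus_le_iff)
    then have "k \<in> PiE {..<n} (\<lambda>_. {-K..K})"
      by (intro PiE_I) (simp_all add: k_def)
    then have gG: "g \<in> G" unfolding G_def g_def by (rule imageI)
    have "norm (y - g) = norm (\<Sum>i<n. (a i - of_int (k i) / M) *\<^sub>R v i)"
      by (simp add: y g_def sum_subtractf scaleR_left_diff_distrib)
    also have "\<dots> \<le> (\<Sum>i<n. 1 / M)"
    proof (rule sum_norm_le)
      fix i assume "i \<in> {..<n}"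
      then have i: "i < n" by simp
      have "\<bar>a i * M - of_int \<lfloor>a i * M\<rfloor>\<bar> \<le> 1" by linarith
      moreover have "a i - of_int (k i) / M = (a i * M - of_int \<lfloor>a i * M\<rfloor>) / M"
        using i M0 by (simp add: k_def field_simps)
      ultimately show "norm ((a i - of_int (k i) / M) *\<^sub>R v i) \<le> 1 / M"
        using v[OF i] M0 by (simp add: divide_right_mono)
    qed
    finally have dist: "norm (y - g) \<le> n / M" by simp
    \<comment> \<open>The functional \<open>\<phi> g\<close> almost norms \<open>y\<close> and
      vanishes on \<open>x\<close>, so adding a multiple of \<open>x\<close> cannot shorten
      \<open>y\<close> by much.\<close>
    have "1 - 2 * real n / M \<le> norm g - norm (y - g)"
      using dist y(2) norm_triangle_ineq2[of y g] by simp
    also have "\<dots> \<le> blinfun_apply (\<phi> g) g - blinfun_apply (\<phi> g) (g - y)"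
      using \<phi>_le[of g "g - y"] \<phi>(2)[of g] by (simp add: norm_minus_commute)
    also have "\<dots> = blinfun_apply (\<phi> g) (y + t *\<^sub>R x)"
      using x(2) gG by (simp add: blinfun.diff_right blinfun.add_right blinfun.scaleR_right)
    also have "\<dots> \<le> norm (y + t *\<^sub>R x)" by (rule \<phi>_le)
    finally show ?thesis using M2 by simp
  qed
  have "\<rho> * norm (\<Sum>j<n. a j *\<^sub>R v j) \<le> norm ((\<Sum>j<n. a j *\<^sub>R v j) + t *\<^sub>R x)" for a t
  proof (cases "(\<Sum>j<n. a j *\<^sub>R v j) = 0")
    case False
    define y where "y = (\<Sum>j<n. a j *\<^sub>R v j)"
    define c where "c = norm y"
    have c: "c > 0" using False by (simp add: c_def y_def)
    have "y /\<^sub>R c = (\<Sum>j<n. (a j / c) *\<^sub>R v j)"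
      by (simp add: y_def scaleR_sum_right divide_inverse_commute)
    moreover have "norm (y /\<^sub>R c) = 1" using c by (simp add: c_def)
    ultimately have "\<rho> \<le> norm (y /\<^sub>R c + (t / c) *\<^sub>R x)" by (rule unit)
    also have "y /\<^sub>R c + (t / c) *\<^sub>R x = (y + t *\<^sub>R x) /\<^sub>R c"
      by (simp add: scaleR_add_right divide_inverse_commute)
    also have "norm \<dots> = norm (y + t *\<^sub>R x) / c" using c by (simp add: divide_inverse_commute)
    finally show ?thesis using c by (simp add: y_def[symmetric] c_def[symmetric] field_simps)
  qed simp
  then show ?thesis using that x(1) by blast
qed

text \<open>A crude form of Mazur's theorem. The constants may grow with the length, since a power
  bound is enough against a decay faster than any power.\<close>

lemma basic_sequence:
  fixes B :: "'a::real_normed_vector set"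
  assumes B: "independent B" "infinite B"
  shows "\<exists>v :: nat \<Rightarrow> 'a. (\<forall>i<n. norm (v i) = 1) \<and>
    (\<forall>a. \<forall>i<n. \<bar>a i\<bar> \<le> 2 * (real n + 1) * norm (\<Sum>j<n. a j *\<^sub>R v j))"
proof -
  \<comment> \<open>These are norm bounds for the partial sum projections. A coordinate is a
    difference of two consecutive partial sums, whence the factor 2 in the conclusion.\<close>
  define proj where "proj v k \<longleftrightarrow> (\<forall>a. \<forall>j\<le>k. norm (\<Sum>i<j. a i *\<^sub>R v i) \<le> (real k + 1) * norm (\<Sum>i<k. a i *\<^sub>R v i))"
    for v :: "nat \<Rightarrow> 'a" and k
  have coord: "\<bar>a i\<bar> \<le> 2 * (real k + 1) * norm (\<Sum>j<k. a j *\<^sub>R v j)"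
    if "proj v k" "i < k" "norm (v i) = 1" for v k a i
  proof -
    have "\<bar>a i\<bar> = norm ((\<Sum>j<Suc i. a j *\<^sub>R v j) - (\<Sum>j<i. a j *\<^sub>R v j))"
      using that by simp
    also have "\<dots> \<le> norm (\<Sum>j<Suc i. a j *\<^sub>R v j) + norm (\<Sum>j<i. a j *\<^sub>R v j)"
      by (rule norm_triangle_ineq4)
    also have "\<dots> \<le> (real k + 1) * norm (\<Sum>i<k. a i *\<^sub>R v i) + (real k + 1) * norm (\<Sum>i<k. a i *\<^sub>R v i)"
      using that(1)[unfolded proj_def, rule_format, of "Suc i" a]
        that(1)[unfolded proj_def, rule_format, of i a] that(2) by simp
    finally show ?thesis by (simp add: algebra_simps)
  qed
  have "\<exists>v. (\<forall>i<n. norm (v i) = 1) \<and> proj v n"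
  proof (induction n)
    case 0
    show ?case by (simp add: proj_def)
  next
    case (Suc n)
    then obtain v where v: "\<And>i. i < n \<Longrightarrow> norm (v i) = 1" "proj v n" by blast
    \<comment> \<open>The losses telescope: \<open>(n + 2) * \<rho> = n + 1\<close> turns the
      projection bound for \<open>n\<close> vectors into that for \<open>n + 1\<close>.\<close>
    define \<rho> where "\<rho> = (real n + 1) / (real n + 2)"
    have \<rho>1: "\<rho> < 1" by (simp add: \<rho>_def field_simps)
    have co: "\<bar>a i\<bar> \<le> (2 * (real n + 1)) * norm (\<Sum>j<n. a j *\<^sub>R v j)" if "i < n" for a i
      using coord[OF v(2) that v(1)[OF that]] .
    obtain x where x: "norm x = 1"
      "\<And>a t. \<rho> * norm (\<Sum>j<n. a j *\<^sub>R v j) \<le> norm ((\<Sum>j<n. a j *\<^sub>R v j) + t *\<^sub>R x)"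
      using basic_sequence_step[OF B v(1) co \<rho>1] by blast
    define w where "w = v(n := x)"
    have w: "(\<Sum>i<j. a i *\<^sub>R w i) = (\<Sum>i<j. a i *\<^sub>R v i)" if "j \<le> n" for a j
      using that by (intro sum.cong) (auto simp: w_def)
    have "proj w (Suc n)"
      unfolding proj_def
    proof (intro allI impI)
      fix a j assume j: "j \<le> Suc n"
      show "norm (\<Sum>i<j. a i *\<^sub>R w i) \<le> (real (Suc n) + 1) * norm (\<Sum>i<Suc n. a i *\<^sub>R w i)"
      proof (cases "j = Suc n")
        case True
        show ?thesis
          using mult_right_mono[of 1 "real (Suc n) + 1" "norm (\<Sum>i<Suc n. a i *\<^sub>R w i)"]
          unfolding True by simp
      next
        case False
        then have j: "j \<le> n" using j by simp
        have "norm (\<Sum>i<j. a i *\<^sub>R v i) \<le> (real n + 1) * norm (\<Sum>i<n. a i *\<^sub>R v i)"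
          using v(2) j unfolding proj_def by blast
        also have "\<dots> = (real n + 2) * (\<rho> * norm (\<Sum>i<n. a i *\<^sub>R v i))"
          by (simp add: \<rho>_def)
        also have "\<dots> \<le> (real n + 2) * norm ((\<Sum>i<n. a i *\<^sub>R v i) + a n *\<^sub>R x)"
          by (intro mult_left_mono x) auto
        finally show ?thesis using j by (simp add: w w_def add.commute)
      qed
    qed
    moreover have "\<forall>i<Suc n. norm (w i) = 1" using v(1) x(1) by (auto simp: w_def less_Suc_eq)
    ultimately show ?case by blast
  qed
  then show ?thesis using coord by blast
qed

section \<open>Summing exponents are at least 2\<close>

text \<open>The identity is (q,1)-summing, for real scalars.\<close>

definition summing_identity :: "'a::real_normed_vector itself \<Rightarrow> real \<Rightarrow> bool" where
  "summing_identity _ q \<longleftrightarrow> (\<exists>C. \<forall>N (x :: nat \<Rightarrow> 'a) B.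
     (\<forall>\<epsilon>. (\<forall>i. \<epsilon> i \<in> {-1, 1::real}) \<longrightarrow> norm (\<Sum>i<N. \<epsilon> i *\<^sub>R x i) \<le> B) \<longrightarrow>
     (\<Sum>i<N. norm (x i) powr q) \<le> C * B powr q)"

lemma summing_identityE:
  assumes "summing_identity TYPE('a::real_normed_vector) q"
  obtains C where "C > 0" "\<And>N (x :: nat \<Rightarrow> 'a) B.
     (\<And>\<epsilon>. (\<And>i. \<epsilon> i \<in> {-1, 1::real}) \<Longrightarrow> norm (\<Sum>i<N. \<epsilon> i *\<^sub>R x i) \<le> B) \<Longrightarrow>
     (\<Sum>i<N. norm (x i) powr q) \<le> C * B powr q"
proof -
  obtain C where C: "\<And>N (x :: nat \<Rightarrow> 'a) B.
     (\<forall>\<epsilon>. (\<forall>i. \<epsilon> i \<in> {-1, 1::real}) \<longrightarrow> norm (\<Sum>i<N. \<epsilon> i *\<^sub>R x i) \<le> B) \<longrightarrow>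
     (\<Sum>i<N. norm (x i) powr q) \<le> C * B powr q"
    using assms unfolding summing_identity_def by blast
  show ?thesis
  proof (rule that[of "max C 1"])
    fix N :: nat and x :: "nat \<Rightarrow> 'a" and B :: real
    assume "\<And>\<epsilon>. (\<And>i. \<epsilon> i \<in> {-1, 1::real}) \<Longrightarrow> norm (\<Sum>i<N. \<epsilon> i *\<^sub>R x i) \<le> B"
    then have "(\<Sum>i<N. norm (x i) powr q) \<le> C * B powr q" using C by blast
    also have "\<dots> \<le> max C 1 * B powr q" by (intro mult_right_mono) auto
    finally show "(\<Sum>i<N. norm (x i) powr q) \<le> max C 1 * B powr q" .
  qed simp
qed

text \<open>Here \<open>g\<close> maximises the norm of the image over the Euclidean unit vectors
  orthogonal to the earlier ones. Maximality up to the factor 2 is enough and spares a compactness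
  argument; candidates exist because \<open>k < n\<close>.\<close>

lemma greedy_orthonormal_step:
  fixes v :: "nat \<Rightarrow> 'a::real_normed_vector" and f :: "nat \<Rightarrow> nat \<Rightarrow> real"
  assumes v: "\<And>i. i < n \<Longrightarrow> norm (v i) = 1" and k: "k < n"
  shows "\<exists>g. (\<Sum>i<n. g i * g i) = 1 \<and> (\<forall>j<k. (\<Sum>i<n. f j i * g i) = 0) \<and>
    (\<forall>a. (\<forall>j<k. (\<Sum>i<n. f j i * a i) = 0) \<longrightarrow>
       norm (\<Sum>i<n. a i *\<^sub>R v i) \<le> 2 * norm (\<Sum>i<n. g i *\<^sub>R v i) * sqrt (\<Sum>i<n. a i * a i))"
proof -
  define ip where "ip a b = (\<Sum>i<n. a i * b i)" for a b :: "nat \<Rightarrow> real"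
  define u where "u a = (\<Sum>i<n. a i *\<^sub>R v i)" for a :: "nat \<Rightarrow> real"
  define S where "S = (\<lambda>a. norm (u a)) ` {a. ip a a = 1 \<and> (\<forall>j<k. ip (f j) a = 0)}"
  have ip_nonneg: "ip a a \<ge> 0" for a by (auto simp: ip_def intro!: sum_nonneg)
  have normalize: "norm (u a) / sqrt (ip a a) \<in> S"
    if "\<And>j. j < k \<Longrightarrow> ip (f j) a = 0" "ip a a \<noteq> 0" for a
  proof -
    define s where "s = sqrt (ip a a)"
    have s: "s > 0" "s\<^sup>2 = ip a a" using that(2) ip_nonneg[of a] by (auto simp: s_def)
    have ipr: "ip b (\<lambda>i. a i / s) = ip b a / s" for b
      by (simp add: ip_def sum_divide_distrib)
    have "ip (\<lambda>i. a i / s) (\<lambda>i. a i / s) = ip a a / s\<^sup>2"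
      by (simp add: ip_def sum_divide_distrib power2_eq_square)
    then have "ip (\<lambda>i. a i / s) (\<lambda>i. a i / s) = 1" using s that by simp
    moreover have "u (\<lambda>i. a i / s) = u a /\<^sub>R s"
      by (simp add: u_def scaleR_sum_right divide_inverse_commute)
    then have "norm (u (\<lambda>i. a i / s)) = norm (u a) / s" using s by (simp add: divide_inverse_commute)
    ultimately show ?thesis
      using that(1) ipr unfolding S_def s_def[symmetric]
      by (intro image_eqI[of _ _ "\<lambda>i. a i / s"]) auto
  qed
  obtain a where a: "\<exists>i<n. a i \<noteq> 0" "\<And>j. j < k \<Longrightarrow> (\<Sum>i<n. a i * f j i) = 0"
    using homogeneous_system_nontrivial[of "{..<k}" "{..<n}" f] k by auto
  have zero: "a i = 0" if "ip a a = 0" "i < n" for a i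
    using that sum_nonneg_eq_0_iff[of "{..<n}" "\<lambda>i. a i * a i"] by (auto simp: ip_def)
  have "S \<noteq> {}"
  proof -
    have "ip a a \<noteq> 0" using a(1) zero[of a] by blast
    moreover have "ip (f j) a = 0" if "j < k" for j
      using a(2)[OF that] by (simp add: ip_def mult.commute)
    ultimately show ?thesis using normalize[of a] by blast
  qed
  have bdd: "bdd_above S"
  proof (rule bdd_aboveI)
    fix s assume "s \<in> S"
    then obtain b where b: "s = norm (u b)" "ip b b = 1" by (auto simp: S_def)
    have "\<bar>b i\<bar> \<le> 1" if "i < n" for i
    proof -
      have "b i * b i \<le> ip b b" unfolding ip_def using that by (intro member_le_sum) auto
      then show ?thesis using b by (simp add: abs_square_le_1[symmetric] power2_eq_square)
    qed
    then show "s \<le> (\<Sum>i<n. 1)"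
      unfolding b u_def by (intro sum_norm_le) (simp add: v)
  qed
  obtain s where s: "s \<in> S" "Sup S \<le> 2 * s"
  proof (cases "Sup S > 0")
    case True
    then obtain s where "s \<in> S" "Sup S / 2 < s"
      using less_cSup_iff[OF \<open>S \<noteq> {}\<close> bdd, of "Sup S / 2"] by auto
    then show ?thesis using that[of s] by simp
  next
    case False
    obtain s where "s \<in> S" using \<open>S \<noteq> {}\<close> by blast
    moreover from this have "s \<ge> 0" by (auto simp: S_def)
    ultimately show ?thesis using that[of s] False by simp
  qed
  then obtain g where g: "ip g g = 1" "\<forall>j<k. ip (f j) g = 0" "s = norm (u g)" by (auto simp: S_def)
  have "norm (u a) \<le> 2 * norm (u g) * sqrt (ip a a)" if "\<And>j. j < k \<Longrightarrow> ip (f j) a = 0" for a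
  proof (cases "ip a a = 0")
    case True
    then have "u a = 0" using zero[OF True] by (simp add: u_def)
    then show ?thesis using True by simp
  next
    case False
    have "norm (u a) / sqrt (ip a a) \<le> 2 * norm (u g)"
      using cSup_upper[OF normalize[OF that False] bdd] s g by simp
    then show ?thesis using False ip_nonneg[of a] by (simp add: field_simps)
  qed
  then show ?thesis using g unfolding ip_def u_def by blast
qed

lemma greedy_orthonormal_system:
  fixes v :: "nat \<Rightarrow> 'a::real_normed_vector"
  assumes v: "\<And>i. i < n \<Longrightarrow> norm (v i) = 1"
  shows "\<exists>f. \<forall>k<n. (\<Sum>i<n. f k i * f k i) = 1 \<and> (\<forall>j<k. (\<Sum>i<n. f j i * f k i) = 0) \<and>
    (\<forall>a. (\<forall>j<k. (\<Sum>i<n. f j i * a i) = 0) \<longrightarrow>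
       norm (\<Sum>i<n. a i *\<^sub>R v i) \<le> 2 * norm (\<Sum>i<n. f k i *\<^sub>R v i) * sqrt (\<Sum>i<n. a i * a i))"
proof -
  define Q where "Q f k \<longleftrightarrow> (\<Sum>i<n. f k i * f k i) = 1 \<and> (\<forall>j<k. (\<Sum>i<n. f j i * f k i) = 0) \<and>
    (\<forall>a. (\<forall>j<k. (\<Sum>i<n. f j i * a i) = 0) \<longrightarrow>
       norm (\<Sum>i<n. a i *\<^sub>R v i) \<le> 2 * norm (\<Sum>i<n. f k i *\<^sub>R v i) * sqrt (\<Sum>i<n. a i * a i))"
    for f :: "nat \<Rightarrow> nat \<Rightarrow> real" and k
  have Q_cong: "Q f k \<longleftrightarrow> Q f' k" if "\<And>j. j \<le> k \<Longrightarrow> f j = f' j" for f f' k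
    unfolding Q_def using that by simp
  have "\<exists>f. \<forall>k<K. Q f k" if "K \<le> n" for K
    using that
  proof (induction K)
    case (Suc K)
    then obtain f where f: "\<forall>k<K. Q f k" by auto
    have "K < n" using Suc.prems by simp
    then obtain g where
      "(\<Sum>i<n. g i * g i) = 1" "\<forall>j<K. (\<Sum>i<n. f j i * g i) = 0"
      "\<forall>a. (\<forall>j<K. (\<Sum>i<n. f j i * a i) = 0) \<longrightarrow>
       norm (\<Sum>i<n. a i *\<^sub>R v i) \<le> 2 * norm (\<Sum>i<n. g i *\<^sub>R v i) * sqrt (\<Sum>i<n. a i * a i)"
      using greedy_orthonormal_step[of n v K f] v by blast
    then have "Q (f(K := g)) K" by (simp add: Q_def)
    moreover have "Q (f(K := g)) k" if "k < K" for k
      using f that Q_cong[of k f "f(K := g)"] by simp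
    ultimately show ?case by (metis less_Suc_eq)
  qed simp
  then obtain f where "\<forall>k<n. Q f k" by blast
  then show ?thesis unfolding Q_def by blast
qed

text \<open>On the greedy system the summing property makes the norms decay faster than any power,
  whereas the basic sequence bounds them below by a power.\<close>

theorem summing_identity_exponent_ge_2:
  fixes B :: "'a::real_normed_vector set"
  assumes B: "independent B" "infinite B" and q: "0 < q" "summing_identity TYPE('a) q"
  shows "q \<ge> 2"
proof (rule ccontr)
  assume "\<not> q \<ge> 2"
  then have q2: "q < 2" by simp
  obtain C where C: "C > 0" "\<And>N (x :: nat \<Rightarrow> 'a) B.
     (\<And>\<epsilon>. (\<And>i. \<epsilon> i \<in> {-1, 1::real}) \<Longrightarrow> norm (\<Sum>i<N. \<epsilon> i *\<^sub>R x i) \<le> B) \<Longrightarrow>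
     (\<Sum>i<N. norm (x i) powr q) \<le> C * B powr q"
    using summing_identityE[OF q(2)] by blast
  \<comment> \<open>The gain in passing from \<open>k\<close> to \<open>2 * k\<close>:
    \<open>sqrt k / k powr (1 / q) = k powr (- \<theta>)\<close>.\<close>
  define \<theta> where "\<theta> = 1 / q - 1 / 2"
  have \<theta>: "\<theta> > 0" using q q2 by (simp add: \<theta>_def field_simps)
  define D where "D = 4 * C powr (1 / q)"
  have D: "D > 0" using C by (simp add: D_def)
  have "(\<lambda>j. D * (2 powr (- \<theta>)) ^ j) \<longlonglongrightarrow> D * 0"
    using \<theta> powr_less_one[of 2 "- \<theta>"] by (intro tendsto_intros LIMSEQ_realpow_zero) auto
  then have "\<forall>\<^sub>F j in sequentially. D * (2 powr (- \<theta>)) ^ j < 1 / 32"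
    by (rule order_tendstoD) simp
  then obtain j0 where j0: "\<And>j. j \<ge> j0 \<Longrightarrow> D * (2 powr (- \<theta>)) ^ j < 1 / 32"
    unfolding eventually_sequentially by blast
  \<comment> \<open>From \<open>2 ^ j0\<close> on, each doubling divides \<open>\<beta>\<close> by
    at least 32. The a priori bounds on \<open>\<beta>\<close> lose at most
    \<open>2 * n * (n + 1) * n\<close>, which is at most \<open>2 ^ (3 * J + 5)\<close>, and this
    \<open>J\<close> makes \<open>32 ^ (J - j0)\<close> larger.\<close>
  define J where "J = 5 * j0 + 7"
  define n :: nat where "n = 2 ^ J + 1"
  obtain v :: "nat \<Rightarrow> 'a" where v: "\<And>i. i < n \<Longrightarrow> norm (v i) = 1"
    and coord: "\<And>a i. i < n \<Longrightarrow> \<bar>a i\<bar> \<le> 2 * (real n + 1) * norm (\<Sum>j<n. a j *\<^sub>R v j)"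
    using basic_sequence[OF B, of n] by blast
  define u where "u a = (\<Sum>i<n. a i *\<^sub>R v i)" for a :: "nat \<Rightarrow> real"
  obtain f where f1: "\<And>k. k < n \<Longrightarrow> (\<Sum>i<n. f k i * f k i) = 1"
    and f0: "\<And>j k. j < k \<Longrightarrow> k < n \<Longrightarrow> (\<Sum>i<n. f j i * f k i) = 0"
    and f2: "\<And>k a. k < n \<Longrightarrow> (\<And>j. j < k \<Longrightarrow> (\<Sum>i<n. f j i * a i) = 0) \<Longrightarrow>
       norm (u a) \<le> 2 * norm (u (f k)) * sqrt (\<Sum>i<n. a i * a i)"
    unfolding u_def using greedy_orthonormal_system[of n v] v by blast
  define \<beta> where "\<beta> k = norm (u (f k))" for k
  have \<beta>_mono: "\<beta> k \<le> 2 * \<beta> i" if "i \<le> k" "k < n" for i k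
    using f2[of i "f k"] f0[of _ k] f1[of k] that by (simp add: \<beta>_def)
  have \<beta>_upper: "\<beta> k \<le> n" and \<beta>_lower: "1 \<le> 2 * real n * (real n + 1) * \<beta> k" if k: "k < n" for k
  proof -
    have "\<bar>f k i\<bar> \<le> 1" if "i < n" for i
    proof -
      have "f k i * f k i \<le> (\<Sum>i<n. f k i * f k i)" using that by (intro member_le_sum) auto
      then show ?thesis using f1[OF k] by (simp add: abs_square_le_1[symmetric] power2_eq_square)
    qed
    then have "norm (u (f k)) \<le> (\<Sum>i<n. 1)"
      unfolding u_def by (intro sum_norm_le) (simp add: v)
    then show "\<beta> k \<le> n" by (simp add: \<beta>_def)
    \<comment> \<open>A Euclidean unit vector has a coordinate of modulus at least
      \<open>1 / n\<close>; the coordinate bound of the basic sequence turns this into a lower bound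
      for the norm.\<close>
    have "\<exists>i<n. 1 \<le> n * \<bar>f k i\<bar>"
    proof (rule ccontr)
      assume "\<not> ?thesis"
      then have small: "n * \<bar>f k i\<bar> < 1" if "i < n" for i using that by auto
      have "(\<Sum>i<n. f k i * f k i) < (\<Sum>i<n. 1 / n)"
      proof (rule sum_strict_mono)
        fix i assume "i \<in> {..<n}"
        then have s: "\<bar>f k i\<bar> < 1 / n" using small[of i] k by (simp add: field_simps)
        have "1 / real n \<le> 1" using k by simp
        then have "\<bar>f k i\<bar> * \<bar>f k i\<bar> \<le> 1 * \<bar>f k i\<bar>" using s by (intro mult_right_mono) auto
        then show "f k i * f k i < 1 / n" using s by simp
      qed (use k in auto)
      then show False using f1[OF k] k by simp
    qed
    then obtain i where i: "i < n" "1 \<le> n * \<bar>f k i\<bar>" by blast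
    have "1 \<le> n * \<bar>f k i\<bar>" by (rule i)
    also have "\<dots> \<le> n * (2 * (real n + 1) * \<beta> k)"
      using coord[OF i(1), of "f k"] by (intro mult_left_mono) (auto simp: \<beta>_def u_def)
    finally show "1 \<le> 2 * real n * (real n + 1) * \<beta> k" by (simp add: algebra_simps)
  qed
  have \<beta>_pos: "\<beta> k > 0" if "k < n" for k
    using \<beta>_lower[OF that] by (auto simp: \<beta>_def intro!: gr_zeroI)
  have decay: "\<beta> (2 * k) \<le> D * real k powr (- \<theta>) * \<beta> k" if k: "0 < k" "2 * k < n" for k
  proof -
    \<comment> \<open>A signed sum of \<open>f k, ..., f (2 * k - 1)\<close> has Euclidean norm
      \<open>sqrt k\<close> and is orthogonal to the first \<open>k\<close> vectors, so greediness
      at stage \<open>k\<close> bounds its image.\<close>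
    have sign: "norm (\<Sum>m<k. \<epsilon> m *\<^sub>R u (f (k + m))) \<le> 2 * \<beta> k * sqrt k"
      if \<epsilon>: "\<And>i. \<epsilon> i \<in> {-1, 1::real}" for \<epsilon>
    proof -
      define a where "a i = (\<Sum>m<k. \<epsilon> m * f (k + m) i)" for i
      have ip: "(\<Sum>i<n. b i * a i) = (\<Sum>m<k. \<epsilon> m * (\<Sum>i<n. b i * f (k + m) i))" for b
      proof -
        have "(\<Sum>i<n. b i * a i) = (\<Sum>i<n. \<Sum>m<k. \<epsilon> m * (b i * f (k + m) i))"
          by (simp add: a_def sum_distrib_left algebra_simps)
        also have "\<dots> = (\<Sum>m<k. \<Sum>i<n. \<epsilon> m * (b i * f (k + m) i))" by (rule sum.swap)
        finally show ?thesis by (simp add: sum_distrib_left)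
      qed
      have ua: "(\<Sum>m<k. \<epsilon> m *\<^sub>R u (f (k + m))) = u a"
      proof -
        have "(\<Sum>m<k. \<epsilon> m *\<^sub>R u (f (k + m))) = (\<Sum>m<k. \<Sum>i<n. (\<epsilon> m * f (k + m) i) *\<^sub>R v i)"
          by (simp add: u_def scaleR_sum_right)
        also have "\<dots> = (\<Sum>i<n. \<Sum>m<k. (\<epsilon> m * f (k + m) i) *\<^sub>R v i)" by (rule sum.swap)
        finally show ?thesis by (simp add: u_def a_def scaleR_sum_left)
      qed
      have ort: "(\<Sum>i<n. f j i * f l i) = (if j = l then 1 else 0)" if "j < n" "l < n" for j l
        using that f0[of j l] f0[of l j] f1[of j] by (auto simp: mult.commute neq_iff)
      have fa: "(\<Sum>i<n. f (k + j) i * a i) = \<epsilon> j" if "j < k" for j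
        using that k by (simp add: ip ort if_distrib cong: if_cong)
      have "(\<Sum>i<n. a i * a i) = (\<Sum>m<k. \<epsilon> m * (\<Sum>i<n. f (k + m) i * a i))"
        by (simp add: ip mult.commute)
      also have "\<dots> = (\<Sum>m<k. \<epsilon> m * \<epsilon> m)" by (simp add: fa)
      also have "\<dots> = (\<Sum>m<k. 1)"
      proof (rule sum.cong)
        show "\<epsilon> m * \<epsilon> m = 1" for m using \<epsilon>[of m] by auto
      qed simp
      finally have aa: "(\<Sum>i<n. a i * a i) = k" by simp
      have "(\<Sum>i<n. f j i * a i) = 0" if "j < k" for j
        using that k by (simp add: ip ort)
      then show ?thesis using f2[of k a] k aa by (simp add: ua \<beta>_def)
    qed
    \<comment> \<open>Greediness also shows that each of these \<open>k\<close> images has norm at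
      least \<open>\<beta> (2 * k) / 2\<close>; the summing property compares them with their signed
      sums.\<close>
    have "k * (\<beta> (2 * k) / 2) powr q = (\<Sum>m<k. (\<beta> (2 * k) / 2) powr q)" by simp
    also have "\<dots> \<le> (\<Sum>m<k. norm (u (f (k + m))) powr q)"
    proof (rule sum_mono)
      fix m assume "m \<in> {..<k}"
      then have "\<beta> (2 * k) \<le> 2 * \<beta> (k + m)" using k by (intro \<beta>_mono) auto
      then show "(\<beta> (2 * k) / 2) powr q \<le> norm (u (f (k + m))) powr q"
        using q by (intro powr_mono2) (auto simp: \<beta>_def)
    qed
    also have "\<dots> \<le> C * (2 * \<beta> k * sqrt k) powr q"
      using sign by (intro C(2)) auto
    finally have "k * (\<beta> (2 * k) / 2) powr q \<le> C * (2 * \<beta> k * sqrt k) powr q" .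
    then have "(k * (\<beta> (2 * k) / 2) powr q) powr (1 / q) \<le> (C * (2 * \<beta> k * sqrt k) powr q) powr (1 / q)"
      using q by (intro powr_mono2) auto
    then have "real k powr (1 / q) * (\<beta> (2 * k) / 2) \<le> C powr (1 / q) * (2 * \<beta> k * sqrt k)"
      using q C \<beta>_pos[of k] \<beta>_pos[of "2 * k"] k by (simp add: powr_mult powr_powr)
    then have "\<beta> (2 * k) \<le> D * (sqrt k / real k powr (1 / q)) * \<beta> k"
      using k by (simp add: D_def field_simps)
    also have "sqrt k / real k powr (1 / q) = real k powr (- \<theta>)"
      using k by (simp add: \<theta>_def powr_half_sqrt[symmetric] powr_diff)
    finally show ?thesis .
  qed
  have iter: "\<beta> (2 ^ (j0 + i)) \<le> \<beta> (2 ^ j0) / 32 ^ i" if "j0 + i \<le> J" for i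
    using that
  proof (induction i)
    case (Suc i)
    have lt: "2 * 2 ^ (j0 + i) < n"
      using Suc.prems power_increasing[of "Suc (j0 + i)" J "2::nat"] by (simp add: n_def)
    have "real (2 ^ (j0 + i)) powr (- \<theta>) = (2 powr (- \<theta>)) ^ (j0 + i)"
      by (simp add: powr_realpow[symmetric] powr_powr mult.commute)
    then have "D * real (2 ^ (j0 + i)) powr (- \<theta>) \<le> 1 / 32" using j0[of "j0 + i"] by simp
    then have "D * real (2 ^ (j0 + i)) powr (- \<theta>) * \<beta> (2 ^ (j0 + i)) \<le> 1 / 32 * \<beta> (2 ^ (j0 + i))"
      by (intro mult_right_mono) (auto simp: \<beta>_def)
    then have "\<beta> (2 ^ (j0 + Suc i)) \<le> \<beta> (2 ^ (j0 + i)) / 32"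
      using decay[of "2 ^ (j0 + i)"] lt by simp
    also have "\<dots> \<le> \<beta> (2 ^ j0) / 32 ^ Suc i" using Suc by simp
    finally show ?case .
  qed simp
  have n_le: "real n \<le> 2 ^ (J + 1)" "real n + 1 \<le> 2 ^ (J + 2)"
  proof -
    have "(1::real) \<le> 2 ^ J" "real n = 2 ^ J + 1" "(2::real) ^ (J + 1) = 2 * 2 ^ J" "(2::real) ^ (J + 2) = 4 * 2 ^ J"
      by (simp_all add: n_def)
    then show "real n \<le> 2 ^ (J + 1)" "real n + 1 \<le> 2 ^ (J + 2)" by linarith+
  qed
  have "j0 \<le> J" by (simp add: J_def)
  then have j0n: "2 ^ j0 < n" "2 ^ J < n"
    by (simp_all add: n_def less_Suc_eq_le)
  have "j0 + (J - j0) \<le> J" by (simp add: J_def)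
  from iter[OF this] have le: "\<beta> (2 ^ J) * 32 ^ (J - j0) \<le> n"
    using \<beta>_upper[OF j0n(1)] by (simp add: J_def field_simps)
  have "(32::real) ^ (J - j0) \<le> (2 * real n * (real n + 1) * \<beta> (2 ^ J)) * 32 ^ (J - j0)"
    using \<beta>_lower[OF j0n(2)] by simp
  also have "\<dots> = 2 * real n * (real n + 1) * (\<beta> (2 ^ J) * 32 ^ (J - j0))" by simp
  also have "\<dots> \<le> 2 * real n * (real n + 1) * n" by (intro mult_left_mono le) auto
  also have "\<dots> \<le> 2 * 2 ^ (J + 1) * 2 ^ (J + 2) * 2 ^ (J + 1)"
    by (intro mult_mono n_le) auto
  also have "\<dots> = 2 ^ (1 + (J + 1) + (J + 2) + (J + 1))"
    by (simp only: power_add power_one_right)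
  also have "1 + (J + 1) + (J + 2) + (J + 1) = 3 * J + 5" by simp
  finally have "(2::real) ^ (5 * (J - j0)) \<le> 2 ^ (3 * J + 5)" by (simp add: power_mult)
  then show False by (simp add: J_def)
qed

section \<open>Averages over signs\<close>

lemma powr_le_self_unit:
  fixes u :: real
  assumes "0 \<le> u" "u \<le> 1" "1 \<le> r"
  shows "u powr r \<le> u"
proof (cases "u = 0")
  case False
  then show ?thesis using powr_mono_both'[of 1 r u u] assms by simp
qed simp

text \<open>Convexity on the open half line extends to the endpoint 0, where it reduces to
  \<open>u powr r \<le> u\<close> for a weight \<open>u\<close>.\<close>

lemma convex_on_powr_atLeast_0:
  assumes r: "(1::real) \<le> r"
  shows "convex_on {0..} (\<lambda>x. x powr r)"
proof (rule convex_onI)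
  fix t x y :: real
  assume t: "0 < t" "t < 1" and xy: "x \<in> {0..}" "y \<in> {0..}"
  have scale: "(u * z) powr r \<le> u * z powr r" if "0 < u" "u < 1" "0 \<le> z" for u z :: real
    using that powr_le_self_unit[of u r] r by (simp add: powr_mult mult_right_mono)
  show "((1 - t) *\<^sub>R x + t *\<^sub>R y) powr r \<le> (1 - t) * x powr r + t * y powr r"
  proof (cases "x = 0 \<or> y = 0")
    case True
    then show ?thesis using scale[of t y] scale[of "1 - t" x] t xy r by auto
  next
    case False
    then show ?thesis
      using convex_onD[OF powr_convex[OF r], of t x y] t xy by simp
  qed
qed (rule convex_real_interval)

text \<open>Jensen's inequality with weights proportional to H.\<close>

lemma sum_powr_sum_le:
  fixes g :: "'l \<Rightarrow> 'e \<Rightarrow> real"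
  assumes fin: "finite E" "finite L" and r: "1 \<le> r"
    and g: "\<And>l e. l \<in> L \<Longrightarrow> e \<in> E \<Longrightarrow> 0 \<le> g l e" and H: "\<And>e. e \<in> E \<Longrightarrow> 0 \<le> H e"
    and le: "\<And>e. e \<in> E \<Longrightarrow> (\<Sum>l\<in>L. g l e powr r) \<le> \<kappa> * H e powr r"
  shows "(\<Sum>l\<in>L. (\<Sum>e\<in>E. g l e) powr r) \<le> \<kappa> * (\<Sum>e\<in>E. H e) powr r"
proof -
  define S where "S = (\<Sum>e\<in>E. H e)"
  \<comment> \<open>Where \<open>H\<close> vanishes every \<open>g l\<close> vanishes too, so
    dividing by \<open>H e\<close> does no harm.\<close>
  have zero: "g l e = 0" if "e \<in> E" "l \<in> L" "H e = 0" for l e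
  proof -
    have "g l e powr r \<le> (\<Sum>l\<in>L. g l e powr r)" using that fin by (intro member_le_sum) auto
    also have "\<dots> \<le> 0" using le[OF that(1)] that(3) by simp
    finally show ?thesis by simp
  qed
  show ?thesis
  proof (cases "S = 0")
    case True
    then have "H e = 0" if "e \<in> E" for e
      using sum_nonneg_eq_0_iff[OF fin(1), of H] H that by (simp add: S_def)
    then have "(\<Sum>e\<in>E. g l e) = 0" if "l \<in> L" for l
      using zero that by (intro sum.neutral) blast
    then show ?thesis using True by (simp add: S_def)
  next
    case False
    then have S: "S > 0" using sum_nonneg[of E H] H by (simp add: S_def)
    have sum_w: "(\<Sum>e\<in>E. H e / S) = 1" using S by (simp add: S_def flip: sum_divide_distrib)
    have "(\<Sum>e\<in>E. g l e) powr r \<le> S powr r * (\<Sum>e\<in>E. H e / S * (g l e / H e) powr r)" if l: "l \<in> L" for l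
    proof -
      have "(\<Sum>e\<in>E. g l e) = S * (\<Sum>e\<in>E. H e / S * (g l e / H e))"
        unfolding sum_distrib_left using S zero l by (intro sum.cong) auto
      moreover have "(\<Sum>e\<in>E. H e / S * (g l e / H e)) \<ge> 0"
        using g[OF l] H S by (intro sum_nonneg) simp
      ultimately have "(\<Sum>e\<in>E. g l e) powr r = S powr r * (\<Sum>e\<in>E. (H e / S) *\<^sub>R (g l e / H e)) powr r"
        using S by (simp add: powr_mult)
      also have "(\<Sum>e\<in>E. (H e / S) *\<^sub>R (g l e / H e)) powr r \<le> (\<Sum>e\<in>E. H e / S * (g l e / H e) powr r)"
        using sum_w g[OF l] H S fin
        by (intro convex_on_sum[OF _ _ convex_on_powr_atLeast_0[OF r]]) (auto intro: sum_nonneg)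
      finally show ?thesis using S by (simp add: mult_left_mono)
    qed
    then have "(\<Sum>l\<in>L. (\<Sum>e\<in>E. g l e) powr r) \<le> (\<Sum>l\<in>L. S powr r * (\<Sum>e\<in>E. H e / S * (g l e / H e) powr r))"
      by (rule sum_mono)
    also have "\<dots> = S powr r * (\<Sum>e\<in>E. H e / S * (\<Sum>l\<in>L. (g l e / H e) powr r))"
      unfolding sum_distrib_left[symmetric] by (subst sum.swap) (simp add: sum_distrib_left)
    also have "\<dots> \<le> S powr r * (\<Sum>e\<in>E. H e / S * \<kappa>)"
    proof (rule mult_left_mono, rule sum_mono)
      fix e assume e: "e \<in> E"
      show "H e / S * (\<Sum>l\<in>L. (g l e / H e) powr r) \<le> H e / S * \<kappa>"
      proof (cases "H e = 0")
        case False
        then have He: "H e > 0" using H[OF e] by simp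
        have "(\<Sum>l\<in>L. (g l e / H e) powr r) = (\<Sum>l\<in>L. g l e powr r) / H e powr r"
          using He g[OF _ e] by (simp add: powr_divide sum_divide_distrib)
        also have "\<dots> \<le> \<kappa>" using le[OF e] He by (simp add: field_simps)
        finally show ?thesis using He S by (intro mult_left_mono) auto
      qed simp
    qed simp
    also have "\<dots> = \<kappa> * S powr r" 
      unfolding sum_distrib_right[symmetric] sum_w by simp
    finally show ?thesis by (simp add: S_def)
  qed
qed

text \<open>The top level, from \<open>m / 2\<close> to the maximum \<open>m\<close>, contributes at
  most \<open>R * m powr (q - s)\<close>. The other weights are at most \<open>m / 2\<close>, so the
  levels add up to a geometric series with ratio \<open>2 powr (s - q)\<close>. Used
  contrapositively, to find one rich level.\<close>

lemma dyadic_level_sum_le: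
  fixes w :: "'i \<Rightarrow> real"
  assumes J: "finite J" and w: "\<And>i. i \<in> J \<Longrightarrow> 0 \<le> w i" "\<And>i. i \<in> J \<Longrightarrow> w i \<le> M"
    and level: "\<And>c. 0 < c \<Longrightarrow> c \<le> M \<Longrightarrow> card {i \<in> J. c / 2 < w i \<and> w i \<le> c} * c powr s \<le> R"
    and R: "0 \<le> R" and s: "0 \<le> s" "s < q"
  shows "(\<Sum>i\<in>J. w i powr q) \<le> R * M powr (q - s) / (1 - 2 powr (s - q))"
  using assms(1-4)
proof (induction "card J" arbitrary: J M rule: less_induct)
  case less
  define \<rho> where "\<rho> = (2::real) powr (s - q)"
  have \<rho>: "\<rho> < 1" "\<rho> > 0" using s powr_less_one[of 2 "s - q"] by (auto simp: \<rho>_def)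
  show ?case
  proof (cases "\<forall>i\<in>J. w i = 0")
    case True
    then have "(\<Sum>i\<in>J. w i powr q) = 0" by simp
    also have "\<dots> \<le> R * M powr (q - s) / (1 - \<rho>)" using R \<rho> by simp
    finally show ?thesis by (simp add: \<rho>_def)
  next
    case False
    define m where "m = Max (w ` J)"
    define J1 where "J1 = {i \<in> J. m / 2 < w i \<and> w i \<le> m}"
    have le_m: "w i \<le> m" if "i \<in> J" for i using that less.prems(1) by (simp add: m_def)
    have "m \<in> w ` J" unfolding m_def using False less.prems(1) by (intro Max_in) auto
    then obtain i0 where i0: "i0 \<in> J" "w i0 = m" by blast
    have "m > 0" using False le_m less.prems(2) by (metis less_eq_real_def order_antisym_conv order_less_le_trans)
    then have i1: "i0 \<in> J1" using i0 by (simp add: J1_def)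
    have mM: "m \<le> M" using i0 less.prems(3) by auto
    have "card (J - J1) < card J"
      using i0 i1 less.prems(1) by (intro psubset_card_mono) auto
    moreover have "w i \<le> m / 2" if "i \<in> J - J1" for i
      using that le_m by (force simp: J1_def)
    moreover have "card {i \<in> J - J1. c / 2 < w i \<and> w i \<le> c} * c powr s \<le> R" if "0 < c" "c \<le> m / 2" for c
    proof -
      have "card {i \<in> J - J1. c / 2 < w i \<and> w i \<le> c} \<le> card {i \<in> J. c / 2 < w i \<and> w i \<le> c}"
        using less.prems(1) by (intro card_mono) auto
      then have "card {i \<in> J - J1. c / 2 < w i \<and> w i \<le> c} * c powr s
          \<le> card {i \<in> J. c / 2 < w i \<and> w i \<le> c} * c powr s"
        by (intro mult_right_mono) auto
      also have "\<dots> \<le> R" using that mM \<open>m > 0\<close> by (intro less.prems(4)) auto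
      finally show ?thesis .
    qed
    ultimately have 2: "(\<Sum>i\<in>J - J1. w i powr q) \<le> R * (m / 2) powr (q - s) / (1 - \<rho>)"
      using less.hyps[of "J - J1" "m / 2"] less.prems by (simp add: \<rho>_def)
    have "(\<Sum>i\<in>J1. w i powr q) \<le> (\<Sum>i\<in>J1. m powr q)"
      using s less.prems(2) by (intro sum_mono powr_mono2) (auto simp: J1_def)
    also have "\<dots> = card J1 * m powr s * m powr (q - s)"
      using \<open>m > 0\<close> by (simp flip: powr_add)
    also have "\<dots> \<le> R * m powr (q - s)"
      using less.prems(4)[of m] mM \<open>m > 0\<close> unfolding J1_def by (intro mult_right_mono) auto
    finally have 1: "(\<Sum>i\<in>J1. w i powr q) \<le> R * m powr (q - s)" .
    have "(\<Sum>i\<in>J. w i powr q) = (\<Sum>i\<in>J - J1. w i powr q) + (\<Sum>i\<in>J1. w i powr q)"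
      using less.prems(1) by (intro sum.subset_diff) (auto simp: J1_def)
    also have "\<dots> \<le> R * (m / 2) powr (q - s) / (1 - \<rho>) + R * m powr (q - s)"
      using 1 2 by simp
    also have "(m / 2) powr (q - s) = m powr (q - s) * \<rho>"
      using \<open>m > 0\<close> by (simp add: powr_divide \<rho>_def powr_diff)
    also have "R * (m powr (q - s) * \<rho>) / (1 - \<rho>) + R * m powr (q - s) = R * m powr (q - s) / (1 - \<rho>)"
      using \<rho> by (simp add: field_simps)
    also have "\<dots> \<le> R * M powr (q - s) / (1 - \<rho>)"
      using R \<rho> mM \<open>m > 0\<close> s by (intro divide_right_mono mult_left_mono powr_mono2) auto
    finally show ?thesis by (simp add: \<rho>_def)
  qed
qed

text \<open>Values outside \<open>I\<close> are fixed by \<open>PiE\<close>, so the set is finite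
  and averages over it are plain finite sums.\<close>

definition signs :: "'i set \<Rightarrow> ('i \<Rightarrow> real) set" where
  "signs I = PiE I (\<lambda>_. {-1, 1})"

lemma finite_signs: "finite I \<Longrightarrow> finite (signs I)"
  unfolding signs_def by (intro finite_PiE) auto

lemma card_signs: "finite I \<Longrightarrow> card (signs I) = 2 ^ card I"
  unfolding signs_def by (simp add: card_PiE numeral_2_eq_2)

lemma card_signs_pos: "finite I \<Longrightarrow> 0 < card (signs I)"
  by (simp add: card_signs)

lemma signs_values: "\<epsilon> \<in> signs I \<Longrightarrow> i \<in> I \<Longrightarrow> \<epsilon> i \<in> {-1, 1}"
  unfolding signs_def by auto

lemma signs_square: "\<epsilon> \<in> signs I \<Longrightarrow> i \<in> I \<Longrightarrow> \<epsilon> i * \<epsilon> i = 1"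
  using signs_values[of \<epsilon> I i] by auto

lemma signs_abs: "\<epsilon> \<in> signs I \<Longrightarrow> i \<in> I \<Longrightarrow> \<bar>\<epsilon> i\<bar> = 1"
  using signs_values[of \<epsilon> I i] by auto

text \<open>Multiplication by a fixed pattern is an involution of \<open>signs I\<close>.\<close>

lemma sum_signs_flip:
  assumes d: "\<And>i. i \<in> I \<Longrightarrow> d i \<in> {-1, 1}"
  shows "(\<Sum>\<epsilon>\<in>signs I. F (restrict (\<lambda>i. d i * \<epsilon> i) I)) = (\<Sum>\<epsilon>\<in>signs I. F \<epsilon>)"
proof -
  have dd: "d i * (d i * z) = z" if "i \<in> I" for i z
    using d[OF that] by auto
  have inv: "restrict (\<lambda>i. d i * restrict (\<lambda>i. d i * \<epsilon> i) I i) I = \<epsilon>" if "\<epsilon> \<in> signs I" for \<epsilon>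
    using that dd unfolding signs_def by (auto simp: fun_eq_iff PiE_def extensional_def)
  have mem: "restrict (\<lambda>i. d i * \<epsilon> i) I \<in> signs I" if "\<epsilon> \<in> signs I" for \<epsilon>
    unfolding signs_def
  proof (rule restrict_PiE_iff[THEN iffD2], rule ballI)
    fix i assume i: "i \<in> I"
    show "d i * \<epsilon> i \<in> {-1, 1}" using d[OF i] signs_values[OF that i] by auto
  qed
  show ?thesis
    by (rule sum.reindex_bij_witness[where i="\<lambda>\<epsilon>. restrict (\<lambda>i. d i * \<epsilon> i) I"
          and j="\<lambda>\<epsilon>. restrict (\<lambda>i. d i * \<epsilon> i) I"]) (use inv mem in auto)
qed

text \<open>Orthogonality: flipping the sign at \<open>i\<close> alone negates
  \<open>\<epsilon> i * \<epsilon> j\<close> for \<open>j\<close> different from \<open>i\<close>,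
  so only the diagonal survives.\<close>

lemma sum_signs_square:
  assumes I: "finite I" and B: "B \<subseteq> I"
  shows "(\<Sum>\<epsilon>\<in>signs I. (\<Sum>i\<in>B. \<epsilon> i)\<^sup>2) = card B * card (signs I)"
proof -
  have off: "(\<Sum>\<epsilon>\<in>signs I. \<epsilon> i * \<epsilon> j) = 0" if "i \<in> I" "j \<in> I" "i \<noteq> j" for i j
  proof -
    have "(\<Sum>\<epsilon>\<in>signs I. \<epsilon> i * \<epsilon> j) = (\<Sum>\<epsilon>\<in>signs I. - (\<epsilon> i * \<epsilon> j))"
      using sum_signs_flip[of I "\<lambda>k. if k = i then -1 else 1" "\<lambda>\<epsilon>. \<epsilon> i * \<epsilon> j"] that by auto
    then show ?thesis by (simp add: sum_negf)
  qed
  have fin: "finite B" using I B finite_subset by auto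
  have "(\<Sum>\<epsilon>\<in>signs I. (\<Sum>i\<in>B. \<epsilon> i)\<^sup>2) = (\<Sum>\<epsilon>\<in>signs I. \<Sum>i\<in>B. \<Sum>j\<in>B. \<epsilon> i * \<epsilon> j)"
    by (simp add: power2_eq_square sum_product)
  also have "\<dots> = (\<Sum>i\<in>B. \<Sum>\<epsilon>\<in>signs I. \<Sum>j\<in>B. \<epsilon> i * \<epsilon> j)" by (rule sum.swap)
  also have "\<dots> = (\<Sum>i\<in>B. \<Sum>j\<in>B. \<Sum>\<epsilon>\<in>signs I. \<epsilon> i * \<epsilon> j)" by (subst sum.swap) simp
  also have "\<dots> = (\<Sum>i\<in>B. \<Sum>j\<in>B. if i = j then real (card (signs I)) else 0)"
    using off B by (intro sum.cong refl) (auto simp: signs_square subset_iff)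
  also have "\<dots> = card B * card (signs I)" using fin by simp
  finally show ?thesis .
qed

section \<open>Mean squares of signed sums\<close>

lemma norm_add_squared_le:
  fixes a b :: "'a::real_normed_vector"
  shows "(norm (a + b))\<^sup>2 \<le> 2 * (norm a)\<^sup>2 + 2 * (norm b)\<^sup>2"
proof -
  have "(norm (a + b))\<^sup>2 \<le> (norm a + norm b)\<^sup>2"
    by (intro power_mono norm_triangle_ineq) auto
  also have "\<dots> \<le> 2 * (norm a)\<^sup>2 + 2 * (norm b)\<^sup>2"
    using sum_squares_bound[of "norm a" "norm b"] by (simp add: power2_sum)
  finally show ?thesis .
qed

text \<open>The mean runs over the signs on all of I also when only the vectors in A are summed, so that
  no marginalisation is needed.\<close>

definition mean_sq :: "'i set \<Rightarrow> 'i set \<Rightarrow> ('i \<Rightarrow> 'a::real_normed_vector) \<Rightarrow> real" where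
  "mean_sq I A x = (\<Sum>\<epsilon>\<in>signs I. (norm (\<Sum>i\<in>A. \<epsilon> i *\<^sub>R x i))\<^sup>2) / card (signs I)"

lemma mean_sq_nonneg: "0 \<le> mean_sq I A x"
  unfolding mean_sq_def by (intro divide_nonneg_nonneg sum_nonneg) auto

lemma mean_sq_flip:
  assumes "\<And>i. i \<in> I \<Longrightarrow> d i \<in> {-1, 1}" "A \<subseteq> I"
  shows "mean_sq I A (\<lambda>i. d i *\<^sub>R x i) = mean_sq I A x"
proof -
  have "(\<Sum>i\<in>A. restrict (\<lambda>i. d i * \<epsilon> i) I i *\<^sub>R x i) = (\<Sum>i\<in>A. \<epsilon> i *\<^sub>R d i *\<^sub>R x i)" for \<epsilon>
    using assms(2) by (intro sum.cong) (auto simp: mult.commute)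
  then show ?thesis
    using sum_signs_flip[of I d "\<lambda>\<epsilon>. (norm (\<Sum>i\<in>A. \<epsilon> i *\<^sub>R x i))\<^sup>2"] assms(1)
    by (simp add: mean_sq_def)
qed

lemma mean_sq_scale: "mean_sq I A (\<lambda>i. c *\<^sub>R x i) = c\<^sup>2 * mean_sq I A x"
proof -
  have "(\<Sum>i\<in>A. \<epsilon> i *\<^sub>R c *\<^sub>R x i) = c *\<^sub>R (\<Sum>i\<in>A. \<epsilon> i *\<^sub>R x i)" for \<epsilon>
    by (simp add: scaleR_sum_right mult.commute)
  then show ?thesis by (simp add: mean_sq_def power_mult_distrib sum_distrib_left)
qed

lemma exists_sign_le_mean_sq:
  assumes I: "finite I"
  obtains \<epsilon> where "\<epsilon> \<in> signs I" "(norm (\<Sum>i\<in>A. \<epsilon> i *\<^sub>R x i))\<^sup>2 \<le> mean_sq I A x"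
proof -
  have "\<exists>\<epsilon>\<in>signs I. (norm (\<Sum>i\<in>A. \<epsilon> i *\<^sub>R x i))\<^sup>2 \<le> mean_sq I A x"
  proof (rule ccontr)
    assume "\<not> ?thesis"
    then have "mean_sq I A x < (norm (\<Sum>i\<in>A. \<epsilon> i *\<^sub>R x i))\<^sup>2" if "\<epsilon> \<in> signs I" for \<epsilon>
      using that by auto
    moreover have "signs I \<noteq> {}" using card_signs_pos[OF I] by auto
    ultimately have "(\<Sum>\<epsilon>\<in>signs I. mean_sq I A x) < (\<Sum>\<epsilon>\<in>signs I. (norm (\<Sum>i\<in>A. \<epsilon> i *\<^sub>R x i))\<^sup>2)"
      by (intro sum_strict_mono finite_signs I) auto
    then show False using card_signs_pos[OF I] by (simp add: mean_sq_def)
  qed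
  then show ?thesis using that by blast
qed

text \<open>Flipping all signs except the one at \<open>i\<close> preserves the mean, and adding the
  flipped sum to the original one leaves twice the \<open>i\<close>-th term.\<close>

lemma norm_le_mean_sq:
  assumes I: "finite I" "i \<in> I"
  shows "(norm (x i))\<^sup>2 \<le> mean_sq I I x"
proof -
  define d where "d k = (if k = i then 1 else - 1 :: real)" for k
  define S where "S x \<epsilon> = (\<Sum>k\<in>I. \<epsilon> k *\<^sub>R x k)" for x :: "'a \<Rightarrow> 'b" and \<epsilon>
  have "4 * (norm (x i))\<^sup>2 \<le> 2 * (norm (S x \<epsilon>))\<^sup>2 + 2 * (norm (S (\<lambda>k. d k *\<^sub>R x k) \<epsilon>))\<^sup>2" if "\<epsilon> \<in> signs I" for \<epsilon>
  proof -
    have "S x \<epsilon> + S (\<lambda>k. d k *\<^sub>R x k) \<epsilon> = (\<Sum>k\<in>I. if k = i then (2 * \<epsilon> i) *\<^sub>R x i else 0)"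
      unfolding S_def sum.distrib[symmetric]
    proof (rule sum.cong)
      fix k
      show "\<epsilon> k *\<^sub>R x k + \<epsilon> k *\<^sub>R d k *\<^sub>R x k = (if k = i then (2 * \<epsilon> i) *\<^sub>R x i else 0)"
        by (simp add: d_def flip: scaleR_add_left)
    qed simp
    also have "\<dots> = (2 * \<epsilon> i) *\<^sub>R x i" using I by simp
    finally have "norm (S x \<epsilon> + S (\<lambda>k. d k *\<^sub>R x k) \<epsilon>) = 2 * norm (x i)"
      using signs_abs[OF that I(2)] by (simp add: abs_mult)
    then show ?thesis
      using norm_add_squared_le[of "S x \<epsilon>" "S (\<lambda>k. d k *\<^sub>R x k) \<epsilon>"] by (simp add: power_mult_distrib)
  qed
  then have "(\<Sum>\<epsilon>\<in>signs I. 4 * (norm (x i))\<^sup>2)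
      \<le> (\<Sum>\<epsilon>\<in>signs I. 2 * (norm (S x \<epsilon>))\<^sup>2 + 2 * (norm (S (\<lambda>k. d k *\<^sub>R x k) \<epsilon>))\<^sup>2)"
    by (rule sum_mono)
  then have "4 * (norm (x i))\<^sup>2 \<le> 2 * mean_sq I I x + 2 * mean_sq I I (\<lambda>k. d k *\<^sub>R x k)"
    using card_signs_pos[OF I(1)]
    by (simp add: mean_sq_def S_def sum.distrib field_simps flip: sum_distrib_left)
  moreover have "mean_sq I I (\<lambda>k. d k *\<^sub>R x k) = mean_sq I I x"
    by (rule mean_sq_flip) (auto simp: d_def)
  ultimately show ?thesis by simp
qed

text \<open>If all vectors were equal to \<open>z\<close>, orthogonality of the signs would give the
  mean \<open>card B * (norm z)\<^sup>2\<close>. Replacing them by \<open>z\<close> changes each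
  signed sum by at most \<open>card B * t\<close>.\<close>

lemma mean_sq_clustered_ge:
  fixes t :: real
  assumes I: "finite I" "B \<subseteq> I" and t: "\<And>i. i \<in> B \<Longrightarrow> norm (x i - z) \<le> t"
  shows "card B * (norm z)\<^sup>2 / 2 - (card B * t)\<^sup>2 \<le> mean_sq I B x"
proof -
  define S where "S \<epsilon> = (\<Sum>i\<in>B. \<epsilon> i *\<^sub>R x i)" for \<epsilon>
  have "(\<Sum>i\<in>B. \<epsilon> i)\<^sup>2 * (norm z)\<^sup>2 \<le> 2 * (norm (S \<epsilon>))\<^sup>2 + 2 * (card B * t)\<^sup>2" if "\<epsilon> \<in> signs I" for \<epsilon>
  proof -
    have "norm (\<Sum>i\<in>B. \<epsilon> i *\<^sub>R (x i - z)) \<le> (\<Sum>i\<in>B. t)"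
      using t signs_abs[OF that] I(2) by (intro sum_norm_le) auto
    then have "(norm (\<Sum>i\<in>B. \<epsilon> i *\<^sub>R (x i - z)))\<^sup>2 \<le> (card B * t)\<^sup>2"
      by (intro power_mono) auto
    moreover have "(\<Sum>i\<in>B. \<epsilon> i) *\<^sub>R z = S \<epsilon> + - (\<Sum>i\<in>B. \<epsilon> i *\<^sub>R (x i - z))"
      by (simp add: S_def scaleR_sum_left scaleR_diff_right sum_subtractf)
    then have "(\<Sum>i\<in>B. \<epsilon> i)\<^sup>2 * (norm z)\<^sup>2 = (norm (S \<epsilon> + - (\<Sum>i\<in>B. \<epsilon> i *\<^sub>R (x i - z))))\<^sup>2"
      by (metis norm_scaleR power2_abs power_mult_distrib)
    ultimately show ?thesis
      using norm_add_squared_le[of "S \<epsilon>" "- (\<Sum>i\<in>B. \<epsilon> i *\<^sub>R (x i - z))"] by simp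
  qed
  then have "(\<Sum>\<epsilon>\<in>signs I. (\<Sum>i\<in>B. \<epsilon> i)\<^sup>2 * (norm z)\<^sup>2)
      \<le> (\<Sum>\<epsilon>\<in>signs I. 2 * (norm (S \<epsilon>))\<^sup>2 + 2 * (card B * t)\<^sup>2)" by (rule sum_mono)
  then have "card B * (norm z)\<^sup>2 * card (signs I) \<le> 2 * (\<Sum>\<epsilon>\<in>signs I. (norm (S \<epsilon>))\<^sup>2) + 2 * (card B * t)\<^sup>2 * card (signs I)"
    by (simp add: sum_signs_square[OF I] sum.distrib algebra_simps flip: sum_distrib_left sum_distrib_right)
  then show ?thesis
    using card_signs_pos[OF I(1)] by (simp add: mean_sq_def S_def field_simps)
qed

section \<open>Ramsey selection of a homogeneous sign pattern\<close>

lemma sorted_list_of_set_image: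
  assumes "strict_mono_on {..<N} (s :: nat \<Rightarrow> nat)"
  shows "sorted_list_of_set (s ` {..<N}) = map s [0..<N]"
proof -
  have "sorted_wrt (<) (map s [0..<N])"
    using assms by (auto simp: sorted_wrt_iff_nth_less strict_mono_on_def)
  then show ?thesis
    by (metis atLeast0LessThan list.set_map set_upt sorted_list_of_set.idem_if_sorted_distinct
        strict_sorted_iff)
qed

lemma nth_sorted_list_of_set_strict_mono_on:
  "strict_mono_on {..<card (A :: nat set)} (\<lambda>i. sorted_list_of_set A ! i)"
  by (auto simp: strict_mono_on_def sorted_wrt_nth_less)

text \<open>The colour of an N-subset is a pattern of signs for which its signed sum is small.\<close>

lemma ramsey_sign_pattern:
  fixes N m :: nat
  shows "\<exists>R. \<forall>(w :: nat \<Rightarrow> 'a::real_normed_vector) \<beta>.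
    (\<forall>A. A \<subseteq> {..<R} \<longrightarrow> card A = N \<longrightarrow> (\<exists>\<epsilon>\<in>signs A. norm (\<Sum>i\<in>A. \<epsilon> i *\<^sub>R w i) \<le> \<beta>)) \<longrightarrow>
    (\<exists>p\<in>signs {..<N}. \<exists>g. strict_mono_on {..<m} g \<and> g ` {..<m} \<subseteq> {..<R} \<and>
      (\<forall>s. strict_mono_on {..<N} s \<and> s ` {..<N} \<subseteq> {..<m} \<longrightarrow>
        norm (\<Sum>j<N. p j *\<^sub>R w (g (s j))) \<le> \<beta>))"
proof -
  obtain R :: nat where R: "partn_lst {..<R} (replicate (2 ^ N) m) N"
    using ramsey_full[of "replicate (2 ^ N) m" N] by blast
  \<comment> \<open>Numbers the \<open>2 ^ N\<close> patterns, because colours are natural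
    numbers.\<close>
  obtain h where h: "bij_betw h (signs {..<N}) {0..<card (signs {..<N})}"
    using ex_bij_betw_finite_nat[OF finite_signs[OF finite_lessThan]] by blast
  have h: "bij_betw h (signs {..<N}) {..<2 ^ N}"
    using h by (simp add: card_signs atLeast0LessThan)
  show ?thesis
  proof (intro exI[of _ R] allI impI)
    fix w :: "nat \<Rightarrow> 'a" and \<beta>
    assume small: "\<forall>A. A \<subseteq> {..<R} \<longrightarrow> card A = N \<longrightarrow> (\<exists>\<epsilon>\<in>signs A. norm (\<Sum>i\<in>A. \<epsilon> i *\<^sub>R w i) \<le> \<beta>)"
    \<comment> \<open>Signs are read along the increasing enumeration of \<open>A\<close>, which
      makes patterns on different sets comparable.\<close>
    have "\<exists>p\<in>signs {..<N}. norm (\<Sum>j<N. p j *\<^sub>R w (sorted_list_of_set A ! j)) \<le> \<beta>"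
      if A: "A \<in> nsets {..<R} N" for A
    proof -
      have A: "A \<subseteq> {..<R}" "finite A" "card A = N" using A by (auto simp: nsets_def)
      obtain \<epsilon> where \<epsilon>: "\<epsilon> \<in> signs A" "norm (\<Sum>i\<in>A. \<epsilon> i *\<^sub>R w i) \<le> \<beta>" using small A by blast
      define e where "e j = sorted_list_of_set A ! j" for j
      have e: "bij_betw e {..<N} A"
        unfolding e_def using bij_betw_nth[of "sorted_list_of_set A" "{..<N}" A] A by simp
      have "restrict (\<lambda>j. \<epsilon> (e j)) {..<N} \<in> signs {..<N}"
        unfolding signs_def using signs_values[OF \<epsilon>(1)] bij_betwE[OF e] by auto
      moreover have "(\<Sum>i\<in>A. \<epsilon> i *\<^sub>R w i) = (\<Sum>j<N. \<epsilon> (e j) *\<^sub>R w (e j))"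
        by (rule sum.reindex_bij_betw[OF e, symmetric])
      ultimately show ?thesis
        using \<epsilon>(2) by (intro bexI[of _ "restrict (\<lambda>j. \<epsilon> (e j)) {..<N}"]) (auto simp: e_def)
    qed
    then obtain pat where pat: "\<And>A. A \<in> nsets {..<R} N \<Longrightarrow> pat A \<in> signs {..<N}"
      "\<And>A. A \<in> nsets {..<R} N \<Longrightarrow> norm (\<Sum>j<N. pat A j *\<^sub>R w (sorted_list_of_set A ! j)) \<le> \<beta>"
      by metis
    have "(\<lambda>A. h (pat A)) \<in> nsets {..<R} N \<rightarrow> {..<length (replicate (2 ^ N) m)}"
      using pat(1) bij_betwE[OF h] by auto
    then obtain i H where i: "i < 2 ^ N" and H: "H \<in> nsets {..<R} (replicate (2 ^ N) m ! i)"
      and col: "(\<lambda>A. h (pat A)) ` nsets H N \<subseteq> {i}"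
      using partn_lstE[OF R] by (metis length_replicate)
    have H: "H \<subseteq> {..<R}" "finite H" "card H = m" using H i by (auto simp: nsets_def)
    obtain p where p: "p \<in> signs {..<N}" "h p = i"
      using bij_betw_imp_surj_on[OF h] i by (metis imageE lessThan_iff)
    define g where "g j = sorted_list_of_set H ! j" for j
    have g: "strict_mono_on {..<m} g"
      unfolding g_def using nth_sorted_list_of_set_strict_mono_on[of H] H(3) by simp
    have gH: "g j \<in> H" if "j < m" for j
      unfolding g_def using that H by (metis nth_mem set_sorted_list_of_set sorted_list_of_set.length_sorted_key_list_of_set)
    show "\<exists>p\<in>signs {..<N}. \<exists>g. strict_mono_on {..<m} g \<and> g ` {..<m} \<subseteq> {..<R} \<and>
      (\<forall>s. strict_mono_on {..<N} s \<and> s ` {..<N} \<subseteq> {..<m} \<longrightarrow>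
        norm (\<Sum>j<N. p j *\<^sub>R w (g (s j))) \<le> \<beta>)"
    proof (intro bexI[OF _ p(1)] exI[of _ g] conjI allI impI g)
      show "g ` {..<m} \<subseteq> {..<R}" using gH H(1) by blast
      fix s assume s: "strict_mono_on {..<N} s \<and> s ` {..<N} \<subseteq> {..<m}"
      have gs: "strict_mono_on {..<N} (\<lambda>j. g (s j))"
        using s g unfolding strict_mono_on_def by (metis image_subset_iff)
      define A where "A = (\<lambda>j. g (s j)) ` {..<N}"
      have "card A = N"
        unfolding A_def using strict_mono_on_imp_inj_on[OF gs] by (simp add: card_image)
      moreover have AH: "A \<subseteq> H" using s gH by (auto simp: A_def)
      ultimately have A: "A \<in> nsets H N" "A \<in> nsets {..<R} N"
        using H finite_subset[OF AH] by (auto simp: nsets_def)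
      have "h (pat A) = h p" using col A(1) p(2) by auto
      then have "pat A = p"
        using pat(1)[OF A(2)] p(1) bij_betw_imp_inj_on[OF h] by (auto dest: inj_onD)
      moreover have "sorted_list_of_set A ! j = g (s j)" if "j < N" for j
        using that by (simp add: A_def sorted_list_of_set_image[OF gs])
      ultimately show "norm (\<Sum>j<N. p j *\<^sub>R w (g (s j))) \<le> \<beta>"
        using pat(2)[OF A(2)] by simp
    qed
  qed
qed

text \<open>Here \<open>\<kappa>\<close> is the best constant for families of at most
  \<open>n\<close> vectors; it is finite because vectors in a family of mean 1 have norm at most 1.
  The failure hypothesis supplies an \<open>n\<close> for which it reaches \<open>\<Lambda>\<close>,
  and the supremum is approached up to the factor 2.\<close>

lemma near_extremal_family:
  fixes q \<Lambda> :: real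
  assumes q: "0 < q" and \<Lambda>: "0 < \<Lambda>"
    and fail: "\<And>C. \<exists>I (x :: nat \<Rightarrow> 'a::real_normed_vector). finite I \<and>
      C * mean_sq I I x powr (q / 2) < (\<Sum>i\<in>I. norm (x i) powr q)"
  shows "\<exists>I (x :: nat \<Rightarrow> 'a) \<kappa>. finite I \<and> \<Lambda> \<le> \<kappa> \<and> 0 < mean_sq I I x \<and>
    \<kappa> / 2 * mean_sq I I x powr (q / 2) \<le> (\<Sum>i\<in>I. norm (x i) powr q) \<and>
    (\<forall>L (y :: nat \<Rightarrow> 'a). finite L \<longrightarrow> card L \<le> card I \<longrightarrow>
       (\<Sum>l\<in>L. norm (y l) powr q) \<le> \<kappa> * mean_sq L L y powr (q / 2))"
proof -
  have zero: "(\<Sum>i\<in>I. norm (x i) powr q) = 0" if "finite I" "mean_sq I I x = 0" for I and x :: "nat \<Rightarrow> 'a"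
    using norm_le_mean_sq[OF that(1), of _ x] that(2) by (intro sum.neutral) auto
  have normalize: "mean_sq I I (\<lambda>i. (1 / sqrt (mean_sq I I x)) *\<^sub>R x i) = 1"
    "(\<Sum>i\<in>I. norm ((1 / sqrt (mean_sq I I x)) *\<^sub>R x i) powr q)
      = (\<Sum>i\<in>I. norm (x i) powr q) / mean_sq I I x powr (q / 2)"
    if "0 < mean_sq I I x" for I and x :: "nat \<Rightarrow> 'a"
  proof -
    show "mean_sq I I (\<lambda>i. (1 / sqrt (mean_sq I I x)) *\<^sub>R x i) = 1"
      using that by (simp add: mean_sq_scale power_divide)
    have "sqrt (mean_sq I I x) powr q = mean_sq I I x powr (q / 2)"
      using that by (simp add: powr_half_sqrt[symmetric] powr_powr)
    then show "(\<Sum>i\<in>I. norm ((1 / sqrt (mean_sq I I x)) *\<^sub>R x i) powr q)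
      = (\<Sum>i\<in>I. norm (x i) powr q) / mean_sq I I x powr (q / 2)"
      using that by (simp add: powr_divide sum_divide_distrib)
  qed
  obtain I0 and x0 :: "nat \<Rightarrow> 'a" where I0: "finite I0"
    "\<Lambda> * mean_sq I0 I0 x0 powr (q / 2) < (\<Sum>i\<in>I0. norm (x0 i) powr q)"
    using fail by blast
  have m0: "0 < mean_sq I0 I0 x0"
    using zero[OF I0(1), of x0] I0(2) mean_sq_nonneg[of I0 I0 x0] by (cases "mean_sq I0 I0 x0 = 0") auto
  define n where "n = card I0"
  define S where "S = {(\<Sum>l\<in>L. norm (y l) powr q) | L (y :: nat \<Rightarrow> 'a). finite L \<and> card L \<le> n \<and> mean_sq L L y = 1}"
  have bdd: "bdd_above S"
  proof (rule bdd_aboveI)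
    fix s assume "s \<in> S"
    then obtain L and y :: "nat \<Rightarrow> 'a" where y: "s = (\<Sum>l\<in>L. norm (y l) powr q)" "finite L" "card L \<le> n" "mean_sq L L y = 1"
      by (auto simp: S_def)
    have "norm (y l) powr q \<le> 1" if "l \<in> L" for l
    proof -
      have "norm (y l) \<le> 1" using norm_le_mean_sq[OF y(2) that, of y] y(4) by (simp add: abs_square_le_1)
      then show ?thesis using q powr_mono2[of q "norm (y l)" 1] by simp
    qed
    then have "s \<le> (\<Sum>l\<in>L. 1)" unfolding y(1) by (rule sum_mono)
    then show "s \<le> n" using y(3) by simp
  qed
  have in_S: "(\<Sum>l\<in>L. norm (y l) powr q) / mean_sq L L y powr (q / 2) \<in> S"
    if "finite L" "card L \<le> n" "0 < mean_sq L L y" for L and y :: "nat \<Rightarrow> 'a"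
    unfolding S_def using that normalize[OF that(3)]
    by (intro CollectI exI[of _ L] exI[of _ "\<lambda>l. (1 / sqrt (mean_sq L L y)) *\<^sub>R y l"]) auto
  define \<kappa> where "\<kappa> = Sup S"
  have "\<Lambda> \<le> (\<Sum>i\<in>I0. norm (x0 i) powr q) / mean_sq I0 I0 x0 powr (q / 2)"
    using I0(2) m0 by (simp add: field_simps)
  also have "\<dots> \<le> \<kappa>"
    unfolding \<kappa>_def using in_S[OF I0(1) _ m0] bdd by (intro cSup_upper) (auto simp: n_def)
  finally have \<kappa>: "\<Lambda> \<le> \<kappa>" .
  have "S \<noteq> {}" using in_S[OF I0(1) _ m0] by (auto simp: n_def)
  moreover have "\<kappa> / 2 < Sup S" using \<kappa> \<Lambda> by (simp add: \<kappa>_def)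
  ultimately obtain s where "s \<in> S" "\<kappa> / 2 < s"
    using less_cSup_iff[OF _ bdd] by blast
  then obtain I and x :: "nat \<Rightarrow> 'a" where x: "finite I" "card I \<le> n" "mean_sq I I x = 1"
    "\<kappa> / 2 < (\<Sum>i\<in>I. norm (x i) powr q)"
    by (auto simp: S_def)
  show ?thesis
  proof (intro exI[of _ I] exI[of _ x] exI[of _ \<kappa>] conjI allI impI)
    fix L :: "nat set" and y :: "nat \<Rightarrow> 'a" assume L: "finite L" "card L \<le> card I"
    show "(\<Sum>l\<in>L. norm (y l) powr q) \<le> \<kappa> * mean_sq L L y powr (q / 2)"
    proof (cases "mean_sq L L y = 0")
      case True
      then show ?thesis using zero[OF L(1) True] by simp
    next
      case False
      then have m: "0 < mean_sq L L y" using mean_sq_nonneg[of L L y] by simp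
      have "(\<Sum>l\<in>L. norm (y l) powr q) / mean_sq L L y powr (q / 2) \<le> \<kappa>"
        unfolding \<kappa>_def using in_S[OF L(1) _ m] L(2) x(2) bdd by (intro cSup_upper) auto
      then show ?thesis using m by (simp add: field_simps)
    qed
  qed (use x \<kappa> in auto)
qed

text \<open>For fixed \<open>\<epsilon>\<close> the group sums form a family of at most
  \<open>card I\<close> vectors, to which \<open>ub\<close> applies. Averaging over
  \<open>\<epsilon>\<close> is an application of \<open>sum_powr_sum_le\<close> with exponent
  \<open>q / 2\<close>.\<close>

lemma mean_sq_disjoint_groups:
  fixes x :: "nat \<Rightarrow> 'a::real_normed_vector"
  assumes I: "finite I" and q: "2 \<le> q" and \<kappa>: "0 \<le> \<kappa>"
    and ub: "\<And>L (y :: nat \<Rightarrow> 'a). finite L \<Longrightarrow> card L \<le> card I \<Longrightarrow>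
       (\<Sum>l\<in>L. norm (y l) powr q) \<le> \<kappa> * mean_sq L L y powr (q / 2)"
    and \<A>: "\<A> \<subseteq> Pow I" "{} \<notin> \<A>" "disjoint \<A>"
  shows "(\<Sum>A\<in>\<A>. mean_sq I A x powr (q / 2)) \<le> \<kappa> * mean_sq I I x powr (q / 2)"
proof -
  \<comment> \<open>Labels each group by its least element and every other index by itself; the
    fibres partition \<open>I\<close> and the labels stay in \<open>I\<close>.\<close>
  define b where "b i = (if i \<in> \<Union>\<A> then Min (THE A. A \<in> \<A> \<and> i \<in> A) else i)" for i
  have fin\<A>: "finite \<A>" "\<And>A. A \<in> \<A> \<Longrightarrow> finite A"
    using \<A>(1) I by (auto intro: finite_subset)
  have b_in: "b i = Min A" if "A \<in> \<A>" "i \<in> A" for i A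
  proof -
    have "(THE A. A \<in> \<A> \<and> i \<in> A) = A"
      using that \<A>(3) by (intro the_equality) (auto simp: disjoint_def)
    then show ?thesis using that by (auto simp: b_def)
  qed
  have Min_in: "Min A \<in> A" if "A \<in> \<A>" for A
    using that \<A>(2) fin\<A>(2) by (intro Min_in) auto
  have same: "A = A'" if "A \<in> \<A>" "A' \<in> \<A>" "Min A \<in> A'" for A A'
    using that \<A>(3) Min_in[OF that(1)] by (auto simp: disjoint_def)
  have fibre: "{i \<in> I. b i = Min A} = A" if A: "A \<in> \<A>" for A
  proof
    show "A \<subseteq> {i \<in> I. b i = Min A}" using b_in[OF A] \<A>(1) A by auto
    show "{i \<in> I. b i = Min A} \<subseteq> A"
    proof
      fix i assume i: "i \<in> {i \<in> I. b i = Min A}"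
      show "i \<in> A"
      proof (cases "i \<in> \<Union>\<A>")
        case True
        then obtain A' where A': "A' \<in> \<A>" "i \<in> A'" by blast
        then have "Min A' = Min A" using b_in i by auto
        then have "A' = A" using same[OF A'(1) A] Min_in[OF A] by simp
        then show ?thesis using A' by simp
      next
        case False
        then show ?thesis using i Min_in[OF A] by (simp add: b_def)
      qed
    qed
  qed
  have b_I: "b i \<in> I" if "i \<in> I" for i
  proof (cases "i \<in> \<Union>\<A>")
    case True
    then obtain A' where "A' \<in> \<A>" "i \<in> A'" by blast
    then show ?thesis using b_in Min_in \<A>(1) by (metis PowD subsetD)
  qed (use that in \<open>simp add: b_def\<close>)
  define L where "L = b ` I"
  have L: "finite L" "card L \<le> card I" "L \<subseteq> I"
    using I b_I by (auto simp: L_def card_image_le)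
  define Y where "Y \<epsilon> l = (\<Sum>i | i \<in> I \<and> b i = l. \<epsilon> i *\<^sub>R x i)" for \<epsilon> :: "nat \<Rightarrow> real" and l
  have Y_sum: "(\<Sum>l\<in>L. \<delta> l *\<^sub>R Y \<epsilon> l) = (\<Sum>i\<in>I. \<epsilon> i *\<^sub>R \<delta> (b i) *\<^sub>R x i)" for \<delta> \<epsilon> :: "nat \<Rightarrow> real"
  proof -
    have "(\<Sum>l\<in>L. \<delta> l *\<^sub>R Y \<epsilon> l) = (\<Sum>l\<in>L. \<Sum>i | i \<in> I \<and> b i = l. \<epsilon> i *\<^sub>R \<delta> (b i) *\<^sub>R x i)"
      by (simp add: Y_def scaleR_sum_right mult.commute)
    also have "\<dots> = (\<Sum>i\<in>I. \<epsilon> i *\<^sub>R \<delta> (b i) *\<^sub>R x i)"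
      using I L(1) by (intro sum.group) (auto simp: L_def)
    finally show ?thesis .
  qed
  define c where "c = real (card (signs I))"
  have c: "c > 0" using card_signs_pos[OF I] by (simp add: c_def)
  define H where "H \<epsilon> = mean_sq L L (Y \<epsilon>) / c" for \<epsilon>
  \<comment> \<open>For each \<open>\<delta>\<close> the factors \<open>\<delta> (b i)\<close> only
    flip signs, which leaves the mean over \<open>\<epsilon>\<close> unchanged.\<close>
  have sumH: "(\<Sum>\<epsilon>\<in>signs I. H \<epsilon>) = mean_sq I I x"
  proof -
    have "(\<Sum>\<epsilon>\<in>signs I. H \<epsilon>)
        = (\<Sum>\<epsilon>\<in>signs I. \<Sum>\<delta>\<in>signs L. (norm (\<Sum>i\<in>I. \<epsilon> i *\<^sub>R \<delta> (b i) *\<^sub>R x i))\<^sup>2 / c / card (signs L))"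
      by (simp add: H_def mean_sq_def Y_sum sum_divide_distrib mult.commute)
    also have "\<dots> = (\<Sum>\<delta>\<in>signs L. (\<Sum>\<epsilon>\<in>signs I. (norm (\<Sum>i\<in>I. \<epsilon> i *\<^sub>R \<delta> (b i) *\<^sub>R x i))\<^sup>2 / c) / card (signs L))"
      by (subst sum.swap) (simp add: sum_divide_distrib)
    also have "\<dots> = (\<Sum>\<delta>\<in>signs L. mean_sq I I x / card (signs L))"
    proof (rule sum.cong[OF refl])
      fix \<delta> assume \<delta>: "\<delta> \<in> signs L"
      have "mean_sq I I (\<lambda>i. \<delta> (b i) *\<^sub>R x i) = mean_sq I I x"
        using signs_values[OF \<delta>] by (intro mean_sq_flip) (auto simp: L_def)
      then show "(\<Sum>\<epsilon>\<in>signs I. (norm (\<Sum>i\<in>I. \<epsilon> i *\<^sub>R \<delta> (b i) *\<^sub>R x i))\<^sup>2 / c) / card (signs L)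
          = mean_sq I I x / card (signs L)"
        by (simp add: mean_sq_def c_def sum_divide_distrib)
    qed
    also have "\<dots> = mean_sq I I x" using card_signs_pos[OF L(1)] by simp
    finally show ?thesis .
  qed
  have mean_A: "(\<Sum>\<epsilon>\<in>signs I. (norm (Y \<epsilon> (Min A)))\<^sup>2 / c) = mean_sq I A x" if "A \<in> \<A>" for A
    using fibre[OF that] by (simp add: Y_def mean_sq_def c_def sum_divide_distrib)
  have inj: "inj_on Min \<A>"
    using same Min_in by (metis inj_onI)
  have sub: "Min ` \<A> \<subseteq> L"
  proof
    fix l assume "l \<in> Min ` \<A>"
    then obtain A where A: "A \<in> \<A>" "l = Min A" by blast
    then have "b (Min A) = l" using b_in Min_in by simp
    then show "l \<in> L" using A Min_in \<A>(1) unfolding L_def by (metis PowD imageI subsetD)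
  qed
  have "(\<Sum>A\<in>\<A>. mean_sq I A x powr (q / 2)) = (\<Sum>l\<in>Min ` \<A>. (\<Sum>\<epsilon>\<in>signs I. (norm (Y \<epsilon> l))\<^sup>2 / c) powr (q / 2))"
    by (subst sum.reindex[OF inj]) (simp add: mean_A)
  also have "\<dots> \<le> (\<Sum>l\<in>L. (\<Sum>\<epsilon>\<in>signs I. (norm (Y \<epsilon> l))\<^sup>2 / c) powr (q / 2))"
    using sub L(1) by (intro sum_mono2) auto
  also have "\<dots> \<le> \<kappa> * (\<Sum>\<epsilon>\<in>signs I. H \<epsilon>) powr (q / 2)"
  proof (rule sum_powr_sum_le)
    fix \<epsilon> :: "nat \<Rightarrow> real"
    have "((norm (Y \<epsilon> l))\<^sup>2 / c) powr (q / 2) = norm (Y \<epsilon> l) powr q / c powr (q / 2)" for l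
    proof -
      have "((norm (Y \<epsilon> l))\<^sup>2) powr (q / 2) = norm (Y \<epsilon> l) powr q"
        using powr_powr[of "norm (Y \<epsilon> l)" 2 "q / 2"] by (cases "norm (Y \<epsilon> l) = 0") (auto simp: powr_numeral)
      then show ?thesis using c by (simp add: powr_divide)
    qed
    then have "(\<Sum>l\<in>L. ((norm (Y \<epsilon> l))\<^sup>2 / c) powr (q / 2)) = (\<Sum>l\<in>L. norm (Y \<epsilon> l) powr q) / c powr (q / 2)"
      by (simp add: sum_divide_distrib)
    also have "\<dots> \<le> \<kappa> * mean_sq L L (Y \<epsilon>) powr (q / 2) / c powr (q / 2)"
      using ub[OF L(1,2)] by (intro divide_right_mono) auto
    also have "\<dots> = \<kappa> * H \<epsilon> powr (q / 2)"
      using c mean_sq_nonneg[of L L "Y \<epsilon>"] by (simp add: H_def powr_divide)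
    finally show "(\<Sum>l\<in>L. ((norm (Y \<epsilon> l))\<^sup>2 / c) powr (q / 2)) \<le> \<kappa> * H \<epsilon> powr (q / 2)" .
  qed (use L finite_signs[OF I] q c in \<open>auto simp: H_def mean_sq_nonneg\<close>)
  finally show ?thesis by (simp add: sumH)
qed

lemma maximal_disjoint_family:
  assumes "finite I"
  shows "\<exists>\<A>\<subseteq>Pow I. {} \<notin> \<A> \<and> disjoint \<A> \<and> (\<forall>A\<in>\<A>. P A) \<and>
    (\<forall>A. A \<subseteq> I - \<Union>\<A> \<longrightarrow> A \<noteq> {} \<longrightarrow> \<not> P A)"
proof -
  define F where "F = {\<A>. \<A> \<subseteq> Pow I \<and> {} \<notin> \<A> \<and> disjoint \<A> \<and> (\<forall>A\<in>\<A>. P A)}"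
  have "F \<subseteq> Pow (Pow I)" by (auto simp: F_def)
  then have fin: "finite F" using assms by (auto intro: finite_subset)
  have "{} \<in> F" by (simp add: F_def)
  from finite_has_maximal2[OF fin this] obtain \<A>
    where \<A>: "\<A> \<in> F" "\<And>\<B>. \<B> \<in> F \<Longrightarrow> \<A> \<subseteq> \<B> \<Longrightarrow> \<A> = \<B>" by metis
  have "\<not> P A" if A: "A \<subseteq> I - \<Union>\<A>" "A \<noteq> {}" for A
  proof
    assume "P A"
    then have "insert A \<A> \<in> F"
      using \<A>(1) A by (auto simp: F_def disjoint_def)
    then have "A \<in> \<A>" using \<A>(2)[of "insert A \<A>"] by auto
    then show False using A by auto
  qed
  then show ?thesis using \<A>(1) unfolding F_def by blast
qed

section \<open>Unconditional vectors in the absence of cotype\<close>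

lemma unconditional_vectors_exist:
  fixes q :: real
  assumes q: "2 < q"
    and fail: "\<And>C. \<exists>I (x :: nat \<Rightarrow> 'a::real_normed_vector). finite I \<and>
      C * mean_sq I I x powr (q / 2) < (\<Sum>i\<in>I. norm (x i) powr q)"
  shows "\<exists>K>0. \<forall>N. \<exists>y :: nat \<Rightarrow> 'a. (\<forall>j<N. 1 \<le> norm (y j)) \<and>
    (\<forall>\<delta>. (\<forall>j. \<delta> j \<in> {-1, 1}) \<longrightarrow> norm (\<Sum>j<N. \<delta> j *\<^sub>R y j) \<le> K * real N powr (1 / q))"
proof -
  define r where "r = q / 2"
  have r: "1 < r" using q by (simp add: r_def)
  have two_r: "(z\<^sup>2) powr r = z powr q" if "0 \<le> z" for z :: real
    using powr_powr[of z 2 r] that by (cases "z = 0") (auto simp: r_def powr_numeral)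
  \<comment> \<open>Arranged so that \<open>(N0 / 16) powr r\<close> is at least
    \<open>8 * N0\<close>, which will make a cluster of \<open>N0\<close> vectors
    \<open>bad\<close>. This is where \<open>r > 1\<close>, that is \<open>q > 2\<close>,
    enters.\<close>
  define Q where "Q = (8 * 16 powr r) powr (1 / (r - 1))"
  obtain N0 :: nat where "max 1 Q \<le> real N0" using real_arch_simple by blast
  then have N0: "1 \<le> N0" "Q \<le> real N0" by auto
  have "Q powr (r - 1) \<le> real N0 powr (r - 1)"
    using N0 r by (intro powr_mono2) (auto simp: Q_def)
  then have "8 * 16 powr r \<le> real N0 powr (r - 1)" using r by (simp add: Q_def powr_powr)
  then have "8 * 16 powr r * real N0 \<le> real N0 powr (r - 1) * real N0"
    by (rule mult_right_mono) simp
  also have "\<dots> = real N0 powr r" using N0 by (simp add: powr_diff)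
  finally have N0_r: "8 * real N0 \<le> (N0 / 16) powr r" by (simp add: powr_divide field_simps)
  \<comment> \<open>The value of \<open>2 * \<beta> / t\<close> below, apart from the factor
    \<open>N powr (1 / q)\<close>.\<close>
  define K where "K = 8 * sqrt N0 * 8 powr (1 / q)"
  have "\<exists>y :: nat \<Rightarrow> 'a. (\<forall>j<N. 1 \<le> norm (y j)) \<and>
    (\<forall>\<delta>. (\<forall>j. \<delta> j \<in> {-1, 1}) \<longrightarrow> norm (\<Sum>j<N. \<delta> j *\<^sub>R y j) \<le> K * real N powr (1 / q))"
    if N: "0 < N" for N
  proof -
    \<comment> \<open>A block of \<open>N0\<close> consecutive positions for each of the
      \<open>N\<close> differences to be built.\<close>
    define m where "m = N * N0"
    obtain R where R: "\<forall>(w :: nat \<Rightarrow> 'a) \<beta>.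
      (\<forall>A. A \<subseteq> {..<R} \<longrightarrow> card A = N \<longrightarrow> (\<exists>\<epsilon>\<in>signs A. norm (\<Sum>i\<in>A. \<epsilon> i *\<^sub>R w i) \<le> \<beta>)) \<longrightarrow>
      (\<exists>p\<in>signs {..<N}. \<exists>g. strict_mono_on {..<m} g \<and> g ` {..<m} \<subseteq> {..<R} \<and>
        (\<forall>s. strict_mono_on {..<N} s \<and> s ` {..<N} \<subseteq> {..<m} \<longrightarrow>
          norm (\<Sum>j<N. p j *\<^sub>R w (g (s j))) \<le> \<beta>))"
      using ramsey_sign_pattern[where 'a='a and N=N and m=m] ..
    obtain I and x :: "nat \<Rightarrow> 'a" and \<kappa> where I: "finite I" and \<kappa>: "8 * real R + 8 \<le> \<kappa>"
      and mean: "0 < mean_sq I I x"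
      and ext: "\<kappa> / 2 * mean_sq I I x powr (q / 2) \<le> (\<Sum>i\<in>I. norm (x i) powr q)"
      and ub: "\<And>L (y :: nat \<Rightarrow> 'a). finite L \<Longrightarrow> card L \<le> card I \<Longrightarrow>
       (\<Sum>l\<in>L. norm (y l) powr q) \<le> \<kappa> * mean_sq L L y powr (q / 2)"
      using near_extremal_family[OF _ _ fail, of "8 * real R + 8"] q by auto
    define mass where "mass A = (\<Sum>i\<in>A. norm (x i) powr q)" for A
    define E where "E = mean_sq I I x powr r"
    have E: "E > 0" using mean by (simp add: E_def)
    \<comment> \<open>Disjoint \<open>bad\<close> groups have total mass at most
      \<open>\<kappa> * E / 8\<close>, while \<open>I\<close> has mass at least
      \<open>\<kappa> * E / 2\<close>. Removing a maximal family of them leaves \<open>J\<close>,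
      with mass at least \<open>3 / 8 * (\<kappa> * E)\<close> and without nonempty
      \<open>bad\<close> subsets.\<close>
    define bad where "bad A \<longleftrightarrow> 8 * mass A \<le> mean_sq I A x powr r" for A
    from maximal_disjoint_family[OF I, of bad] obtain \<A> where
      "\<A> \<subseteq> Pow I \<and> {} \<notin> \<A> \<and> disjoint \<A> \<and> (\<forall>A\<in>\<A>. bad A) \<and>
        (\<forall>A. A \<subseteq> I - \<Union>\<A> \<longrightarrow> A \<noteq> {} \<longrightarrow> \<not> bad A)" ..
    then have \<A>: "\<A> \<subseteq> Pow I" "{} \<notin> \<A>" "disjoint \<A>" "\<And>A. A \<in> \<A> \<Longrightarrow> bad A"
      and not_bad: "\<And>A. A \<subseteq> I - \<Union>\<A> \<Longrightarrow> A \<noteq> {} \<Longrightarrow> \<not> bad A"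
      by simp_all
    define J where "J = I - \<Union>\<A>"
    have fin_A: "finite A" if "A \<in> \<A>" for A using that \<A>(1) I by (auto intro: finite_subset)
    have "8 * mass (\<Union>\<A>) = (\<Sum>A\<in>\<A>. 8 * mass A)"
      unfolding mass_def using fin_A \<A>(3)
      by (subst sum.Union_disjoint) (auto simp: disjoint_def sum_distrib_left)
    also have "\<dots> \<le> (\<Sum>A\<in>\<A>. mean_sq I A x powr r)"
      using \<A>(4) by (intro sum_mono) (simp add: bad_def)
    also have "\<dots> \<le> \<kappa> * E"
      unfolding r_def E_def using mean_sq_disjoint_groups[OF I _ _ ub \<A>(1-3)] q \<kappa> by auto
    finally have "8 * mass (\<Union>\<A>) \<le> \<kappa> * E" .
    moreover have "mass I = mass J + mass (\<Union>\<A>)"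
      unfolding mass_def J_def using I \<A>(1) by (intro sum.subset_diff) auto
    moreover have "\<kappa> / 2 * E \<le> mass I" using ext by (simp add: mass_def E_def r_def)
    ultimately have massJ: "3 / 8 * (\<kappa> * E) \<le> mass J" by simp
    \<comment> \<open>If every dyadic level had at most \<open>R\<close> elements, the level lemma
      with exponent 0 would bound the mass of \<open>J\<close> by \<open>2 * R * E\<close>, too
      little because \<open>\<kappa>\<close> is at least \<open>8 * R + 8\<close>.\<close>
    have "\<exists>c>0. R < card {i \<in> J. c / 2 < norm (x i) \<and> norm (x i) \<le> c}"
    proof (rule ccontr)
      assume "\<not> ?thesis"
      then have level: "card {i \<in> J. c / 2 < norm (x i) \<and> norm (x i) \<le> c} \<le> R" if "c > 0" for c
        using that by (meson not_le)
      have "(\<Sum>i\<in>J. norm (x i) powr q) \<le> R * sqrt (mean_sq I I x) powr (q - 0) / (1 - 2 powr (0 - q))"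
      proof (rule dyadic_level_sum_le)
        show "norm (x i) \<le> sqrt (mean_sq I I x)" if "i \<in> J" for i
          using norm_le_mean_sq[OF I, of i x] that by (intro real_le_rsqrt) (simp add: J_def)
      qed (use I level q in \<open>auto simp: J_def\<close>)
      also have "sqrt (mean_sq I I x) powr (q - 0) = E"
        using two_r[of "sqrt (mean_sq I I x)"] mean by (simp add: E_def)
      also have "R * E / (1 - 2 powr (0 - q)) \<le> R * E / (1 / 2)"
      proof (intro divide_left_mono)
        have "2 powr (0 - q) \<le> (2::real) powr (-1)" using q by (intro powr_mono) auto
        then show "1 / 2 \<le> 1 - (2::real) powr (0 - q)" by (simp add: powr_minus)
        then show "0 < (1 - (2::real) powr (0 - q)) * (1 / 2)" by simp
      qed (use E in auto)
      finally have "mass J \<le> 2 * R * E" by (simp add: mass_def)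
      moreover have "(8 * real R + 8) * E \<le> \<kappa> * E" using \<kappa> E by (intro mult_right_mono) auto
      ultimately have "3 / 8 * ((8 * real R + 8) * E) \<le> 2 * R * E" using massJ by linarith
      then have "(3 * real R + 3) * E \<le> (2 * R) * E" by (simp add: algebra_simps)
      then show False using E by simp
    qed
    then obtain c where c: "c > 0" and card_level: "R < card {i \<in> J. c / 2 < norm (x i) \<and> norm (x i) \<le> c}"
      by blast
    define J' where "J' = {i \<in> J. c / 2 < norm (x i) \<and> norm (x i) \<le> c}"
    have card_J': "R < card J'" using card_level unfolding J'_def .
    have J': "finite J'" "J' \<subseteq> I - \<Union>\<A>" using I by (auto simp: J'_def J_def)
    have norm_J': "c / 2 < norm (x i)" "norm (x i) \<le> c" if "i \<in> J'" for i
      using that by (auto simp: J'_def)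
    have mass_le: "mass A \<le> card A * c powr q" if "A \<subseteq> J'" for A
    proof -
      have "mass A \<le> (\<Sum>i\<in>A. c powr q)"
        unfolding mass_def using that norm_J' q by (intro sum_mono powr_mono2) auto
      then show ?thesis by simp
    qed
    define e where "e i = sorted_list_of_set J' ! i" for i
    have e_mono: "strict_mono_on {..<R} e"
      using nth_sorted_list_of_set_strict_mono_on[of J'] card_J'
      unfolding e_def by (auto simp: strict_mono_on_def)
    then have e_inj: "inj_on e {..<R}" by (rule strict_mono_on_imp_inj_on)
    have e_J': "e i \<in> J'" if "i < R" for i
    proof -
      have "i < length (sorted_list_of_set J')" using that card_J' by simp
      then show ?thesis using J'(1) nth_mem[of i "sorted_list_of_set J'"] by (simp add: e_def)
    qed
    \<comment> \<open>Bounds the root mean square over \<open>N\<close> vectors of the level: their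
      mass is at most \<open>N * c powr q\<close>, and their set is not \<open>bad\<close>.\<close>
    define \<beta> where "\<beta> = (8 * real N) powr (1 / q) * c"
    have small: "\<exists>\<epsilon>\<in>signs A. norm (\<Sum>i\<in>A. \<epsilon> i *\<^sub>R x (e i)) \<le> \<beta>" if A: "A \<subseteq> {..<R}" "card A = N" for A
    proof -
      have inj: "inj_on e A" using e_inj A(1) by (rule inj_on_subset)
      have eA: "e ` A \<subseteq> J'" using e_J' A(1) by auto
      have "A \<noteq> {}" using A N by auto
      then have "\<not> bad (e ` A)" using not_bad[of "e ` A"] eA J'(2) by blast
      then have "mean_sq I (e ` A) x powr r < 8 * mass (e ` A)" by (simp add: bad_def)
      also have "\<dots> \<le> 8 * (N * c powr q)"
        using mass_le[OF eA] A(2) card_image[OF inj] by simp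
      finally have mean_lt: "mean_sq I (e ` A) x powr r < 8 * (N * c powr q)" .
      obtain \<epsilon> where \<epsilon>: "\<epsilon> \<in> signs I" "(norm (\<Sum>i\<in>e ` A. \<epsilon> i *\<^sub>R x i))\<^sup>2 \<le> mean_sq I (e ` A) x"
        using exists_sign_le_mean_sq[OF I] by blast
      define n where "n = norm (\<Sum>i\<in>e ` A. \<epsilon> i *\<^sub>R x i)"
      have "n powr q = (n\<^sup>2) powr r" using two_r[of n] by (simp add: n_def)
      also have "\<dots> \<le> mean_sq I (e ` A) x powr r" using \<epsilon>(2) r by (intro powr_mono2) (auto simp: n_def)
      finally have "(n powr q) powr (1 / q) \<le> (8 * real N * c powr q) powr (1 / q)"
        using mean_lt q by (intro powr_mono2) (auto simp: n_def)
      then have "n \<le> \<beta>" using q c by (simp add: powr_powr powr_mult n_def \<beta>_def)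
      moreover have "(\<Sum>i\<in>e ` A. \<epsilon> i *\<^sub>R x i) = (\<Sum>i\<in>A. restrict (\<lambda>i. \<epsilon> (e i)) A i *\<^sub>R x (e i))"
        using inj by (simp add: sum.reindex)
      moreover have "restrict (\<lambda>i. \<epsilon> (e i)) A \<in> signs A"
        using signs_values[OF \<epsilon>(1)] eA J'(2) unfolding signs_def by (intro restrict_PiE_iff[THEN iffD2]) blast
      ultimately show ?thesis unfolding n_def by metis
    qed
    have "\<exists>p\<in>signs {..<N}. \<exists>g. strict_mono_on {..<m} g \<and> g ` {..<m} \<subseteq> {..<R} \<and>
        (\<forall>s. strict_mono_on {..<N} s \<and> s ` {..<N} \<subseteq> {..<m} \<longrightarrow>
          norm (\<Sum>j<N. p j *\<^sub>R x (e (g (s j)))) \<le> \<beta>)"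
      by (rule R[rule_format, of "\<lambda>i. x (e i)" \<beta>, OF small])
    then obtain p g where p: "p \<in> signs {..<N}" and g: "strict_mono_on {..<m} g" "g ` {..<m} \<subseteq> {..<R}"
      and "\<forall>s. strict_mono_on {..<N} s \<and> s ` {..<N} \<subseteq> {..<m} \<longrightarrow>
          norm (\<Sum>j<N. p j *\<^sub>R x (e (g (s j)))) \<le> \<beta>" by (elim bexE exE conjE)
    then have pg: "\<And>s. strict_mono_on {..<N} s \<Longrightarrow> s ` {..<N} \<subseteq> {..<m} \<Longrightarrow>
          norm (\<Sum>j<N. p j *\<^sub>R x (e (g (s j)))) \<le> \<beta>" by simp
    have g_inj: "inj_on g {..<m}" using g(1) by (rule strict_mono_on_imp_inj_on)
    \<comment> \<open>With this \<open>t\<close> the error \<open>(N0 * t)\<^sup>2\<close> of the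
      cluster estimate is half of the lower bound \<open>N0 * c\<^sup>2 / 8\<close> for its main
      term.\<close>
    define t where "t = c / (4 * sqrt N0)"
    have t: "t > 0" using c N0 by (simp add: t_def)
    \<comment> \<open>Otherwise the vectors of the block cluster around its first one, and the block
      is \<open>bad\<close> by the choice of \<open>N0\<close> and \<open>t\<close>.\<close>
    have "\<exists>a b. a \<in> {j * N0..<Suc j * N0} \<and> b \<in> {j * N0..<Suc j * N0} \<and> t < norm (x (e (g a)) - x (e (g b)))"
      if j: "j < N" for j
    proof (rule ccontr)
      assume neg: "\<not> ?thesis"
      define T where "T = {j * N0..<Suc j * N0}"
      have "Suc j * N0 \<le> N * N0" using j by (intro mult_le_mono1) auto
      then have T: "T \<subseteq> {..<m}" by (auto simp: T_def m_def)
      define B where "B = e ` g ` T"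
      have gT: "g ` T \<subseteq> {..<R}" using g(2) T by blast
      have card_B: "card B = N0"
        unfolding B_def using card_image[OF inj_on_subset[OF e_inj gT]] card_image[OF inj_on_subset[OF g_inj T]]
        by (simp add: T_def)
      have BJ: "B \<subseteq> J'" using e_J' gT by (auto simp: B_def)
      have j0: "j * N0 \<in> T" using N0 by (simp add: T_def)
      define z where "z = x (e (g (j * N0)))"
      have zc: "c / 2 < norm z" using norm_J'[of "e (g (j * N0))"] BJ j0 by (auto simp: B_def z_def)
      have close: "norm (x i - z) \<le> t" if "i \<in> B" for i
      proof -
        from that obtain k where k: "k \<in> T" "i = e (g k)" by (auto simp: B_def)
        then have "\<not> t < norm (x (e (g k)) - x (e (g (j * N0))))"
          using neg j0 unfolding T_def by blast
        then show ?thesis by (simp add: k z_def)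
      qed
      have "B \<subseteq> I" using BJ J' by auto
      from mean_sq_clustered_ge[OF I this close]
      have "N0 * (norm z)\<^sup>2 / 2 - (N0 * t)\<^sup>2 \<le> mean_sq I B x" by (simp add: card_B)
      moreover have "(c / 2)\<^sup>2 \<le> (norm z)\<^sup>2" using zc c by (intro power_mono) auto
      then have "N0 * (c / 2)\<^sup>2 / 2 \<le> N0 * (norm z)\<^sup>2 / 2"
        by (intro divide_right_mono mult_left_mono) auto
      moreover have "(N0 * t)\<^sup>2 = N0 * c\<^sup>2 / 16"
        using N0 by (simp add: t_def power_mult_distrib power_divide power2_eq_square)
      ultimately have "N0 / 16 * c\<^sup>2 \<le> mean_sq I B x" by (simp add: power_divide)
      then have "(N0 / 16 * c\<^sup>2) powr r \<le> mean_sq I B x powr r" using r by (intro powr_mono2) auto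
      then have "(N0 / 16) powr r * c powr q \<le> mean_sq I B x powr r"
        using c two_r[of c] by (subst (asm) powr_mult) auto
      moreover have "8 * real N0 * c powr q \<le> (N0 / 16) powr r * c powr q"
        using N0_r by (rule mult_right_mono) simp
      ultimately have "bad B" using mass_le[OF BJ] by (simp add: bad_def card_B)
      moreover have "B \<noteq> {}" using j0 by (auto simp: B_def)
      ultimately show False using not_bad BJ J'(2) by blast
    qed
    then obtain a b where ab: "\<And>j. j < N \<Longrightarrow> a j \<in> {j * N0..<Suc j * N0}"
      "\<And>j. j < N \<Longrightarrow> b j \<in> {j * N0..<Suc j * N0}"
      "\<And>j. j < N \<Longrightarrow> t < norm (x (e (g (a j))) - x (e (g (b j))))"
      by metis
    \<comment> \<open>One position from each successive block is an increasing selection, so the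
      homogeneous pattern applies to it.\<close>
    have select: "norm (\<Sum>j<N. p j *\<^sub>R x (e (g (s j)))) \<le> \<beta>"
      if s: "\<And>j. j < N \<Longrightarrow> s j \<in> {j * N0..<Suc j * N0}" for s
    proof (rule pg)
      show "strict_mono_on {..<N} s"
      proof (rule strict_mono_onI)
        fix i j assume ij: "i \<in> {..<N}" "j \<in> {..<N}" "i < j"
        have "s i < Suc i * N0" using s ij by auto
        also have "\<dots> \<le> j * N0" using ij by (intro mult_le_mono1) auto
        also have "\<dots> \<le> s j" using s ij by auto
        finally show "s i < s j" .
      qed
      have "s j < m" if "j < N" for j
      proof -
        have "s j < Suc j * N0" using s[OF that] by auto
        also have "\<dots> \<le> N * N0" using that by (intro mult_le_mono1) auto
        finally show ?thesis by (simp add: m_def)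
      qed
      then show "s ` {..<N} \<subseteq> {..<m}" by auto
    qed
    define y where "y j = (p j / t) *\<^sub>R (x (e (g (a j))) - x (e (g (b j))))" for j
    have "1 \<le> norm (y j)" if "j < N" for j
      using ab(3)[OF that] signs_abs[OF p, of j] that t by (simp add: y_def)
    moreover have "norm (\<Sum>j<N. \<delta> j *\<^sub>R y j) \<le> K * real N powr (1 / q)" if \<delta>: "\<forall>j. \<delta> j \<in> {-1, 1}" for \<delta>
    proof -
      define u where "u j = (if \<delta> j = 1 then a j else b j)" for j
      define v where "v j = (if \<delta> j = 1 then b j else a j)" for j
      text \<open>Flipping a sign only exchanges a j and b j, and both selections stay increasing.\<close>
      have summand: "\<delta> j *\<^sub>R y j = (1 / t) *\<^sub>R (p j *\<^sub>R x (e (g (u j))) - p j *\<^sub>R x (e (g (v j))))" for j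
        using \<delta>[rule_format, of j] by (auto simp: y_def u_def v_def scaleR_diff_right)
      have "(\<Sum>j<N. \<delta> j *\<^sub>R y j) = (1 / t) *\<^sub>R ((\<Sum>j<N. p j *\<^sub>R x (e (g (u j)))) - (\<Sum>j<N. p j *\<^sub>R x (e (g (v j)))))"
        unfolding summand sum_subtractf[symmetric] scaleR_sum_right ..
      then have "norm (\<Sum>j<N. \<delta> j *\<^sub>R y j)
          = norm ((\<Sum>j<N. p j *\<^sub>R x (e (g (u j)))) - (\<Sum>j<N. p j *\<^sub>R x (e (g (v j))))) / t"
        using t by simp
      also have "\<dots> \<le> (\<beta> + \<beta>) / t"
        using t ab(1,2)
        by (intro divide_right_mono order_trans[OF norm_triangle_ineq4] add_mono select) (auto simp: u_def v_def)
      also have "\<dots> = K * real N powr (1 / q)"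
        using c N0 by (simp add: \<beta>_def t_def K_def powr_mult)
      finally show ?thesis .
    qed
    ultimately show ?thesis by blast
  qed
  then have "\<exists>y :: nat \<Rightarrow> 'a. (\<forall>j<N. 1 \<le> norm (y j)) \<and>
    (\<forall>\<delta>. (\<forall>j. \<delta> j \<in> {-1, 1}) \<longrightarrow> norm (\<Sum>j<N. \<delta> j *\<^sub>R y j) \<le> K * real N powr (1 / q))" for N
    by (cases "N = 0") auto
  moreover have "K > 0" using N0 by (simp add: K_def)
  ultimately show ?thesis by blast
qed

text \<open>Without this cotype the unconditional vectors exist for every \<open>N\<close>, and the
  summing property forces \<open>N\<close> to be at most a constant times
  \<open>N powr (s / q)\<close>, impossible for large \<open>N\<close> because
  \<open>s < q\<close>.\<close>

theorem summing_identity_imp_mean_cotype: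
  fixes q s :: real
  assumes q: "2 < q" and s: "0 < s" "s < q" and summing: "summing_identity TYPE('a::real_normed_vector) s"
  shows "\<exists>C. \<forall>I (x :: nat \<Rightarrow> 'a). finite I \<longrightarrow>
    (\<Sum>i\<in>I. norm (x i) powr q) \<le> C * mean_sq I I x powr (q / 2)"
proof (rule ccontr)
  assume "\<not> ?thesis"
  then have "\<exists>I (x :: nat \<Rightarrow> 'a). finite I \<and>
      C * mean_sq I I x powr (q / 2) < (\<Sum>i\<in>I. norm (x i) powr q)" for C
    by (meson not_le)
  from unconditional_vectors_exist[OF q this] obtain K where K: "K > 0"
    "\<forall>N. \<exists>y :: nat \<Rightarrow> 'a. (\<forall>j<N. 1 \<le> norm (y j)) \<and>
    (\<forall>\<delta>. (\<forall>j. \<delta> j \<in> {-1, 1}) \<longrightarrow> norm (\<Sum>j<N. \<delta> j *\<^sub>R y j) \<le> K * real N powr (1 / q))"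
    by blast
  obtain C where C: "C > 0" "\<And>N (x :: nat \<Rightarrow> 'a) B.
     (\<And>\<epsilon>. (\<And>i. \<epsilon> i \<in> {-1, 1::real}) \<Longrightarrow> norm (\<Sum>i<N. \<epsilon> i *\<^sub>R x i) \<le> B) \<Longrightarrow>
     (\<Sum>i<N. norm (x i) powr s) \<le> C * B powr s"
    using summing_identityE[OF summing] by blast
  define D where "D = C * K powr s"
  have le: "real N powr (1 - s / q) \<le> D" if N: "0 < N" for N
  proof -
    obtain y :: "nat \<Rightarrow> 'a" where y: "\<And>j. j < N \<Longrightarrow> 1 \<le> norm (y j)"
      "\<And>\<delta>. (\<forall>j. \<delta> j \<in> {-1, 1}) \<Longrightarrow> norm (\<Sum>j<N. \<delta> j *\<^sub>R y j) \<le> K * real N powr (1 / q)"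
      using K(2) by blast
    have "(\<Sum>j<N. 1) \<le> (\<Sum>j<N. norm (y j) powr s)"
      using y(1) s by (intro sum_mono ge_one_powr_ge_zero) auto
    also have "\<dots> \<le> C * (K * real N powr (1 / q)) powr s"
      using y(2) by (intro C(2)) auto
    also have "\<dots> = D * real N powr (s / q)"
      using K by (simp add: D_def powr_mult powr_powr)
    finally have "real N / real N powr (s / q) \<le> D" using N by (simp add: field_simps)
    then show ?thesis using N by (simp add: powr_diff)
  qed
  define \<theta> where "\<theta> = 1 - s / q"
  have \<theta>: "\<theta> > 0" using s q by (simp add: \<theta>_def)
  obtain N :: nat where N: "max 1 ((\<bar>D\<bar> + 1) powr (1 / \<theta>)) < real N"
    using reals_Archimedean2 by blast
  then have "((\<bar>D\<bar> + 1) powr (1 / \<theta>)) powr \<theta> \<le> real N powr \<theta>"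
    using \<theta> by (intro powr_mono2) auto
  then have "\<bar>D\<bar> + 1 \<le> real N powr \<theta>" using \<theta> by (simp add: powr_powr)
  also have "\<dots> \<le> D" unfolding \<theta>_def using N by (intro le) simp
  finally show False by simp
qed

section \<open>Rademacher functions\<close>

lemma rademacher_values: "rademacher n t \<in> {-1, 0, 1}"
  by (auto simp: rademacher_def sgn_if)

lemma rademacher_Suc: "rademacher (Suc n) t = rademacher n (2 * t)"
  by (simp add: rademacher_def algebra_simps)

lemma rademacher_periodic:
  assumes "0 < n"
  shows "rademacher n (t - 1) = rademacher n t"
proof -
  obtain k where n: "n = Suc k" using assms by (cases n) auto
  have "2 ^ n * pi * (t - 1) = 2 ^ n * pi * t - 2 * real (2 ^ k) * pi"
    by (simp add: n algebra_simps)
  then have "sin (2 ^ n * pi * (t - 1)) = sin (2 ^ n * pi * t)"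
    by (simp only: sin_diff sin_2npi cos_2npi)
  then show ?thesis by (simp add: rademacher_def)
qed

lemma rademacher_1_left: "0 < t \<Longrightarrow> t < 1 / 2 \<Longrightarrow> rademacher (Suc 0) t = 1"
  by (simp add: rademacher_def sin_gt_zero)

lemma rademacher_1_right:
  assumes "1 / 2 < t" "t < 1"
  shows "rademacher (Suc 0) t = -1"
proof -
  have "sin (2 * pi * t) < 0"
  proof (rule sin_lt_zero)
    show "pi < 2 * pi * t" using assms pi_gt_zero by (simp add: field_simps)
    show "2 * pi * t < 2 * pi" using assms pi_gt_zero by simp
  qed
  then show ?thesis by (simp add: rademacher_def)
qed

lemma sum_signs_insert:
  assumes "i \<notin> I" "finite I"
  shows "(\<Sum>\<epsilon>\<in>signs (insert i I). F \<epsilon>) = (\<Sum>\<epsilon>\<in>signs I. F (\<epsilon>(i := 1))) + (\<Sum>\<epsilon>\<in>signs I. F (\<epsilon>(i := -1)))"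
proof -
  have inj: "inj_on (\<lambda>\<epsilon>. \<epsilon>(i := c)) (signs I)" for c :: real
  proof (rule inj_onI)
    fix \<epsilon> \<delta> assume "\<epsilon> \<in> signs I" "\<delta> \<in> signs I" and eq: "\<epsilon>(i := c) = \<delta>(i := c)"
    then have "\<epsilon> i = \<delta> i" using assms(1) by (auto simp: signs_def PiE_def extensional_def)
    moreover have "\<epsilon> k = \<delta> k" if "k \<noteq> i" for k using fun_cong[OF eq, of k] that by simp
    ultimately show "\<epsilon> = \<delta>" by (metis ext)
  qed
  have "signs (insert i I) = (\<lambda>\<epsilon>. \<epsilon>(i := 1)) ` signs I \<union> (\<lambda>\<epsilon>. \<epsilon>(i := -1)) ` signs I"
    unfolding signs_def PiE_insert_eq by force
  moreover have "(\<lambda>\<epsilon>. \<epsilon>(i := 1)) ` signs I \<inter> (\<lambda>\<epsilon>. \<epsilon>(i := -1)) ` signs I = {}"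
    by (auto dest: fun_cong[of _ _ i])
  ultimately show ?thesis
    using finite_signs[OF assms(2)] by (simp add: sum.union_disjoint sum.reindex inj)
qed

text \<open>The index of the Rademacher functions is shifted against that of the vectors so that the
  induction can split off the first coordinate, on which the two halves of the interval differ.\<close>

lemma has_integral_rademacher_sum:
  fixes x :: "nat \<Rightarrow> 'a::real_normed_vector"
  shows "((\<lambda>t. (norm (z + (\<Sum>n=Suc k..k + N. rademacher (n - k) t *\<^sub>R x n)))\<^sup>2) has_integral
    (\<Sum>\<epsilon>\<in>signs {Suc k..k + N}. (norm (z + (\<Sum>n=Suc k..k + N. \<epsilon> n *\<^sub>R x n)))\<^sup>2) / 2 ^ N) {0..1}"
proof (induction N arbitrary: z k)
  case 0
  have "signs {Suc k..k + 0} = {\<lambda>_. undefined}" by (simp add: signs_def)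
  then show ?case using has_integral_const_real[of "(norm z)\<^sup>2" 0 1] by simp
next
  case (Suc N)
  define I where "I = {Suc (Suc k)..Suc k + N}"
  define h where "h z t = (norm (z + (\<Sum>n\<in>I. rademacher (n - Suc k) t *\<^sub>R x n)))\<^sup>2" for z t
  define M where "M z = (\<Sum>\<epsilon>\<in>signs I. (norm (z + (\<Sum>n\<in>I. \<epsilon> n *\<^sub>R x n)))\<^sup>2) / 2 ^ N" for z
  \<comment> \<open>The vector \<open>z\<close> has to be arbitrary: the hypothesis is used with the
    first term added to it under either sign.\<close>
  have IH: "(h z has_integral M z) (cbox 0 1)" for z
    unfolding h_def M_def I_def using Suc.IH[of z "Suc k"] by (simp only: box_real)
  have ins: "{Suc k..k + Suc N} = insert (Suc k) I" by (auto simp: I_def)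
  have I: "Suc k \<notin> I" "finite I" by (auto simp: I_def)
  define f where "f t = (norm (z + (\<Sum>n=Suc k..k + Suc N. rademacher (n - k) t *\<^sub>R x n)))\<^sup>2" for t
  have f: "f t = (norm (z + rademacher (Suc 0) t *\<^sub>R x (Suc k) + (\<Sum>n\<in>I. rademacher (n - Suc k) (2 * t) *\<^sub>R x n)))\<^sup>2" for t
  proof -
    have "rademacher (n - k) t = rademacher (n - Suc k) (2 * t)" if "n \<in> I" for n
      using that rademacher_Suc[of "n - Suc k" t] by (simp add: I_def Suc_diff_le flip: Suc_diff_Suc)
    then show ?thesis unfolding f_def ins using I by (simp add: add.assoc)
  qed
  \<comment> \<open>Stretching a half of the interval to the whole lowers the Rademacher index by
    one, and on the right half periodicity absorbs the shift. The first Rademacher function is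
    constant inside each half, so only the endpoints are exceptional.\<close>
  have half: "((\<lambda>t. u (2 * t + c)) has_integral m / 2) {- c / 2..(1 - c) / 2}"
    if "(u has_integral m) (cbox 0 1)" for u :: "real \<Rightarrow> real" and m c
  proof -
    have "((\<lambda>t. u (2 *\<^sub>R t + c)) has_integral (m /\<^sub>R 2 ^ DIM(real))) (cbox ((0 - c) /\<^sub>R 2) ((1 - c) /\<^sub>R 2))"
      by (rule has_integral_affinity'[OF that]) simp
    moreover have "m /\<^sub>R 2 ^ DIM(real) = m / 2" "cbox ((0 - c) /\<^sub>R 2) ((1 - c) /\<^sub>R 2) = {- c / 2..(1 - c) / 2}"
      by simp_all
    ultimately show ?thesis by (simp only: real_scaleR_def)
  qed
  have left: "(f has_integral M (z + x (Suc k)) / 2) {0..1 / 2}"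
  proof (rule has_integral_spike_finite[of "{0, 1 / 2}"])
    show "((\<lambda>t. h (z + x (Suc k)) (2 * t)) has_integral M (z + x (Suc k)) / 2) {0..1 / 2}"
      using half[OF IH[of "z + x (Suc k)"], of 0] by simp
    show "f t = h (z + x (Suc k)) (2 * t)" if "t \<in> {0..1 / 2} - {0, 1 / 2}" for t
      using that rademacher_1_left[of t] by (simp add: f h_def)
  qed simp
  have right: "(f has_integral M (z - x (Suc k)) / 2) {1 / 2..1}"
  proof (rule has_integral_spike_finite[of "{1 / 2, 1}"])
    show "((\<lambda>t. h (z - x (Suc k)) (2 * t - 1)) has_integral M (z - x (Suc k)) / 2) {1 / 2..1}"
      using half[OF IH[of "z - x (Suc k)"], of "- 1"] by simp
    show "f t = h (z - x (Suc k)) (2 * t - 1)" if "t \<in> {1 / 2..1} - {1 / 2, 1}" for t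
    proof -
      have "rademacher (n - Suc k) (2 * t - 1) = rademacher (n - Suc k) (2 * t)" if "n \<in> I" for n
        using that by (intro rademacher_periodic) (auto simp: I_def)
      then show ?thesis using that rademacher_1_right[of t] by (simp add: f h_def)
    qed
  qed simp
  have "(f has_integral M (z + x (Suc k)) / 2 + M (z - x (Suc k)) / 2) {0..1}"
    by (rule has_integral_combine[OF _ _ left right]) auto
  moreover have "M (z + x (Suc k)) / 2 + M (z - x (Suc k)) / 2
      = (\<Sum>\<epsilon>\<in>signs (insert (Suc k) I). (norm (z + (\<Sum>n\<in>insert (Suc k) I. \<epsilon> n *\<^sub>R x n)))\<^sup>2) / 2 ^ Suc N"
  proof -
    have upd: "(\<Sum>n\<in>I. (if n = Suc k then c else \<epsilon> n) *\<^sub>R x n) = (\<Sum>n\<in>I. \<epsilon> n *\<^sub>R x n)" for \<epsilon> and c :: real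
      using I(1) by (intro sum.cong) auto
    show ?thesis
      using I by (simp add: M_def sum_signs_insert upd add.assoc[symmetric] add_divide_distrib)
  qed
  ultimately show ?case unfolding f_def ins[symmetric] by simp
qed

section \<open>The Rademacher integral as a mean over signs\<close>

lemma rademacher_measurable: "rademacher n \<in> borel_measurable borel"
  unfolding rademacher_def[abs_def] by measurable

text \<open>Measurability of sums in a possibly nonseparable space is avoided by working with
  real-valued norms: a Rademacher function takes three values, and on each of them its term is
  absorbed into \<open>z\<close>.\<close>

lemma rademacher_sum_measurable:
  fixes x :: "nat \<Rightarrow> 'a::real_normed_vector"
  assumes "finite A"
  shows "(\<lambda>t. norm (z + (\<Sum>n\<in>A. rademacher n t *\<^sub>R x n))) \<in> borel_measurable borel"
  using assms
proof (induction A arbitrary: z rule: finite_induct)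
  case (insert m A)
  note [measurable] = rademacher_measurable insert.IH
  have "norm (z + (\<Sum>n\<in>insert m A. rademacher n t *\<^sub>R x n)) =
    (if rademacher m t = 1 then norm ((z + x m) + (\<Sum>n\<in>A. rademacher n t *\<^sub>R x n))
     else if rademacher m t = -1 then norm ((z - x m) + (\<Sum>n\<in>A. rademacher n t *\<^sub>R x n))
     else norm (z + (\<Sum>n\<in>A. rademacher n t *\<^sub>R x n)))" for t
    using insert rademacher_values[of m t] by (auto simp: algebra_simps)
  then show ?case by simp
qed simp

theorem rademacher_integral:
  fixes x :: "nat \<Rightarrow> 'a::real_normed_vector"
  shows "(LINT t:{0..1}|lborel. (norm (\<Sum>n=1..N. rademacher n t *\<^sub>R x n))\<^sup>2) = mean_sq {1..N} {1..N} x"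
proof -
  define f where "f t = (norm (\<Sum>n=1..N. rademacher n t *\<^sub>R x n))\<^sup>2" for t
  have meas: "f \<in> borel_measurable borel"
    using rademacher_sum_measurable[of "{1..N}" 0 x] unfolding f_def[abs_def] by simp
  have "norm (f t) \<le> (\<Sum>n=1..N. norm (x n))\<^sup>2" for t
  proof -
    have "norm (\<Sum>n=1..N. rademacher n t *\<^sub>R x n) \<le> (\<Sum>n=1..N. norm (x n))"
    proof (rule sum_norm_le)
      show "norm (rademacher n t *\<^sub>R x n) \<le> norm (x n)" for n
        using rademacher_values[of n t] by auto
    qed
    then show ?thesis by (simp add: f_def power_mono)
  qed
  then have "set_integrable lborel {0..1} f"
    unfolding set_integrable_def using meas
    by (intro integrableI_bounded_set_indicator[where B="(\<Sum>n=1..N. norm (x n))\<^sup>2"]) auto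
  then have "(LINT t:{0..1}|lborel. f t) = integral {0..1} f"
    by (rule set_borel_integral_eq_integral)
  also have "\<dots> = mean_sq {1..N} {1..N} x"
    using has_integral_rademacher_sum[where z=0 and k=0 and N=N and x=x]
    by (intro integral_unique) (simp add: f_def[abs_def] mean_sq_def card_signs)
  finally show ?thesis by (simp add: f_def)
qed

theorem summing_identity_imp_has_cotype:
  assumes q: "2 < q" and s: "0 < s" "s < q" "summing_identity TYPE('a::real_normed_vector) s"
  shows "has_cotype TYPE('a) (ereal q)"
proof -
  obtain C where C: "\<And>I (x :: nat \<Rightarrow> 'a). finite I \<Longrightarrow>
    (\<Sum>i\<in>I. norm (x i) powr q) \<le> C * mean_sq I I x powr (q / 2)"
    using summing_identity_imp_mean_cotype[OF q s] by blast
  define D where "D = max C 1 powr (1 / q)"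
  have "cotype_lhs (ereal q) N x \<le> D * sqrt (LINT t:{0..1}|lborel. (norm (\<Sum>n=1..N. rademacher n t *\<^sub>R x n))\<^sup>2)"
    for N and x :: "nat \<Rightarrow> 'a"
  proof -
    define m where "m = mean_sq {1..N} {1..N} x"
    have m: "m \<ge> 0" by (simp add: m_def mean_sq_nonneg)
    have "(\<Sum>n=1..N. norm (x n) powr q) \<le> C * m powr (q / 2)"
      using C[of "{1..N}" x] by (simp add: m_def)
    also have "\<dots> \<le> max C 1 * m powr (q / 2)" by (intro mult_right_mono) auto
    finally have "(\<Sum>n=1..N. norm (x n) powr q) powr (1 / q) \<le> (max C 1 * m powr (q / 2)) powr (1 / q)"
      using q by (intro powr_mono2) (auto intro: sum_nonneg)
    also have "\<dots> = D * sqrt m"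
      using q m by (simp add: D_def powr_mult powr_powr powr_half_sqrt)
    finally show ?thesis
      unfolding rademacher_integral cotype_lhs_def m_def[symmetric] by simp
  qed
  moreover have "D > 0" by (simp add: D_def)
  ultimately show ?thesis unfolding has_cotype_def by blast
qed

section \<open>Upper bound for the gap\<close>

lemma cmod_Suc_powr: "cmod (of_nat (Suc n) powr (- s)) = real (Suc n) powr (- Re s)"
  using norm_powr_real_powr[of "of_nat (Suc n)" "- s"] by (simp del: of_nat_Suc)

lemma abscissa_abs_conv_real:
  "abscissa_abs_conv a =
     Inf {ereal r | r. \<forall>\<sigma>>r. summable (\<lambda>n. norm (a (Suc n)) * real (Suc n) powr (- \<sigma>))}"
proof -
  have "(\<forall>s. Re s > r \<longrightarrow> summable (\<lambda>n. norm (a (Suc n)) * cmod (of_nat (Suc n) powr (- s))))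
      \<longleftrightarrow> (\<forall>\<sigma>>r. summable (\<lambda>n. norm (a (Suc n)) * real (Suc n) powr (- \<sigma>)))" (is "?L \<longleftrightarrow> ?R") for r
  proof
    assume L: ?L
    show ?R
    proof (intro allI impI)
      fix \<sigma> assume "r < \<sigma>"
      then show "summable (\<lambda>n. norm (a (Suc n)) * real (Suc n) powr (- \<sigma>))"
        using L[rule_format, of "complex_of_real \<sigma>"] unfolding cmod_Suc_powr by simp
    qed
  qed (simp add: cmod_Suc_powr del: of_nat_Suc)
  then show ?thesis unfolding abscissa_abs_conv_def by simp
qed

lemma abscissa_abs_conv_lessD:
  assumes "abscissa_abs_conv a < ereal \<sigma>"
  shows "summable (\<lambda>n. norm (a (Suc n)) * real (Suc n) powr (- \<sigma>))"
  using assms unfolding abscissa_abs_conv_real Inf_less_iff by auto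

lemma abscissa_abs_conv_leI:
  assumes "\<And>\<sigma>. r < \<sigma> \<Longrightarrow> summable (\<lambda>n. norm (a (Suc n)) * real (Suc n) powr (- \<sigma>))"
  shows "abscissa_abs_conv a \<le> ereal r"
  unfolding abscissa_abs_conv_real using assms by (intro Inf_lower) auto

lemma dual_space_bound:
  assumes "f \<in> dual_space"
  shows "\<exists>K>0. \<forall>x. cmod (f x) \<le> K * norm x"
proof -
  have "bounded_linear f" using assms by (simp add: dual_space_def)
  then show ?thesis using bounded_linear.pos_bounded by (metis mult.commute)
qed

lemma abscissa_weak_abs_conv_le: "abscissa_weak_abs_conv a \<le> abscissa_abs_conv a"
  unfolding abscissa_weak_abs_conv_def
proof (rule SUP_least)
  fix f :: "'a \<Rightarrow> complex" assume "f \<in> dual_space"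
  then obtain K where K: "K > 0" "\<And>x. cmod (f x) \<le> K * norm x"
    using dual_space_bound by blast
  have "summable (\<lambda>n. norm (f (a (Suc n))) * real (Suc n) powr (- \<sigma>))"
    if "summable (\<lambda>n. norm (a (Suc n)) * real (Suc n) powr (- \<sigma>))" for \<sigma>
  proof (rule summable_comparison_test[OF _ summable_mult[OF that, of K]], intro exI allI impI)
    fix n
    show "norm (norm (f (a (Suc n))) * real (Suc n) powr (- \<sigma>)) \<le> K * (norm (a (Suc n)) * real (Suc n) powr (- \<sigma>))"
      using mult_right_mono[OF K(2)[of "a (Suc n)"], of "real (Suc n) powr (- \<sigma>)"]
      by (simp add: abs_mult mult.assoc del: of_nat_Suc)
  qed
  then show "abscissa_abs_conv (\<lambda>n. f (a n)) \<le> abscissa_abs_conv a"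
    unfolding abscissa_abs_conv_real by (intro Inf_superset_mono) blast
qed

lemma summable_Suc_powr: "1 < e \<Longrightarrow> summable (\<lambda>n. real (Suc n) powr (- e))"
  using summable_Suc_iff[of "\<lambda>n. real n powr (- e)"] summable_real_powr_iff[of "- e"] by simp

text \<open>Convergence bounds the terms at exponent \<open>r + 1\<close>, which gives absolute
  convergence to the right of \<open>r + 2\<close>. This excludes the value
  \<open>\<infinity>\<close> in the gap estimate.\<close>

lemma abscissa_abs_conv_finite:
  fixes a :: "nat \<Rightarrow> 'a::complex_normed_vector"
  assumes "abscissa_conv a < \<infinity>"
  shows "abscissa_abs_conv a < \<infinity>"
proof -
  obtain r where r: "\<And>s. Re s > r \<Longrightarrow> summable (\<lambda>n. (of_nat (Suc n) powr (- s)) *\<^sub>C a (Suc n))"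
    using assms unfolding abscissa_conv_def Inf_less_iff by auto
  have "summable (\<lambda>n. (of_nat (Suc n) powr (- complex_of_real (r + 1))) *\<^sub>C a (Suc n))"
    by (rule r) simp
  then have "Bseq (\<lambda>n. (of_nat (Suc n) powr (- complex_of_real (r + 1))) *\<^sub>C a (Suc n))"
    by (rule convergent_imp_Bseq[OF convergentI[OF summable_LIMSEQ_zero]])
  then obtain M where M: "\<And>n. norm ((of_nat (Suc n) powr (- complex_of_real (r + 1))) *\<^sub>C a (Suc n)) \<le> M"
    by (auto simp: Bseq_def)
  have "abscissa_abs_conv a \<le> ereal (r + 2)"
  proof (rule abscissa_abs_conv_leI)
    fix \<sigma> assume \<sigma>: "r + 2 < \<sigma>"
    have "summable (\<lambda>n. M * real (Suc n) powr (- (\<sigma> - r - 1)))"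
      using \<sigma> by (intro summable_mult summable_Suc_powr) simp
    then show "summable (\<lambda>n. norm (a (Suc n)) * real (Suc n) powr (- \<sigma>))"
    proof (rule summable_comparison_test[rotated], intro exI allI impI)
      fix n
      have "real (Suc n) powr (- (r + 1)) * norm (a (Suc n)) \<le> M"
        using M[of n] unfolding norm_scaleC cmod_Suc_powr by simp
      then have "real (Suc n) powr (- (r + 1)) * norm (a (Suc n)) * real (Suc n) powr (- (\<sigma> - r - 1))
          \<le> M * real (Suc n) powr (- (\<sigma> - r - 1))" by (rule mult_right_mono) simp
      moreover have "real (Suc n) powr (- \<sigma>) = real (Suc n) powr (- (r + 1)) * real (Suc n) powr (- (\<sigma> - r - 1))"
        by (simp flip: powr_add)
      ultimately show "norm (norm (a (Suc n)) * real (Suc n) powr (- \<sigma>)) \<le> M * real (Suc n) powr (- (\<sigma> - r - 1))"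
        by (simp add: abs_mult mult_ac del: of_nat_Suc)
    qed
  qed
  then show ?thesis by (auto intro: le_less_trans)
qed

text \<open>The complex functional with real part \<open>g\<close>. It carries weak absolute
  convergence over to real functionals, for which the uniform boundedness argument is
  stated.\<close>

lemma complexify_functional:
  fixes g :: "'a::complex_normed_vector \<Rightarrow>\<^sub>L real"
  shows "(\<lambda>x. Complex (blinfun_apply g x) (- blinfun_apply g (\<i> *\<^sub>C x))) \<in> dual_space"
proof -
  have C: "c *\<^sub>C x = Re c *\<^sub>R x + Im c *\<^sub>R (\<i> *\<^sub>C x)" for c and x :: 'a
  proof -
    have "c = complex_of_real (Re c) + complex_of_real (Im c) * \<i>" by (simp add: complex_eq_iff)
    then have "c *\<^sub>C x = (complex_of_real (Re c) + complex_of_real (Im c) * \<i>) *\<^sub>C x" by simp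
    then show ?thesis by (simp only: scaleC_add_left scaleC_scaleC[symmetric] scaleC_of_real)
  qed
  have ii: "\<i> *\<^sub>C (\<i> *\<^sub>C x) = - x" for x :: 'a
    using scaleC_of_real[of "-1" x] by (simp add: scaleC_scaleC)
  have ic: "\<i> *\<^sub>C (c *\<^sub>R x) = c *\<^sub>R (\<i> *\<^sub>C x)" for c and x :: 'a
    by (simp add: scaleC_of_real[symmetric] scaleC_scaleC mult.commute)
  show ?thesis
    unfolding dual_space_def
  proof (intro CollectI conjI allI)
    show "bounded_linear (\<lambda>x. Complex (blinfun_apply g x) (- blinfun_apply g (\<i> *\<^sub>C x)))"
    proof (rule bounded_linear_intro[where K="2 * norm g"])
      fix x y :: 'a and c :: real
      show "Complex (blinfun_apply g (x + y)) (- blinfun_apply g (\<i> *\<^sub>C (x + y)))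
        = Complex (blinfun_apply g x) (- blinfun_apply g (\<i> *\<^sub>C x)) + Complex (blinfun_apply g y) (- blinfun_apply g (\<i> *\<^sub>C y))"
        by (simp add: complex_eq_iff blinfun.add_right scaleC_add_right)
      show "Complex (blinfun_apply g (c *\<^sub>R x)) (- blinfun_apply g (\<i> *\<^sub>C (c *\<^sub>R x)))
        = c *\<^sub>R Complex (blinfun_apply g x) (- blinfun_apply g (\<i> *\<^sub>C x))"
        by (simp add: complex_eq_iff ic blinfun.scaleR_right)
      have "norm (Complex (blinfun_apply g x) (- blinfun_apply g (\<i> *\<^sub>C x)))
          \<le> \<bar>blinfun_apply g x\<bar> + \<bar>blinfun_apply g (\<i> *\<^sub>C x)\<bar>"
        using cmod_le[of "Complex (blinfun_apply g x) (- blinfun_apply g (\<i> *\<^sub>C x))"] by simp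
      also have "\<dots> \<le> norm g * norm x + norm g * norm x"
        using norm_blinfun[of g x] norm_blinfun[of g "\<i> *\<^sub>C x"] by (simp add: norm_scaleC mult.commute)
      finally show "norm (Complex (blinfun_apply g x) (- blinfun_apply g (\<i> *\<^sub>C x))) \<le> norm x * (2 * norm g)"
        by simp
    qed
    fix c and x :: 'a
    have "\<i> *\<^sub>C (c *\<^sub>C x) = Re c *\<^sub>R (\<i> *\<^sub>C x) - Im c *\<^sub>R x"
      unfolding C[of c x] scaleC_add_right ic ii by simp
    then show "Complex (blinfun_apply g (c *\<^sub>C x)) (- blinfun_apply g (\<i> *\<^sub>C (c *\<^sub>C x)))
        = c * Complex (blinfun_apply g x) (- blinfun_apply g (\<i> *\<^sub>C x))"
      by (simp add: C[of c x] complex_eq_iff blinfun.add_right blinfun.diff_right blinfun.scaleR_right)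
  qed
qed

text \<open>A functional norming the signed sum is evaluated term by term, and the uniform bound
  applies to the absolute values.\<close>

lemma weakly_summable_signs_bound:
  fixes y :: "nat \<Rightarrow> 'a::real_normed_vector"
  assumes "\<And>g :: 'a \<Rightarrow>\<^sub>L real. summable (\<lambda>n. \<bar>blinfun_apply g (y n)\<bar>)"
  shows "\<exists>K\<ge>0. \<forall>N c. (\<forall>n<N. \<bar>c n\<bar> \<le> 1) \<longrightarrow> norm (\<Sum>n<N. c n *\<^sub>R y n) \<le> K"
proof -
  obtain K where K: "K \<ge> 0" "\<And>(g :: 'a \<Rightarrow>\<^sub>L real) N. (\<Sum>n<N. \<bar>blinfun_apply g (y n)\<bar>) \<le> K * norm g"
    using weakly_summable_bound[OF assms] by blast
  have "norm (\<Sum>n<N. c n *\<^sub>R y n) \<le> K" if c: "\<forall>n<N. \<bar>c n\<bar> \<le> 1" for N c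
  proof -
    obtain g :: "'a \<Rightarrow>\<^sub>L real" where g: "norm g \<le> 1"
      "blinfun_apply g (\<Sum>n<N. c n *\<^sub>R y n) = norm (\<Sum>n<N. c n *\<^sub>R y n)"
      by (rule norming_functional)
    have "norm (\<Sum>n<N. c n *\<^sub>R y n) = (\<Sum>n<N. c n * blinfun_apply g (y n))"
      unfolding g(2)[symmetric] by (simp add: blinfun.sum_right blinfun.scaleR_right)
    also have "\<dots> \<le> (\<Sum>n<N. \<bar>blinfun_apply g (y n)\<bar>)"
    proof (rule sum_mono)
      fix n assume "n \<in> {..<N}"
      then have "\<bar>c n\<bar> * \<bar>blinfun_apply g (y n)\<bar> \<le> 1 * \<bar>blinfun_apply g (y n)\<bar>"
        using c by (intro mult_right_mono) auto
      then show "c n * blinfun_apply g (y n) \<le> \<bar>blinfun_apply g (y n)\<bar>"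
        by (simp add: abs_mult[symmetric])
    qed
    also have "\<dots> \<le> K * norm g" by (rule K)
    also have "\<dots> \<le> K * 1" using K(1) g(1) by (rule mult_left_mono[rotated])
    finally show ?thesis by simp
  qed
  then show ?thesis using K(1) by blast
qed

lemma cotype_weakly_summable:
  fixes y :: "nat \<Rightarrow> 'a::real_normed_vector"
  assumes cotype: "has_cotype TYPE('a) (ereal q)" and q: "0 < q"
    and y: "\<And>g :: 'a \<Rightarrow>\<^sub>L real. summable (\<lambda>n. \<bar>blinfun_apply g (y n)\<bar>)"
  shows "summable (\<lambda>n. norm (y n) powr q)"
proof -
  obtain K where K: "K \<ge> 0" "\<And>N c. (\<forall>n<N. \<bar>c n\<bar> \<le> 1) \<Longrightarrow> norm (\<Sum>n<N. c n *\<^sub>R y n) \<le> K"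
    using weakly_summable_signs_bound[OF y] by blast
  obtain C where C: "C > 0" "\<And>N (x :: nat \<Rightarrow> 'a). cotype_lhs (ereal q) N x
          \<le> C * sqrt (LINT t:{0..1}|lborel. (norm (\<Sum>n=1..N. rademacher n t *\<^sub>R x n))\<^sup>2)"
    using cotype unfolding has_cotype_def by blast
  have "(\<Sum>n<N. norm (y n) powr q) \<le> (C * K) powr q" for N
  proof -
    \<comment> \<open>Families in the cotype inequality start at index 1, the sequence
      \<open>y\<close> at 0.\<close>
    define x where "x n = y (n - 1)" for n
    have shift: "(\<Sum>n=1..N. h n) = (\<Sum>n<N. h (Suc n))" for h :: "nat \<Rightarrow> 'b::comm_monoid_add"
      by (rule sum.reindex_bij_witness[of _ Suc "\<lambda>n. n - 1"]) auto
    have "mean_sq {1..N} {1..N} x \<le> (\<Sum>\<epsilon>\<in>signs {1..N}. K\<^sup>2) / card (signs {1..N})"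
      unfolding mean_sq_def
    proof (intro divide_right_mono sum_mono power_mono)
      fix \<epsilon> assume \<epsilon>: "\<epsilon> \<in> signs {1..N}"
      show "norm (\<Sum>n=1..N. \<epsilon> n *\<^sub>R x n) \<le> K"
        unfolding shift using signs_abs[OF \<epsilon>] by (auto simp: x_def intro!: K(2))
    qed auto
    then have "mean_sq {1..N} {1..N} x \<le> K\<^sup>2" using card_signs_pos[of "{1..N}"] by simp
    then have "sqrt (mean_sq {1..N} {1..N} x) \<le> K" using K(1) by (simp add: real_le_lsqrt)
    then have "cotype_lhs (ereal q) N x \<le> C * K"
      using C(2)[of N x] mult_left_mono[of "sqrt (mean_sq {1..N} {1..N} x)" K C] C(1)
      unfolding rademacher_integral by linarith
    then have "(\<Sum>n<N. norm (y n) powr q) powr (1 / q) \<le> C * K"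
      by (simp add: cotype_lhs_def shift x_def del: One_nat_def)
    then have "((\<Sum>n<N. norm (y n) powr q) powr (1 / q)) powr q \<le> (C * K) powr q"
      using q by (intro powr_mono2) auto
    then show ?thesis using q by (simp add: powr_powr sum_nonneg)
  qed
  then show ?thesis by (intro summableI_nonneg_bounded) auto
qed

lemma abscissa_abs_conv_le_cotype:
  fixes a :: "nat \<Rightarrow> 'a::complex_normed_vector"
  assumes cotype: "has_cotype TYPE('a) (ereal q)" and q: "1 < q"
    and r: "abscissa_weak_abs_conv a < ereal r"
  shows "abscissa_abs_conv a \<le> ereal (r + 1 - 1 / q)"
proof (rule abscissa_abs_conv_leI)
  define y where "y n = real (Suc n) powr (- r) *\<^sub>R a (Suc n)" for n
  have "summable (\<lambda>n. \<bar>blinfun_apply g (y n)\<bar>)" for g :: "'a \<Rightarrow>\<^sub>L real"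
  proof -
    define f where "f x = Complex (blinfun_apply g x) (- blinfun_apply g (\<i> *\<^sub>C x))" for x
    have "f \<in> dual_space" using complexify_functional[of g] by (simp add: f_def[abs_def])
    then have "abscissa_abs_conv (\<lambda>n. f (a n)) \<le> abscissa_weak_abs_conv a"
      unfolding abscissa_weak_abs_conv_def by (rule SUP_upper)
    then have "summable (\<lambda>n. norm (f (a (Suc n))) * real (Suc n) powr (- r))"
      using r by (intro abscissa_abs_conv_lessD) (rule le_less_trans)
    then show ?thesis
    proof (rule summable_comparison_test[rotated], intro exI allI impI)
      fix n
      have "\<bar>blinfun_apply g (a (Suc n))\<bar> \<le> norm (f (a (Suc n)))"
        using abs_Re_le_cmod[of "f (a (Suc n))"] by (simp add: f_def)
      then show "norm \<bar>blinfun_apply g (y n)\<bar> \<le> norm (f (a (Suc n))) * real (Suc n) powr (- r)"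
        by (simp add: y_def blinfun.scaleR_right abs_mult mult.commute mult_right_mono del: of_nat_Suc)
    qed
  qed
  then have y: "summable (\<lambda>n. norm (y n) powr q)"
    using q by (intro cotype_weakly_summable[OF cotype]) auto
  fix \<sigma> assume \<sigma>: "r + 1 - 1 / q < \<sigma>"
  \<comment> \<open>The conjugate exponent: \<open>r + 1 - 1 / q < \<sigma>\<close> says exactly
    that \<open>(\<sigma> - r) * q'\<close> exceeds 1, which makes the second term of Young's
    inequality summable.\<close>
  define q' where "q' = q / (q - 1)"
  have q': "q' > 0" "1 / q + 1 / q' = 1" using q by (auto simp: q'_def field_simps)
  have "(\<sigma> - r) * q' > 1"
  proof -
    have "1 / q' = 1 - 1 / q" using q' by simp
    then have "1 / q' < \<sigma> - r" using \<sigma> by simp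
    then show ?thesis using q' by (simp add: field_simps)
  qed
  then have "summable (\<lambda>n. norm (y n) powr q / q + real (Suc n) powr (- ((\<sigma> - r) * q')) / q')"
    by (intro summable_add summable_divide y summable_Suc_powr)
  then show "summable (\<lambda>n. norm (a (Suc n)) * real (Suc n) powr (- \<sigma>))"
  proof (rule summable_comparison_test[rotated], intro exI allI impI)
    fix n
    have "norm (a (Suc n)) * real (Suc n) powr (- \<sigma>) = norm (y n) * real (Suc n) powr (- (\<sigma> - r))"
      by (simp add: y_def powr_minus powr_diff field_simps del: of_nat_Suc)
    also have "\<dots> \<le> norm (y n) powr q / q + (real (Suc n) powr (- (\<sigma> - r))) powr q' / q'"
    proof (rule Youngs_inequality)
      show "1 < q'" using q by (simp add: q'_def)
    qed (use q q' in auto)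
    also have "(real (Suc n) powr (- (\<sigma> - r))) powr q' = real (Suc n) powr (- ((\<sigma> - r) * q'))"
      by (simp add: powr_powr algebra_simps del: of_nat_Suc)
    finally show "norm (norm (a (Suc n)) * real (Suc n) powr (- \<sigma>))
        \<le> norm (y n) powr q / q + real (Suc n) powr (- ((\<sigma> - r) * q')) / q'"
      by (simp add: abs_mult del: of_nat_Suc)
  qed
qed

theorem abs_conv_gap_le_cotype:
  fixes a :: "nat \<Rightarrow> 'a::complex_normed_vector"
  assumes cotype: "has_cotype TYPE('a) (ereal q)" and q: "1 < q" and a: "abscissa_conv a < \<infinity>"
  shows "abs_conv_gap a \<le> ereal (1 - 1 / q)"
proof -
  have le: "abscissa_abs_conv a \<le> ereal (r + 1 - 1 / q)" if "abscissa_weak_abs_conv a < ereal r" for r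
    by (rule abscissa_abs_conv_le_cotype[OF cotype q that])
  have "1 - 1 / q \<ge> 0" using q by simp
  show ?thesis
  proof (cases "abscissa_weak_abs_conv a")
    case (real w)
    have "abscissa_abs_conv a \<le> ereal (w + (1 - 1 / q))"
    proof (rule ereal_le_epsilon2)
      fix e :: real assume "0 < e"
      then show "abscissa_abs_conv a \<le> ereal (w + (1 - 1 / q)) + ereal e"
        using le[of "w + e"] real by (simp add: algebra_simps)
    qed
    then have "abscissa_abs_conv a - ereal w \<le> ereal (1 - 1 / q)"
      by (simp add: ereal_minus_le add.commute)
    then show ?thesis using real by (simp add: abs_conv_gap_def)
  next
    case PInf
    then have "abscissa_abs_conv a = \<infinity>" using abscissa_weak_abs_conv_le[of a] by simp
    then show ?thesis using abscissa_abs_conv_finite[OF a] by simp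
  next
    \<comment> \<open>The estimate then holds for every \<open>r\<close>, so both abscissas are
      \<open>- \<infinity>\<close> and the gap is 0 by convention.\<close>
    case MInf
    have "abscissa_abs_conv a \<le> ereal B" for B
      using le[of "B - 1 + 1 / q"] MInf by simp
    then have "abscissa_abs_conv a = -\<infinity>" by (rule ereal_bot)
    then show ?thesis using MInf \<open>1 - 1 / q \<ge> 0\<close> by (simp add: abs_conv_gap_def)
  qed
qed

section \<open>Lower bound for the gap\<close>

text \<open>After division by the bound \<open>B\<close>, the level lemma yields a dyadic level so
  rich that its norms, all above \<open>c / 2\<close>, are large compared with its
  cardinality.\<close>

lemma not_summing_identity_families:
  fixes q s :: real
  assumes not_summing: "\<not> summing_identity TYPE('a::real_normed_vector) q" and s: "0 < s" "s < q"
  shows "\<exists>N\<ge>n0. \<exists>x :: nat \<Rightarrow> 'a. 0 < N \<and> (\<forall>i<N. real N powr (- 1 / s) \<le> norm (x i) \<and> norm (x i) \<le> 1) \<and>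
    (\<forall>\<epsilon>. (\<forall>i. \<epsilon> i \<in> {-1, 1}) \<longrightarrow> norm (\<Sum>i<N. \<epsilon> i *\<^sub>R x i) \<le> 1)"
proof -
  \<comment> \<open>The term \<open>2 powr s\<close> turns \<open>R < n * c powr s\<close> into
    \<open>n powr (- 1 / s) \<le> c / 2\<close>; the term \<open>n0\<close> makes the family
    long.\<close>
  define R where "R = max (real n0) (max 1 (2 powr s))"
  have R: "R \<ge> real n0" "R \<ge> 1" "R \<ge> 2 powr s" by (auto simp: R_def)
  \<comment> \<open>The bound of \<open>dyadic_level_sum_le\<close>, so that violating the summing
    inequality with this constant forces a rich level.\<close>
  define C where "C = R * 1 powr (q - s) / (1 - 2 powr (s - q))"
  obtain N B and x :: "nat \<Rightarrow> 'a" where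
    signs_x: "\<forall>\<epsilon>. (\<forall>i. \<epsilon> i \<in> {-1, 1::real}) \<longrightarrow> norm (\<Sum>i<N. \<epsilon> i *\<^sub>R x i) \<le> B"
    and large: "C * B powr q < (\<Sum>i<N. norm (x i) powr q)"
    using not_summing unfolding summing_identity_def by (meson not_le)
  \<comment> \<open>Two sums that agree on \<open>A\<close> and have opposite signs elsewhere are
    averaged, which removes the terms outside \<open>A\<close>.\<close>
  have sub_le: "norm (\<Sum>i\<in>A. \<epsilon> i *\<^sub>R x i) \<le> B" if A: "A \<subseteq> {..<N}" and \<epsilon>: "\<And>i. i \<in> A \<Longrightarrow> \<epsilon> i \<in> {-1, 1}" for A \<epsilon>
  proof -
    define S where "S c = (\<Sum>i<N. (if i \<in> A then \<epsilon> i else c) *\<^sub>R x i)" for c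
    have "norm (S c) \<le> B" if "c \<in> {-1, 1}" for c
      unfolding S_def using that \<epsilon> by (intro signs_x[rule_format]) auto
    then have S: "norm (S 1) \<le> B" "norm (S (-1)) \<le> B" by auto
    have "S 1 + S (-1) = (\<Sum>i<N. if i \<in> A then (2 * \<epsilon> i) *\<^sub>R x i else 0)"
      unfolding S_def sum.distrib[symmetric] by (intro sum.cong) (auto simp flip: scaleR_add_left)
    also have "\<dots> = 2 *\<^sub>R (\<Sum>i\<in>A. \<epsilon> i *\<^sub>R x i)"
      using A by (simp add: sum.If_cases Int_absorb1 scaleR_sum_right)
    finally have "2 * norm (\<Sum>i\<in>A. \<epsilon> i *\<^sub>R x i) \<le> norm (S 1) + norm (S (-1))"
      using norm_triangle_ineq[of "S 1" "S (-1)"] by simp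
    then show ?thesis using S by linarith
  qed
  have x_le: "norm (x i) \<le> B" if "i < N" for i
    using sub_le[of "{i}" "\<lambda>_. 1"] that by simp
  have B: "B > 0"
  proof (rule ccontr)
    assume "\<not> B > 0"
    then have "norm (x i) = 0" if "i < N" for i using x_le[OF that] norm_ge_zero[of "x i"] by linarith
    then have "(\<Sum>i<N. norm (x i) powr q) = 0" by simp
    moreover have "B = 0"
      using \<open>\<not> B > 0\<close> sub_le[of "{}"] by simp
    ultimately show False using large by simp
  qed
  define w where "w i = norm (x i) / B" for i
  have "\<exists>c. 0 < c \<and> c \<le> 1 \<and> R < card {i \<in> {..<N}. c / 2 < w i \<and> w i \<le> c} * c powr s"
  proof (rule ccontr)
    assume "\<not> ?thesis"
    then have level: "card {i \<in> {..<N}. c / 2 < w i \<and> w i \<le> c} * c powr s \<le> R" if "0 < c" "c \<le> 1" for c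
      using that by (meson not_le)
    have "(\<Sum>i<N. w i powr q) \<le> C"
      unfolding C_def using level R s B x_le
      by (intro dyadic_level_sum_le) (auto simp: w_def)
    moreover have "(\<Sum>i<N. w i powr q) = (\<Sum>i<N. norm (x i) powr q) / B powr q"
      using B by (simp add: w_def powr_divide sum_divide_distrib)
    ultimately show False using large B by (simp add: field_simps)
  qed
  then obtain c where c: "0 < c" "c \<le> 1" and card: "R < card {i \<in> {..<N}. c / 2 < w i \<and> w i \<le> c} * c powr s"
    by blast
  define A where "A = {i \<in> {..<N}. c / 2 < w i \<and> w i \<le> c}"
  define n where "n = card A"
  have RA: "R < n * c powr s" using card by (simp add: A_def n_def)
  have "c powr s \<le> 1" using c s powr_mono2[of s c 1] by simp
  then have "real n * c powr s \<le> real n * 1" by (intro mult_left_mono) auto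
  then have Rn: "R < n" using RA by simp
  have n: "n \<ge> n0" "n > 0" using Rn R by (auto intro: gr0I)
  obtain h where h: "bij_betw h {0..<n} A"
    using ex_bij_betw_nat_finite[of A] by (auto simp: A_def n_def)
  then have h: "bij_betw h {..<n} A" by (simp add: atLeast0LessThan)
  define y where "y i = x (h i) /\<^sub>R B" for i
  have norm_y: "norm (y i) = w (h i)" for i using B by (simp add: y_def w_def divide_inverse_commute)
  have hA: "h i \<in> A" if "i < n" for i using h that by (auto dest: bij_betwE)
  have lower: "real n powr (- 1 / s) \<le> c / 2"
  proof -
    have "2 powr s / n \<le> c powr s" using RA R(3) n by (simp add: field_simps)
    then have "(2 powr s / n) powr (1 / s) \<le> (c powr s) powr (1 / s)"
      using s by (intro powr_mono2) auto
    then have "2 / real n powr (1 / s) \<le> c" using s c n by (simp add: powr_powr powr_divide)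
    then show ?thesis using n by (simp add: powr_minus field_simps)
  qed
  have "real n powr (- 1 / s) \<le> norm (y i) \<and> norm (y i) \<le> 1" if "i < n" for i
    using hA[OF that] lower c by (auto simp: norm_y A_def)
  moreover have "norm (\<Sum>i<n. \<epsilon> i *\<^sub>R y i) \<le> 1" if \<epsilon>: "\<forall>i. \<epsilon> i \<in> {-1, 1}" for \<epsilon>
  proof -
    define g where "g = the_inv_into {..<n} h"
    have gh: "g (h i) = i" if "i < n" for i
      unfolding g_def using h that by (intro the_inv_into_f_f) (auto simp: bij_betw_def)
    have "(\<Sum>i<n. \<epsilon> i *\<^sub>R y i) = (\<Sum>i<n. \<epsilon> (g (h i)) *\<^sub>R x (h i)) /\<^sub>R B"
      by (simp add: y_def scaleR_sum_right gh mult.commute)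
    also have "(\<Sum>i<n. \<epsilon> (g (h i)) *\<^sub>R x (h i)) = (\<Sum>k\<in>A. \<epsilon> (g k) *\<^sub>R x k)"
      by (rule sum.reindex_bij_betw[OF h])
    finally have "norm (\<Sum>i<n. \<epsilon> i *\<^sub>R y i) = norm (\<Sum>k\<in>A. \<epsilon> (g k) *\<^sub>R x k) / B"
      using B by (simp add: divide_inverse_commute)
    also have "\<dots> \<le> B / B"
      using \<epsilon> B by (intro divide_right_mono sub_le) (auto simp: A_def)
    finally show ?thesis using B by simp
  qed
  ultimately show ?thesis using n by blast
qed

text \<open>With signs adapted to the real parts, their absolute sum becomes a value at one signed
  sum; the imaginary parts are treated separately, whence the factor 2.\<close>

lemma dual_sum_le:
  assumes f: "f \<in> dual_space" "\<And>x. cmod (f x) \<le> K * norm x"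
    and x: "\<And>\<epsilon>. (\<And>i. \<epsilon> i \<in> {-1, 1::real}) \<Longrightarrow> norm (\<Sum>i<N. \<epsilon> i *\<^sub>R x i) \<le> 1" and K: "0 \<le> K"
  shows "(\<Sum>i<N. cmod (f (x i))) \<le> 2 * K"
proof -
  have lin: "linear f" using f(1) by (simp add: dual_space_def bounded_linear.linear)
  have part: "(\<Sum>i<N. \<bar>P (f (x i))\<bar>) \<le> K" if P: "linear P" "\<And>z. \<bar>P z\<bar> \<le> cmod z" for P :: "complex \<Rightarrow> real"
  proof -
    define \<epsilon> where "\<epsilon> i = (if 0 \<le> P (f (x i)) then 1 else -1 :: real)" for i
    have "(\<Sum>i<N. \<bar>P (f (x i))\<bar>) = (\<Sum>i<N. \<epsilon> i * P (f (x i)))"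
      by (intro sum.cong) (auto simp: \<epsilon>_def)
    also have "\<dots> = P (f (\<Sum>i<N. \<epsilon> i *\<^sub>R x i))"
      by (simp add: linear_sum[OF lin] linear_sum[OF P(1)] linear_cmul[OF lin] linear_cmul[OF P(1)])
    also have "\<dots> \<le> cmod (f (\<Sum>i<N. \<epsilon> i *\<^sub>R x i))" using P(2) abs_le_D1 by blast
    also have "\<dots> \<le> K * norm (\<Sum>i<N. \<epsilon> i *\<^sub>R x i)" by (rule f(2))
    also have "\<dots> \<le> K * 1" using K by (intro mult_left_mono x) (auto simp: \<epsilon>_def)
    finally show ?thesis by simp
  qed
  have "(\<Sum>i<N. cmod (f (x i))) \<le> (\<Sum>i<N. \<bar>Re (f (x i))\<bar> + \<bar>Im (f (x i))\<bar>)"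
    by (intro sum_mono cmod_le)
  also have "\<dots> \<le> K + K"
    unfolding sum.distrib
    by (intro add_mono part abs_Re_le_cmod abs_Im_le_cmod)
      (simp_all add: bounded_linear.linear bounded_linear_Re bounded_linear_Im)
  finally show ?thesis by simp
qed

theorem abs_conv_gap_ge:
  fixes q s :: real
  assumes not_summing: "\<not> summing_identity TYPE('a::complex_banach) q" and s: "1 < s" "s < q"
  shows "\<exists>a :: nat \<Rightarrow> 'a. abscissa_conv a < \<infinity> \<and> ereal (1 - 1 / s) \<le> abs_conv_gap a"
proof -
  define fam where "fam N x \<longleftrightarrow> 0 < N \<and> (\<forall>i<N. real N powr (- 1 / s) \<le> norm (x i) \<and> norm (x i) \<le> 1) \<and>
    (\<forall>\<epsilon>. (\<forall>i. \<epsilon> i \<in> {-1, 1}) \<longrightarrow> norm (\<Sum>i<N. \<epsilon> i *\<^sub>R x i) \<le> 1)" for N and x :: "nat \<Rightarrow> 'a"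
  have "\<exists>N x. n \<le> N \<and> fam N x" for n
    using not_summing_identity_families[OF not_summing, of s n] s unfolding fam_def by auto
  then obtain len vec where fam: "\<And>n. n \<le> len n" "\<And>n. fam (len n) (vec n)" by metis
  \<comment> \<open>Each family is requested at least twice as long as the previous one, which makes
    the blocks \<open>{M k..<2 * M k}\<close> disjoint and \<open>M k\<close> at least
    \<open>2 ^ k\<close>.\<close>
  define st where "st = rec_nat (0::nat) (\<lambda>_ n. 2 * len n)"
  define M where "M k = len (st k)" for k
  define x where "x k = vec (st k)" for k
  have famM: "fam (M k) (x k)" for k using fam by (simp add: M_def x_def)
  have M_pos: "0 < M k" for k using famM[of k] by (simp add: fam_def)
  have M_Suc: "2 * M k \<le> M (Suc k)" for k using fam(1)[of "st (Suc k)"] by (simp add: M_def st_def)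
  have M_mono: "2 * M k \<le> M l" if "k < l" for k l
  proof -
    have "mono M" using M_Suc M_pos by (intro mono_iff_le_Suc[THEN iffD2]) (metis add_leE mult_2)
    then show ?thesis using M_Suc[of k] monoD[of M "Suc k" l] that by simp
  qed
  have M_ge: "2 ^ k \<le> M k" for k
  proof (induction k)
    case 0
    show ?case using M_pos[of 0] by simp
  next
    case (Suc k)
    then show ?case using M_Suc[of k] by simp
  qed
  define block where "block k = {M k..<2 * M k}" for k
  have block_unique: "k = l" if "n \<in> block k" "n \<in> block l" for n k l
    using that M_mono[of k l] M_mono[of l k] by (cases k l rule: linorder_cases) (auto simp: block_def)
  define a where "a n = (if \<exists>k. n \<in> block k then x (THE k. n \<in> block k) (n - M (THE k. n \<in> block k)) else 0)" for n
  have a_block: "a n = x k (n - M k)" if "n \<in> block k" for n k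
  proof -
    have "(THE k. n \<in> block k) = k" using that block_unique by blast
    then show ?thesis using that by (auto simp: a_def)
  qed
  have a_le: "norm (a n) \<le> 1" for n
  proof (cases "\<exists>k. n \<in> block k")
    case True
    then obtain k where k: "n \<in> block k" by blast
    then have "n - M k < M k" by (auto simp: block_def)
    then show ?thesis using famM[of k] a_block[OF k] by (simp add: fam_def)
  qed (simp add: a_def)
  have sum_block: "(\<Sum>n\<in>block k. u (a n)) = (\<Sum>i<M k. u (x k i))" for k and u :: "'a \<Rightarrow> real"
  proof -
    have "(\<Sum>n\<in>block k. u (a n)) = (\<Sum>n\<in>block k. u (x k (n - M k)))"
      by (intro sum.cong) (auto simp: a_block)
    also have "\<dots> = (\<Sum>i<M k. u (x k i))"
      by (rule sum.reindex_bij_witness[of _ "\<lambda>i. i + M k" "\<lambda>n. n - M k"]) (auto simp: block_def)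
    finally show ?thesis .
  qed
  have "abscissa_conv a \<le> ereal 1"
    unfolding abscissa_conv_def
  proof (rule Inf_lower, intro CollectI exI[of _ 1] conjI refl allI impI)
    fix z assume z: "1 < Re z"
    show "summable (\<lambda>n. (of_nat (Suc n) powr (- z)) *\<^sub>C a (Suc n))"
    proof (rule summable_comparison_test[OF _ summable_Suc_powr[OF z]], intro exI allI impI)
      fix n
      show "norm ((of_nat (Suc n) powr (- z)) *\<^sub>C a (Suc n)) \<le> real (Suc n) powr (- Re z)"
        unfolding norm_scaleC cmod_Suc_powr using a_le[of "Suc n"] by (intro mult_left_le) auto
    qed
  qed
  then have conv: "abscissa_conv a < \<infinity>" by (auto intro: le_less_trans)
  \<comment> \<open>By \<open>dual_sum_le\<close> every functional has absolute sum at most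
    \<open>2 * K\<close> on each block, so for positive \<open>\<sigma>\<close> the blocks are
    dominated by a geometric series.\<close>
  have weak: "abscissa_weak_abs_conv a \<le> 0"
    unfolding abscissa_weak_abs_conv_def
  proof (rule SUP_least)
    fix f :: "'a \<Rightarrow> complex" assume f: "f \<in> dual_space"
    then obtain K where K: "K > 0" "\<And>x. cmod (f x) \<le> K * norm x"
      using dual_space_bound by blast
    have f0: "f 0 = 0" using K(2)[of 0] by simp
    have "abscissa_abs_conv (\<lambda>n. f (a n)) \<le> ereal 0"
    proof (rule abscissa_abs_conv_leI)
      fix \<sigma> :: real assume \<sigma>: "0 < \<sigma>"
      define u where "u n = cmod (f (a n)) * real n powr (- \<sigma>)" for n
      have u_nonneg: "u n \<ge> 0" for n by (simp add: u_def)
      define \<rho> where "\<rho> = (2::real) powr (- \<sigma>)"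
      have \<rho>: "0 < \<rho>" "\<rho> < 1" using \<sigma> powr_less_one[of 2 "- \<sigma>"] by (auto simp: \<rho>_def)
      have block_le: "(\<Sum>n\<in>block k. u n) \<le> 2 * K * \<rho> ^ k" for k
      proof -
        have pow: "real n powr (- \<sigma>) \<le> \<rho> ^ k" if "n \<in> block k" for n
        proof -
          have "2 ^ k \<le> n" using that M_ge[of k] by (auto simp: block_def)
          then have "(2::real) ^ k \<le> real n" by (metis of_nat_le_iff of_nat_numeral of_nat_power)
          then have "real n powr (- \<sigma>) \<le> (2 ^ k) powr (- \<sigma>)"
            using \<sigma> by (intro powr_mono2') auto
          also have "\<dots> = \<rho> ^ k"
            by (simp add: \<rho>_def powr_realpow[symmetric] powr_powr mult.commute)
          finally show ?thesis .
        qed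
        have "(\<Sum>n\<in>block k. u n) \<le> (\<Sum>n\<in>block k. cmod (f (a n)) * \<rho> ^ k)"
          unfolding u_def using pow by (intro sum_mono mult_left_mono) auto
        also have "\<dots> = (\<Sum>i<M k. cmod (f (x k i))) * \<rho> ^ k"
          using sum_block[of "\<lambda>v. cmod (f v)" k] by (simp flip: sum_distrib_right)
        also have "\<dots> \<le> 2 * K * \<rho> ^ k"
          using famM[of k] K \<rho> by (intro mult_right_mono dual_sum_le[OF f]) (auto simp: fam_def)
        finally show ?thesis .
      qed
      show "summable (\<lambda>n. norm (f (a (Suc n))) * real (Suc n) powr (- \<sigma>))"
      proof (rule summableI_nonneg_bounded[where x="2 * K * (1 / (1 - \<rho>))"])
        fix m
        have "(\<Sum>n<m. norm (f (a (Suc n))) * real (Suc n) powr (- \<sigma>)) = (\<Sum>n\<in>{1..m}. u n)"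
          unfolding u_def by (rule sum.reindex_bij_witness[of _ "\<lambda>n. n - 1" Suc]) auto
        \<comment> \<open>A nonzero term of index at most \<open>m\<close> lies in a block
          \<open>k\<close> with \<open>k < 2 ^ k \<le> m\<close>.\<close>
        also have "\<dots> \<le> (\<Sum>n\<in>(\<Union>k\<in>{..m}. block k). u n)"
        proof -
          have "(\<Sum>n\<in>{1..m}. u n) = (\<Sum>n\<in>{n\<in>{1..m}. u n \<noteq> 0}. u n)"
            by (rule sum.mono_neutral_right) auto
          also have "\<dots> \<le> (\<Sum>n\<in>(\<Union>k\<in>{..m}. block k). u n)"
          proof (rule sum_mono2)
            show "{n \<in> {1..m}. u n \<noteq> 0} \<subseteq> (\<Union>k\<in>{..m}. block k)"
            proof
              fix n assume n: "n \<in> {n \<in> {1..m}. u n \<noteq> 0}"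
              then have "a n \<noteq> 0" using f0 by (auto simp: u_def)
              then obtain k where k: "n \<in> block k" by (auto simp: a_def split: if_splits)
              then have "2 ^ k \<le> n" using M_ge[of k] by (auto simp: block_def)
              moreover have "n \<le> m" using n by simp
              moreover have "k < 2 ^ k" by (rule less_exp)
              ultimately have "k \<le> m" by linarith
              then show "n \<in> (\<Union>k\<in>{..m}. block k)" using k by blast
            qed
          qed (use u_nonneg in \<open>auto simp: block_def\<close>)
          finally show ?thesis .
        qed
        also have "\<dots> = (\<Sum>k\<le>m. \<Sum>n\<in>block k. u n)"
        proof (rule sum.UNION_disjoint)
          show "\<forall>k\<in>{..m}. finite (block k)" by (simp add: block_def)
          show "\<forall>k\<in>{..m}. \<forall>l\<in>{..m}. k \<noteq> l \<longrightarrow> block k \<inter> block l = {}"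
            using block_unique by blast
        qed simp
        also have "\<dots> \<le> (\<Sum>k\<le>m. 2 * K * \<rho> ^ k)" by (intro sum_mono block_le)
        also have "\<dots> = 2 * K * (\<Sum>k<Suc m. \<rho> ^ k)"
          by (simp add: sum_distrib_left lessThan_Suc_atMost)
        also have "\<dots> \<le> 2 * K * (\<Sum>k. \<rho> ^ k)"
          using K \<rho> by (intro mult_left_mono sum_le_suminf) (auto simp: summable_geometric)
        also have "(\<Sum>k. \<rho> ^ k) = 1 / (1 - \<rho>)" using \<rho> by (intro suminf_geometric) auto
        finally show "(\<Sum>n<m. norm (f (a (Suc n))) * real (Suc n) powr (- \<sigma>)) \<le> 2 * K * (1 / (1 - \<rho>))" .
      qed simp
    qed
    then show "abscissa_abs_conv (\<lambda>n. f (a n)) \<le> 0" by (simp add: zero_ereal_def)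
  qed
  have s1: "1 - 1 / s > 0" using s by simp
  \<comment> \<open>For \<open>\<sigma>\<close> below \<open>1 - 1 / s\<close>, block
    \<open>k\<close> contributes at least
    \<open>2 powr (- \<sigma>) * M k powr (1 - 1 / s - \<sigma>)\<close>, hence at least
    \<open>2 powr (- \<sigma>)\<close>, against the Cauchy criterion.\<close>
  have strong: "ereal (1 - 1 / s) \<le> abscissa_abs_conv a"
  proof (rule ccontr)
    assume "\<not> ?thesis"
    then have lt: "abscissa_abs_conv a < ereal (1 - 1 / s)" by simp
    \<comment> \<open>The maximum with 0 yields a positive \<open>\<sigma>\<close>, for which
      \<open>n powr (- \<sigma>)\<close> is decreasing.\<close>
    then have "max (abscissa_abs_conv a) 0 < ereal (1 - 1 / s)" using s1 by (simp add: zero_ereal_def)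
    then obtain \<sigma> where \<sigma>: "max (abscissa_abs_conv a) 0 < ereal \<sigma>" "ereal \<sigma> < ereal (1 - 1 / s)"
      using ereal_dense2 by blast
    then have \<sigma>1: "abscissa_abs_conv a < ereal \<sigma>" "0 < \<sigma>" "\<sigma> < 1 - 1 / s" by (auto simp: zero_ereal_def)
    define v where "v n = norm (a (Suc n)) * real (Suc n) powr (- \<sigma>)" for n
    have "summable v" unfolding v_def by (rule abscissa_abs_conv_lessD[OF \<sigma>1(1)])
    moreover have "2 powr (- \<sigma>) > (0::real)" by simp
    ultimately obtain m where m: "\<And>i j. i \<ge> m \<Longrightarrow> norm (sum v {i..<j}) < 2 powr (- \<sigma>)"
      unfolding summable_Cauchy by blast
    define k where "k = Suc m"
    \<comment> \<open>The term \<open>v n\<close> belongs to the coefficient of index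
      \<open>Suc n\<close>, so the block is shifted by one.\<close>
    have "m \<le> M k - 1"
    proof -
      have "k < 2 ^ k" by (rule less_exp)
      then show ?thesis using M_ge[of k] by (simp add: k_def)
    qed
    then have "norm (sum v {M k - 1..<2 * M k - 1}) < 2 powr (- \<sigma>)" by (rule m)
    moreover have "sum v {M k - 1..<2 * M k - 1} = (\<Sum>n\<in>block k. norm (a n) * real n powr (- \<sigma>))"
      unfolding v_def block_def using M_pos[of k]
      by (intro sum.reindex_bij_witness[of _ "\<lambda>n. n - 1" Suc]) auto
    ultimately have small: "(\<Sum>n\<in>block k. norm (a n) * real n powr (- \<sigma>)) < 2 powr (- \<sigma>)" by simp
    have "2 powr (- \<sigma>) * real (M k) powr (- \<sigma>) * norm (a n) \<le> norm (a n) * real n powr (- \<sigma>)"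
      if "n \<in> block k" for n
    proof -
      have "(2 * real (M k)) powr (- \<sigma>) \<le> real n powr (- \<sigma>)"
        using that \<sigma>1 M_pos[of k] by (intro powr_mono2') (auto simp: block_def)
      then show ?thesis by (simp add: powr_mult mult_left_mono mult.commute)
    qed
    from le_less_trans[OF sum_mono[of "block k", OF this] small]
    have "(\<Sum>n\<in>block k. 2 powr (- \<sigma>) * real (M k) powr (- \<sigma>) * norm (a n)) < 2 powr (- \<sigma>)" .
    then have "2 powr (- \<sigma>) * real (M k) powr (- \<sigma>) * (\<Sum>i<M k. norm (x k i)) < 2 powr (- \<sigma>)"
      unfolding sum_distrib_left[symmetric] sum_block[of norm k] .
    moreover have "real (M k) * real (M k) powr (- 1 / s) \<le> (\<Sum>i<M k. norm (x k i))"
      using sum_mono[of "{..<M k}" "\<lambda>_. real (M k) powr (- 1 / s)" "\<lambda>i. norm (x k i)"] famM[of k]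
      by (simp add: fam_def)
    then have "2 powr (- \<sigma>) * real (M k) powr (- \<sigma>) * (real (M k) * real (M k) powr (- 1 / s))
        \<le> 2 powr (- \<sigma>) * real (M k) powr (- \<sigma>) * (\<Sum>i<M k. norm (x k i))"
      by (intro mult_left_mono) auto
    ultimately have "2 powr (- \<sigma>) * (real (M k) powr (- \<sigma>) * (real (M k) * real (M k) powr (- 1 / s))) < 2 powr (- \<sigma>) * 1"
      by simp
    then have "real (M k) powr (- \<sigma>) * (real (M k) * real (M k) powr (- 1 / s)) < 1" by simp
    moreover have "real (M k) powr (- \<sigma>) * (real (M k) * real (M k) powr (- 1 / s)) = real (M k) powr (1 - 1 / s - \<sigma>)"
      using M_pos[of k] by (simp add: powr_diff powr_minus powr_add field_simps)
    moreover have "1 \<le> real (M k) powr (1 - 1 / s - \<sigma>)"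
      using M_pos[of k] \<sigma>1 by (intro ge_one_powr_ge_zero) auto
    ultimately show False by simp
  qed
  have "ereal (1 - 1 / s) - 0 \<le> abscissa_abs_conv a - abscissa_weak_abs_conv a"
    by (intro ereal_minus_mono strong weak)
  then have "ereal (1 - 1 / s) \<le> abs_conv_gap a"
    using strong by (auto simp: abs_conv_gap_def)
  then show ?thesis using conv by blast
qed

section \<open>Combination of both bounds at the cotype index\<close>

theorem theorem3p6:
  fixes p :: real
  assumes "infinite_dimensional TYPE('a::complex_banach)"
    and "2 \<le> p"
    and "has_cotype TYPE('a) (ereal p)"
  shows "G_a TYPE('a) = 1 - 1 / Cot TYPE('a)"
proof -
  define S where "S = {q. 2 \<le> q \<and> has_cotype TYPE('a) q}"
  have Cot: "Cot TYPE('a) = Inf S" by (simp add: Cot_def S_def)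
  have "2 \<le> Cot TYPE('a)" unfolding Cot S_def by (rule Inf_greatest) simp
  moreover have "Cot TYPE('a) \<le> ereal p"
    unfolding Cot S_def using assms(2,3) by (intro Inf_lower) (simp add: numeral_eq_ereal)
  ultimately obtain c where c: "Cot TYPE('a) = ereal c" "2 \<le> c"
    by (cases "Cot TYPE('a)") (auto simp: numeral_eq_ereal)
  obtain B :: "'a set" where B: "independent B" "infinite B"
    using infinite_dimensional_independent[OF assms(1)] by blast
  have upper: "G_a TYPE('a) \<le> ereal (1 - 1 / q)" if q: "c < q" for q
  proof -
    obtain q0 where q0: "q0 \<in> S" "q0 < ereal q"
      using q c(1) Inf_less_iff[of S "ereal q"] unfolding Cot by auto
    then obtain t where t: "q0 = ereal t" "2 \<le> t" "t < q" "has_cotype TYPE('a) (ereal t)"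
      by (cases q0) (auto simp: S_def numeral_eq_ereal)
    have "abs_conv_gap a \<le> ereal (1 - 1 / t)" if "abscissa_conv a < \<infinity>" for a :: "nat \<Rightarrow> 'a"
      using t that by (intro abs_conv_gap_le_cotype) auto
    then have "G_a TYPE('a) \<le> ereal (1 - 1 / t)"
      unfolding G_a_def by (intro SUP_least) simp
    also have "1 - 1 / t \<le> 1 - 1 / q" using t by (simp add: frac_le)
    finally show ?thesis by simp
  qed
  \<comment> \<open>A summing exponent \<open>q < c\<close> would be at least 2 and would give
    cotype \<open>t\<close> for some \<open>t\<close> between \<open>q\<close> and \<open>c\<close>,
    against the definition of \<open>c\<close> as an infimum.\<close>
  have lower: "ereal (1 - 1 / s) \<le> G_a TYPE('a)" if s: "1 < s" "s < c" for s
  proof -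
    obtain q where q: "s < q" "q < c" using dense s by blast
    have "\<not> summing_identity TYPE('a) q"
    proof
      assume summing: "summing_identity TYPE('a) q"
      have q2: "2 \<le> q"
        using summing_identity_exponent_ge_2[OF B _ summing] q s by simp
      obtain t where t: "q < t" "t < c" using dense q by blast
      have "has_cotype TYPE('a) (ereal t)"
        using t q2 by (intro summing_identity_imp_has_cotype[OF _ _ _ summing]) auto
      then have "Cot TYPE('a) \<le> ereal t"
        unfolding Cot S_def using t q2 by (intro Inf_lower) (simp add: numeral_eq_ereal)
      then show False using c t by simp
    qed
    from abs_conv_gap_ge[OF this s(1) q(1)]
    obtain a :: "nat \<Rightarrow> 'a" where a: "abscissa_conv a < \<infinity>" "ereal (1 - 1 / s) \<le> abs_conv_gap a" by blast
    have "abs_conv_gap a \<le> G_a TYPE('a)" unfolding G_a_def using a(1) by (intro SUP_upper) simp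
    then show ?thesis using a(2) by (rule order_trans[rotated])
  qed
  \<comment> \<open>The infimum \<open>c\<close> may not be attained, so the bounds are obtained for
    exponents on either side of it and passed to the limit.\<close>
  have lim: "((\<lambda>q. ereal (1 - 1 / q)) \<longlongrightarrow> ereal (1 - 1 / c)) (at c within A)" for A
    using c(2) by (intro tendsto_ereal tendsto_intros) auto
  have "G_a TYPE('a) \<le> ereal (1 - 1 / c)"
  proof (rule tendsto_lowerbound[OF lim[of "{c<..}"]])
    show "\<forall>\<^sub>F q in at_right c. G_a TYPE('a) \<le> ereal (1 - 1 / q)"
      using upper by (auto simp: eventually_at_filter)
  qed simp
  moreover have "ereal (1 - 1 / c) \<le> G_a TYPE('a)"
  proof (rule tendsto_upperbound[OF lim[of "{..<c}"]])
    have "\<forall>\<^sub>F q in at_left c. q \<in> {1<..<c}"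
      using c(2) by (intro eventually_at_leftI[of 1]) auto
    then show "\<forall>\<^sub>F q in at_left c. ereal (1 - 1 / q) \<le> G_a TYPE('a)"
      by eventually_elim (simp add: lower)
  qed simp
  ultimately have "G_a TYPE('a) = ereal (1 - 1 / c)" by (rule antisym)
  then show ?thesis using c by (simp add: one_ereal_def)
qed

end
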